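(* Let $G$ be a rootless directed tree without leaves, with edges $\{e_i : i\in I\}$. Let $1<p<\infty$ and let $\rho=(\rho_i)_{i\in I}$ be a $p$-admissible weight, so that the left translation semigroup $(T_t)_{t\ge0}$ is strongly continuous on $L^p_\rho(L(G))$. Let $\mathcal F$ be a proper, finite invariant Furstenberg family on $\mathbb R_+$. For $i\in I$, $t\ge 0$, $s\in[0,1)$ put $$\Phi_i(t,s)=\Bigl(\sum_{j\in M_{n(t,s)}(i)}\rho_j(\sigma(t,s))^{-1/(p-1)}\Bigr)^{1-p},$$ $$\Psi_i(t,s)=\Bigl(\rho_{K_{n(t,s)}(i)}(s)^{-1/(p-1)}+\sum_{j\in M_{n(t,s)}(K_{n(t,s)}(i))}\rho_j(\sigma(t,s))^{-1/(p-1)}\Bigr)^{1-p},$$ where sums are taken in $[0,+\infty]$ and $(+\infty)^{1-p}=0$. For every finite nonempty set $K\subset I$, $\varepsilon>0$ and $0<\alpha<1$, define $$\mathcal N(K,\varepsilon,\alpha)=\Bigl\{t\ge0:\ \inf_{E\subset[0,1)\text{ measurable},\ m(E)>\alpha}\ \int_E\sum_{i\in K}\bigl(\Phi_i(t,s)+\Psi_i(t,s)\bigr)\,ds<\varepsilon\Bigr\},$$ where $m$ is Lebesgue measure. Then the following assertions are equivalent: (i) $(T_t)_{t\ge0}$ is $\mathcal F$-transitive on $L^p_\rho(L(G))$; (ii) for every finite nonempty set $K\subset I$, every $\varepsilon>0$ and every $0<\alpha<1$, one has $\mathcal N(K,\varepsilon,\alpha)\in\mathcal F$; (iii) $(T_t)_{t\ge0}$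 is topologically $\mathcal F$-recurrent on $L^p_\rho(L(G))$.
   Context: **Directed trees.** A directed tree is a directed graph $G=(V,E)$ that is connected (as an undirected graph), contains no cycles, in which every vertex $v$ has at most one parent (at most one $u\in V$ with $(u,v)\in E$), and with $V$ countable. If $(u,v)\in E$, then $u$ is the parent of $v$ and $v$ a child of $u$; $u$ is the tail and $v$ the head of the edge $(u,v)$. A leaf is a vertex without children, a root is a vertex without a parent; $G$ is rootless if it has no root. Write $E=\{e_i:i\in I\}$ with $I$ countable (distinct indices giving distinct edges). For $i\in I$ let $M_0(i)=\{i\}$ and $M_{n+1}(i)=\{j\in I:\text{the head of } e_k \text{ is the tail of } e_j \text{ for some } k\in M_n(i)\}$, $n\in\mathbb N_0$. When $G$ is rootless, for $i\in I$ and $n\in\mathbb N_0$, $K_n(i)\in I$ denotes the (unique, existing) index of the $n$-th ancestor edge of $e_i$: $K_0(i)=i$ and $i\in M_n(K_n(i))$. **Weighted spaces.** The directed metric tree $L(G)$ is obtained by replacing each edge by a copy of $[0,1)$, with coordinate increasing from tail to head. A function on $L(G)$ is identified with a family $f=(f_i)_{i\in I}$, $f_i:[0,1)\to\mathbb K$, where $\mathbb K=\mathbb R$ or $\mathbb C$. A weight is a family $\rho=(\rho_i)_{i\in I}$ with $\rho_i\in L^1([0,1))$ and $\rho_i(s)>0$ for every $s\in[0,1)$. For $1\le p<\infty$, $L^p_\rho(L(G))$ is the Banach space of (classes of a.e. equal) measurable families $f=(f_i)_{i\in I}$ with norm $\|f\|_{p,\rho}=\bigl(\sum_{i\in I}\int_0^1|f_i(s)|^p\rho_i(s)\,ds\bigr)^{1/p}<\infty$.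 **Left translation semigroup.** For $t\ge0$, $s\in[0,1)$ set $n(t,s)=\lfloor t+s\rfloor$ and $\sigma(t,s)=t+s-n(t,s)\in[0,1)$. For $t\ge 0$, $(T_tf)_i(s)=\sum_{j\in M_{n(t,s)}(i)}f_j(\sigma(t,s))$ for $i\in I$ and a.e. $s\in[0,1)$ (empty sums are $0$). **Admissibility.** For $1<p<\infty$, $\rho$ is $p$-admissible if there exist $M\ge1$ and $\omega\in\mathbb R$ such that for every $i\in I$, $t\ge0$, $s\in[0,1)$: $$\Bigl(\sum_{j\in M_{n(t,s)}(i)}\rho_j(\sigma(t,s))^{-1/(p-1)}\Bigr)^{p-1}\le M^pe^{p\omega t}\frac1{\rho_i(s)}.$$ It is known that if $\rho$ is $p$-admissible, then $(T_t)_{t\ge0}$ is a strongly continuous semigroup of bounded linear operators on $L^p_\rho(L(G))$ with $\|T_t\|\le Me^{\omega t}$. **Furstenberg families.** A Furstenberg family on $\mathbb R_+=[0,\infty)$ is a nonempty collection $\mathcal F$ of subsets of $\mathbb R_+$ such that $A\in\mathcal F$ and $A\subset B\subset\mathbb R_+$ imply $B\in\mathcal F$. It is proper if $\varnothing\notin\mathcal F$ (and $\mathcal F\ne\varnothing$), and finite invariant if $A\in\mathcal F$, $R>0$ imply $A\cap(R,\infty)\in\mathcal F$. For a semigroup $(T_t)_{t\ge0}$ on $X$ and nonempty open $U,V\subset X$, let $N(U,V)=\{t\ge0:T_t(U)\cap V\ne\varnothing\}$. The semigroup is $\mathcal F$-transitive if $N(U,V)\in\mathcal F$ for all nonempty open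 $U,V\subset X$, and topologically $\mathcal F$-recurrent if $N(U,U)\in\mathcal F$ for every nonempty open $U\subset X$. *)

theory Defs
  imports "HOL-Analysis.Analysis" "Graph_Theory.Graph_Theory"
begin

section \<open>Directed trees\<close>

text \<open>
  The index set of the edges of a digraph \<open>G\<close> is \<open>arcs G\<close>, and the edge with index \<open>i\<close> is
  \<open>(tail G i, head G i)\<close>; \<open>nomulti_digraph\<close> says that distinct indices give distinct edges.
  A \<open>tree\<close> in the sense of the graph library is a nonempty digraph which is connected as an
  undirected graph and has no directed cycle (a loop counts as a cycle). Together with uniqueness
  of parents this excludes undirected cycles as well, since an undirected cycle in which each
  vertex has at most one parent is consistently oriented.
\<close>

locale directed_tree = nomulti_digraph G for G :: "('v, 'i) pre_digraph" (structure) +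
  assumes tree: "tree G"
    and parent_unique: "\<lbrakk>u \<rightarrow> v; w \<rightarrow> v\<rbrakk> \<Longrightarrow> u = w"
    and countable_verts: "countable (verts G)"

definition rootless :: "('v, 'i) pre_digraph \<Rightarrow> bool" where
  "rootless G \<longleftrightarrow> (\<forall>v\<in>verts G. \<exists>u. u \<rightarrow>\<^bsub>G\<^esub> v)"

definition leafless :: "('v, 'i) pre_digraph \<Rightarrow> bool" where
  "leafless G \<longleftrightarrow> (\<forall>u\<in>verts G. \<exists>v. u \<rightarrow>\<^bsub>G\<^esub> v)"

primrec desc_edges :: "('v, 'i) pre_digraph \<Rightarrow> nat \<Rightarrow> 'i \<Rightarrow> 'i set" where
  "desc_edges G 0 i = {i}"
| "desc_edges G (Suc n) i = {j \<in> arcs G. \<exists>k\<in>desc_edges G n i. head G k = tail G j}"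

definition anc_edge :: "('v, 'i) pre_digraph \<Rightarrow> nat \<Rightarrow> 'i \<Rightarrow> 'i" where
  "anc_edge G n i = (THE k. k \<in> arcs G \<and> i \<in> desc_edges G n k)"


section \<open>Weighted spaces on the metric tree\<close>

text \<open>
  A family \<open>(f\<^sub>i)\<close> is a function \<open>'i \<Rightarrow> real \<Rightarrow> 'k\<close>, of which only the values at \<open>i \<in> arcs G\<close> and
  \<open>s \<in> [0,1)\<close> matter. Sums over index sets of terms in \<open>[0,\<infinity>]\<close> are written as integrals with
  respect to counting measure.
\<close>

abbreviation unit_meas :: "real measure" where
  "unit_meas \<equiv> lebesgue_on {0..<1}"

definition weight :: "('v, 'i) pre_digraph \<Rightarrow> ('i \<Rightarrow> real \<Rightarrow> real) \<Rightarrow> bool" where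
  "weight G \<rho> \<longleftrightarrow> (\<forall>i\<in>arcs G. integrable unit_meas (\<rho> i) \<and> (\<forall>s\<in>{0..<1}. \<rho> i s > 0))"

definition Lp_modular ::
    "('v, 'i) pre_digraph \<Rightarrow> real \<Rightarrow> ('i \<Rightarrow> real \<Rightarrow> real) \<Rightarrow> ('i \<Rightarrow> real \<Rightarrow> 'k::real_normed_field) \<Rightarrow> ennreal" where
  "Lp_modular G p \<rho> f =
     (\<integral>\<^sup>+ i. (\<integral>\<^sup>+ s. ennreal (norm (f i s) powr p * \<rho> i s) \<partial>unit_meas) \<partial>count_space (arcs G))"

definition Lp_norm ::
    "('v, 'i) pre_digraph \<Rightarrow> real \<Rightarrow> ('i \<Rightarrow> real \<Rightarrow> real) \<Rightarrow> ('i \<Rightarrow> real \<Rightarrow> 'k::real_normed_field) \<Rightarrow> real" where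
  "Lp_norm G p \<rho> f = enn2real (Lp_modular G p \<rho> f) powr (1 / p)"

definition Lp_funs ::
    "('v, 'i) pre_digraph \<Rightarrow> real \<Rightarrow> ('i \<Rightarrow> real \<Rightarrow> real) \<Rightarrow> ('i \<Rightarrow> real \<Rightarrow> 'k::real_normed_field) set" where
  "Lp_funs G p \<rho> = {f. (\<forall>i\<in>arcs G. f i \<in> borel_measurable unit_meas) \<and> Lp_modular G p \<rho> f < \<infinity>}"

definition Lp_rel ::
    "('v, 'i) pre_digraph \<Rightarrow> real \<Rightarrow> ('i \<Rightarrow> real \<Rightarrow> real) \<Rightarrow> ('i \<Rightarrow> real \<Rightarrow> 'k::real_normed_field) rel" where
  "Lp_rel G p \<rho> = {(f, g). f \<in> Lp_funs G p \<rho> \<and> g \<in> Lp_funs G p \<rho> \<and>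
     (\<forall>i\<in>arcs G. AE s in unit_meas. f i s = g i s)}"

definition Lp_space ::
    "('v, 'i) pre_digraph \<Rightarrow> real \<Rightarrow> ('i \<Rightarrow> real \<Rightarrow> real) \<Rightarrow> ('i \<Rightarrow> real \<Rightarrow> 'k::real_normed_field) set set" where
  "Lp_space G p \<rho> = Lp_funs G p \<rho> // Lp_rel G p \<rho>"

definition Lp_dist ::
    "('v, 'i) pre_digraph \<Rightarrow> real \<Rightarrow> ('i \<Rightarrow> real \<Rightarrow> real) \<Rightarrow>
     ('i \<Rightarrow> real \<Rightarrow> 'k::real_normed_field) set \<Rightarrow> ('i \<Rightarrow> real \<Rightarrow> 'k) set \<Rightarrow> real" where
  "Lp_dist G p \<rho> A B = Lp_norm G p \<rho> (\<lambda>i s. (SOME f. f \<in> A) i s - (SOME g. g \<in> B) i s)"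

definition Lp_topology ::
    "('v, 'i) pre_digraph \<Rightarrow> real \<Rightarrow> ('i \<Rightarrow> real \<Rightarrow> real) \<Rightarrow> ('i \<Rightarrow> real \<Rightarrow> 'k::real_normed_field) set topology" where
  "Lp_topology G p \<rho> = Metric_space.mtopology (Lp_space G p \<rho>) (Lp_dist G p \<rho>)"


subsection \<open>The quotient is a metric space\<close>

lemma Lp_rel_equiv: "equiv (Lp_funs G p \<rho>) (Lp_rel G p \<rho>)"
proof (rule equivI)
  show "Lp_rel G p \<rho> \<subseteq> Lp_funs G p \<rho> \<times> Lp_funs G p \<rho>"
    by (auto simp: Lp_rel_def)
  show "refl_on (Lp_funs G p \<rho>) (Lp_rel G p \<rho>)"
    by (auto simp: Lp_rel_def refl_on_def)
  show "sym (Lp_rel G p \<rho>)"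
  proof (rule symI)
    fix f g assume "(f, g) \<in> Lp_rel G p \<rho>"
    then show "(g, f) \<in> Lp_rel G p \<rho>"
      unfolding Lp_rel_def by (simp add: eq_commute)
  qed
  show "trans (Lp_rel G p \<rho>)"
  proof (rule transI)
    fix f g h assume fg: "(f, g) \<in> Lp_rel G p \<rho>" and gh: "(g, h) \<in> Lp_rel G p \<rho>"
    have "AE s in unit_meas. f i s = h i s" if "i \<in> arcs G" for i
    proof -
      have "AE s in unit_meas. f i s = g i s" "AE s in unit_meas. g i s = h i s"
        using fg gh that by (auto simp: Lp_rel_def)
      then show ?thesis by eventually_elim simp
    qed
    then show "(f, h) \<in> Lp_rel G p \<rho>"
      using fg gh by (auto simp: Lp_rel_def)
  qed
qed

lemma powr_convex_combination:
  fixes a b x y p :: real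
  assumes "a > 0" "b > 0" "x \<ge> 0" "y \<ge> 0" "p > 1"
  shows "(x + y) powr p \<le> (a + b) powr (p - 1) * (a powr (1 - p) * x powr p + b powr (1 - p) * y powr p)"
proof -
  have one: "1 \<le> (a + b) powr (p - 1) * c powr (1 - p)" if "c > 0" "c \<le> a + b" for c
  proof -
    have "c powr (p - 1) * c powr (1 - p) \<le> (a + b) powr (p - 1) * c powr (1 - p)"
      using assms that by (intro mult_right_mono powr_mono2) auto
    then show ?thesis
      using that by (simp flip: powr_add)
  qed
  consider "x = 0" | "y = 0" | "x > 0" "y > 0"
    using assms by fastforce
  then show ?thesis
  proof cases
    case 1
    then show ?thesis
      using mult_right_mono[OF one[of b], of "y powr p"] assms by (simp add: mult.assoc)
  next
    case 2
    then show ?thesis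
      using mult_right_mono[OF one[of a], of "x powr p"] assms by (simp add: mult.assoc)
  next
    case 3
    have c: "convex_on {0<..} (\<lambda>x::real. x powr p)"
      by (rule powr_convex) (use assms in simp)
    have w: "1 - b / (a + b) = a / (a + b)"
      using assms by (simp add: field_simps)
    have e: "a / (a + b) * (x / a) + b / (a + b) * (y / b) = (x + y) / (a + b)"
      using assms by (simp add: add_divide_distrib)
    have "((x + y) / (a + b)) powr p \<le> a / (a + b) * (x / a) powr p + b / (a + b) * (y / b) powr p"
      using convex_onD[OF c, of "b / (a + b)" "x / a" "y / b"] assms 3
      unfolding w real_scaleR_def e by simp
    then have "(a + b) powr p * ((x + y) / (a + b)) powr p
        \<le> (a + b) powr p * (a / (a + b) * (x / a) powr p + b / (a + b) * (y / b) powr p)"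
      by (rule mult_left_mono) simp
    moreover have "(a + b) powr p * ((x + y) / (a + b)) powr p = (x + y) powr p"
      using assms by (simp add: powr_divide)
    moreover have "(a + b) powr p * (c / (a + b) * (z / c) powr p)
        = (a + b) powr (p - 1) * (c powr (1 - p) * z powr p)" if "c > 0" "z \<ge> 0" for c z
      using assms that by (simp add: powr_divide powr_diff)
    ultimately show ?thesis
      using assms by (simp add: distrib_left)
  qed
qed

lemma Lp_modular_diff_le:
  fixes f g :: "'i \<Rightarrow> real \<Rightarrow> 'k::{real_normed_field, euclidean_space}"
  assumes w: "weight G \<rho>" and p: "1 < p" and ab: "a > 0" "b > 0"
    and f: "f \<in> Lp_funs G p \<rho>" "Lp_modular G p \<rho> f \<le> ennreal (a powr p)"
    and g: "g \<in> Lp_funs G p \<rho>" "Lp_modular G p \<rho> g \<le> ennreal (b powr p)"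
  shows "Lp_modular G p \<rho> (\<lambda>i s. f i s - g i s) \<le> ennreal ((a + b) powr p)"
proof -
  let ?C = "(a + b) powr (p - 1)"
  let ?A = "?C * a powr (1 - p)" and ?B = "?C * b powr (1 - p)"
  let ?h = "\<lambda>(u :: 'i \<Rightarrow> real \<Rightarrow> 'k) i s. ennreal (norm (u i s) powr p * \<rho> i s)"
  have meas [measurable]: "f i \<in> borel_measurable unit_meas" "g i \<in> borel_measurable unit_meas"
    "\<rho> i \<in> borel_measurable unit_meas" if "i \<in> arcs G" for i
    using that f(1) g(1) w by (auto simp: Lp_funs_def weight_def)
  have pt: "ennreal (norm (f i s - g i s) powr p * \<rho> i s)
      \<le> ennreal ?A * ?h f i s + ennreal ?B * ?h g i s" if i: "i \<in> arcs G" and s: "s \<in> {0..<1}" for i s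
  proof -
    have r: "\<rho> i s > 0" using w i s by (auto simp: weight_def)
    have "norm (f i s - g i s) powr p \<le> (norm (f i s) + norm (g i s)) powr p"
      using p by (intro powr_mono2) (auto intro: norm_triangle_ineq4)
    also have "\<dots> \<le> ?C * (a powr (1 - p) * norm (f i s) powr p + b powr (1 - p) * norm (g i s) powr p)"
      using powr_convex_combination[OF ab, of "norm (f i s)" "norm (g i s)" p] p by simp
    finally have "norm (f i s - g i s) powr p * \<rho> i s
        \<le> ?C * (a powr (1 - p) * norm (f i s) powr p + b powr (1 - p) * norm (g i s) powr p) * \<rho> i s"
      using r by (intro mult_right_mono) auto
    also have "\<dots> = ?A * (norm (f i s) powr p * \<rho> i s) + ?B * (norm (g i s) powr p * \<rho> i s)"
      by (simp add: algebra_simps)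
    finally have "ennreal (norm (f i s - g i s) powr p * \<rho> i s) \<le>
        ennreal (?A * (norm (f i s) powr p * \<rho> i s) + ?B * (norm (g i s) powr p * \<rho> i s))"
      by (rule ennreal_leI)
    also have "\<dots> = ennreal ?A * ?h f i s + ennreal ?B * ?h g i s"
      using r by (simp add: ennreal_plus ennreal_mult)
    finally show ?thesis .
  qed
  have inner: "(\<integral>\<^sup>+ s. ?h (\<lambda>i s. f i s - g i s) i s \<partial>unit_meas)
     \<le> ennreal ?A * (\<integral>\<^sup>+ s. ?h f i s \<partial>unit_meas) + ennreal ?B * (\<integral>\<^sup>+ s. ?h g i s \<partial>unit_meas)"
    if i: "i \<in> arcs G" for i
  proof -
    note [measurable] = meas[OF i]
    have "(\<integral>\<^sup>+ s. ?h (\<lambda>i s. f i s - g i s) i s \<partial>unit_meas)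
        \<le> (\<integral>\<^sup>+ s. ennreal ?A * ?h f i s + ennreal ?B * ?h g i s \<partial>unit_meas)"
      using pt[OF i] by (intro nn_integral_mono) auto
    also have "\<dots> = (\<integral>\<^sup>+ s. ennreal ?A * ?h f i s \<partial>unit_meas) + (\<integral>\<^sup>+ s. ennreal ?B * ?h g i s \<partial>unit_meas)"
      by (rule nn_integral_add) measurable
    also have "\<dots> = ennreal ?A * (\<integral>\<^sup>+ s. ?h f i s \<partial>unit_meas) + ennreal ?B * (\<integral>\<^sup>+ s. ?h g i s \<partial>unit_meas)"
      using i by (simp add: nn_integral_cmult)
    finally show ?thesis .
  qed
  have "Lp_modular G p \<rho> (\<lambda>i s. f i s - g i s)
      \<le> (\<integral>\<^sup>+ i. ennreal ?A * (\<integral>\<^sup>+ s. ?h f i s \<partial>unit_meas)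
           + ennreal ?B * (\<integral>\<^sup>+ s. ?h g i s \<partial>unit_meas) \<partial>count_space (arcs G))"
    unfolding Lp_modular_def using inner by (intro nn_integral_mono) auto
  also have "\<dots> = ennreal ?A * Lp_modular G p \<rho> f + ennreal ?B * Lp_modular G p \<rho> g"
    unfolding Lp_modular_def by (simp add: nn_integral_add nn_integral_cmult)
  also have "\<dots> \<le> ennreal ?A * ennreal (a powr p) + ennreal ?B * ennreal (b powr p)"
    by (intro add_mono mult_left_mono f g) auto
  also have "\<dots> = ennreal (?A * a powr p + ?B * b powr p)"
    by (simp add: ennreal_plus ennreal_mult)
  also have "?A * a powr p + ?B * b powr p = (a + b) powr p"
  proof -
    have "a powr (1 - p) * a powr p = a" "b powr (1 - p) * b powr p = b"
      using ab by (simp_all flip: powr_add)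
    then have "?A * a powr p + ?B * b powr p = ?C * (a + b)"
      by (simp add: distrib_left mult.assoc)
    also have "\<dots> = (a + b) powr p"
      using ab by (simp add: powr_diff)
    finally show ?thesis .
  qed
  finally show ?thesis .
qed

lemma Lp_modular_le_if_norm_less:
  assumes "1 < p" "f \<in> Lp_funs G p \<rho>" "Lp_norm G p \<rho> f < a"
  shows "Lp_modular G p \<rho> f \<le> ennreal (a powr p)"
proof -
  let ?m = "enn2real (Lp_modular G p \<rho> f)"
  have "?m = (?m powr (1 / p)) powr p"
    using assms by (simp add: powr_powr)
  also have "\<dots> \<le> a powr p"
    using assms by (intro powr_mono2) (auto simp: Lp_norm_def)
  finally have m: "?m \<le> a powr p" .
  have "Lp_modular G p \<rho> f = ennreal ?m"
    using assms(2) by (simp add: Lp_funs_def)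
  also have "\<dots> \<le> ennreal (a powr p)"
    using m by (rule ennreal_leI)
  finally show ?thesis .
qed

lemma Lp_norm_diff:
  fixes f g :: "'i \<Rightarrow> real \<Rightarrow> 'k::{real_normed_field, euclidean_space}"
  assumes w: "weight G \<rho>" and p: "1 < p" and f: "f \<in> Lp_funs G p \<rho>" and g: "g \<in> Lp_funs G p \<rho>"
  shows "(\<lambda>i s. f i s - g i s) \<in> Lp_funs G p \<rho>"
    and "Lp_norm G p \<rho> (\<lambda>i s. f i s - g i s) \<le> Lp_norm G p \<rho> f + Lp_norm G p \<rho> g"
proof -
  have le: "Lp_modular G p \<rho> (\<lambda>i s. f i s - g i s) \<le> ennreal ((a + b) powr p)"
    if "Lp_norm G p \<rho> f < a" "Lp_norm G p \<rho> g < b" for a b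
  proof -
    have "0 \<le> Lp_norm G p \<rho> f" "0 \<le> Lp_norm G p \<rho> g"
      by (simp_all add: Lp_norm_def)
    then show ?thesis
      using that by (intro Lp_modular_diff_le[OF w p _ _ f _ g] Lp_modular_le_if_norm_less[OF p] f g) auto
  qed
  have "Lp_modular G p \<rho> (\<lambda>i s. f i s - g i s) < \<infinity>"
    using le[of "Lp_norm G p \<rho> f + 1" "Lp_norm G p \<rho> g + 1"] by (auto intro: le_less_trans)
  then show "(\<lambda>i s. f i s - g i s) \<in> Lp_funs G p \<rho>"
    using f g by (auto simp: Lp_funs_def intro!: borel_measurable_diff)
  show "Lp_norm G p \<rho> (\<lambda>i s. f i s - g i s) \<le> Lp_norm G p \<rho> f + Lp_norm G p \<rho> g"
  proof (rule field_le_epsilon)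
    fix e :: real assume e: "0 < e"
    let ?a = "Lp_norm G p \<rho> f + e / 2" and ?b = "Lp_norm G p \<rho> g + e / 2"
    have nn: "0 \<le> Lp_norm G p \<rho> f" "0 \<le> Lp_norm G p \<rho> g"
      by (simp_all add: Lp_norm_def)
    have "enn2real (Lp_modular G p \<rho> (\<lambda>i s. f i s - g i s)) \<le> (?a + ?b) powr p"
      using le[of ?a ?b] e by (intro enn2real_leI) auto
    then have "Lp_norm G p \<rho> (\<lambda>i s. f i s - g i s) \<le> ((?a + ?b) powr p) powr (1 / p)"
      unfolding Lp_norm_def using p by (intro powr_mono2) auto
    also have "\<dots> = ?a + ?b"
      using e p nn by (simp add: powr_powr)
    finally show "Lp_norm G p \<rho> (\<lambda>i s. f i s - g i s) \<le> Lp_norm G p \<rho> f + Lp_norm G p \<rho> g + e"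
      by simp
  qed
qed

lemma Lp_norm_diff_eq_0_iff:
  fixes f g :: "'i \<Rightarrow> real \<Rightarrow> 'k::{real_normed_field, euclidean_space}"
  assumes w: "weight G \<rho>" and p: "1 < p" and f: "f \<in> Lp_funs G p \<rho>" and g: "g \<in> Lp_funs G p \<rho>"
  shows "Lp_norm G p \<rho> (\<lambda>i s. f i s - g i s) = 0 \<longleftrightarrow> (f, g) \<in> Lp_rel G p \<rho>"
proof -
  have fin: "Lp_modular G p \<rho> (\<lambda>i s. f i s - g i s) < \<infinity>"
    using Lp_norm_diff(1)[OF w p f g] by (simp add: Lp_funs_def)
  have inner: "(\<integral>\<^sup>+ s. ennreal (norm (f i s - g i s) powr p * \<rho> i s) \<partial>unit_meas) = 0
      \<longleftrightarrow> (AE s in unit_meas. f i s = g i s)" if i: "i \<in> arcs G" for i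
  proof -
    have [measurable]: "f i \<in> borel_measurable unit_meas" "g i \<in> borel_measurable unit_meas"
      "\<rho> i \<in> borel_measurable unit_meas"
      using i f g w by (auto simp: Lp_funs_def weight_def)
    have "(\<integral>\<^sup>+ s. ennreal (norm (f i s - g i s) powr p * \<rho> i s) \<partial>unit_meas) = 0
      \<longleftrightarrow> (AE s in unit_meas. ennreal (norm (f i s - g i s) powr p * \<rho> i s) = 0)"
      by (rule nn_integral_0_iff_AE) measurable
    also have "\<dots> \<longleftrightarrow> (AE s in unit_meas. f i s = g i s)"
    proof (rule AE_cong)
      fix s assume "s \<in> space unit_meas"
      then have "\<rho> i s > 0" using w i by (auto simp: weight_def)
      then show "(ennreal (norm (f i s - g i s) powr p * \<rho> i s) = 0) = (f i s = g i s)"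
        by (auto simp: ennreal_eq_0_iff mult_le_0_iff)
    qed
    finally show ?thesis .
  qed
  have "Lp_norm G p \<rho> (\<lambda>i s. f i s - g i s) = 0 \<longleftrightarrow> Lp_modular G p \<rho> (\<lambda>i s. f i s - g i s) = 0"
    using fin by (auto simp: Lp_norm_def enn2real_eq_0_iff)
  also have "\<dots> \<longleftrightarrow> (\<forall>i\<in>arcs G. (\<integral>\<^sup>+ s. ennreal (norm (f i s - g i s) powr p * \<rho> i s) \<partial>unit_meas) = 0)"
    unfolding Lp_modular_def by (subst nn_integral_0_iff_AE) (auto simp: AE_count_space)
  also have "\<dots> \<longleftrightarrow> (f, g) \<in> Lp_rel G p \<rho>"
    using f g inner by (auto simp: Lp_rel_def)
  finally show ?thesis .
qed

lemma Lp_space_some: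
  assumes "A \<in> Lp_space G p \<rho>"
  shows "(SOME f. f \<in> A) \<in> Lp_funs G p \<rho>" and "A = Lp_rel G p \<rho> `` {SOME f. f \<in> A}"
proof -
  have A: "A \<in> Lp_funs G p \<rho> // Lp_rel G p \<rho>"
    using assms by (simp add: Lp_space_def)
  have in_A: "(SOME f. f \<in> A) \<in> A"
    using in_quotient_imp_non_empty[OF Lp_rel_equiv A] by (simp add: some_in_eq)
  then show "(SOME f. f \<in> A) \<in> Lp_funs G p \<rho>"
    using in_quotient_imp_subset[OF Lp_rel_equiv A] by blast
  obtain f where "A = Lp_rel G p \<rho> `` {f}"
    using A by (rule quotientE)
  then show "A = Lp_rel G p \<rho> `` {SOME f. f \<in> A}"
    using in_A equiv_class_eq[OF Lp_rel_equiv] by blast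
qed

lemma Metric_space_Lp:
  assumes w: "weight G \<rho>" and p: "1 < p"
  shows "Metric_space (Lp_space G p \<rho>)
    (Lp_dist G p \<rho> :: ('i \<Rightarrow> real \<Rightarrow> 'k::{real_normed_field, euclidean_space}) set \<Rightarrow> _)"
proof
  fix A B C :: "('i \<Rightarrow> real \<Rightarrow> 'k) set"
  let ?r = "\<lambda>A :: ('i \<Rightarrow> real \<Rightarrow> 'k) set. SOME f. f \<in> A"
  show "0 \<le> Lp_dist G p \<rho> A B"
    by (simp add: Lp_dist_def Lp_norm_def)
  show "Lp_dist G p \<rho> A B = Lp_dist G p \<rho> B A"
    by (simp add: Lp_dist_def Lp_norm_def Lp_modular_def norm_minus_commute)
  assume A: "A \<in> Lp_space G p \<rho>" and B: "B \<in> Lp_space G p \<rho>"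
  note rA = Lp_space_some[OF A] and rB = Lp_space_some[OF B]
  have "Lp_dist G p \<rho> A B = 0 \<longleftrightarrow> (?r A, ?r B) \<in> Lp_rel G p \<rho>"
    unfolding Lp_dist_def by (rule Lp_norm_diff_eq_0_iff[OF w p rA(1) rB(1)])
  also have "\<dots> \<longleftrightarrow> Lp_rel G p \<rho> `` {?r A} = Lp_rel G p \<rho> `` {?r B}"
    using eq_equiv_class_iff[OF Lp_rel_equiv rA(1) rB(1)] by simp
  also have "\<dots> \<longleftrightarrow> A = B"
    using rA(2) rB(2) by simp
  finally show "Lp_dist G p \<rho> A B = 0 \<longleftrightarrow> A = B" .
  assume C: "C \<in> Lp_space G p \<rho>"
  note rC = Lp_space_some[OF C]
  have "Lp_norm G p \<rho> (\<lambda>i s. (?r A i s - ?r B i s) - (?r C i s - ?r B i s))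
      \<le> Lp_norm G p \<rho> (\<lambda>i s. ?r A i s - ?r B i s) + Lp_norm G p \<rho> (\<lambda>i s. ?r C i s - ?r B i s)"
    by (intro Lp_norm_diff[OF w p] rA rB rC)
  moreover have "Lp_norm G p \<rho> (\<lambda>i s. ?r C i s - ?r B i s) = Lp_norm G p \<rho> (\<lambda>i s. ?r B i s - ?r C i s)"
    by (simp add: Lp_norm_def Lp_modular_def norm_minus_commute)
  ultimately show "Lp_dist G p \<rho> A C \<le> Lp_dist G p \<rho> A B + Lp_dist G p \<rho> B C"
    by (simp add: Lp_dist_def)
qed


section \<open>The left translation semigroup\<close>

definition cross_count :: "real \<Rightarrow> real \<Rightarrow> nat" where
  "cross_count t s = nat \<lfloor>t + s\<rfloor>"

definition shift_pos :: "real \<Rightarrow> real \<Rightarrow> real" where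
  "shift_pos t s = t + s - real (cross_count t s)"

text \<open>
  On families in \<open>Lp_funs G p \<rho>\<close>, with \<open>\<rho>\<close> admissible, the possibly infinite sum below
  converges absolutely for almost every \<open>s\<close>; the value 0 that \<open>infsum\<close> assigns to divergent sums
  only matters on a null set.
\<close>

definition left_trans ::
    "('v, 'i) pre_digraph \<Rightarrow> real \<Rightarrow> ('i \<Rightarrow> real \<Rightarrow> 'k::real_normed_field) \<Rightarrow> 'i \<Rightarrow> real \<Rightarrow> 'k" where
  "left_trans G t f i s = (\<Sum>\<^sub>\<infinity>j\<in>desc_edges G (cross_count t s) i. f j (shift_pos t s))"

definition left_semigroup ::
    "('v, 'i) pre_digraph \<Rightarrow> real \<Rightarrow> ('i \<Rightarrow> real \<Rightarrow> real) \<Rightarrow> real \<Rightarrow>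
     ('i \<Rightarrow> real \<Rightarrow> 'k::real_normed_field) set \<Rightarrow> ('i \<Rightarrow> real \<Rightarrow> 'k) set" where
  "left_semigroup G p \<rho> t A = (\<Union>f\<in>A. Lp_rel G p \<rho> `` {left_trans G t f})"


section \<open>Admissible weights\<close>

text \<open>Powers on \<open>[0,\<infinity>]\<close>, with \<open>\<infinity>\<^sup>a = 0\<close> and \<open>0\<^sup>a = \<infinity>\<close> for \<open>a < 0\<close>.\<close>

definition enn_powr :: "ennreal \<Rightarrow> real \<Rightarrow> ennreal" where
  "enn_powr x a =
     (if a = 0 then 1
      else if x = 0 then (if a > 0 then 0 else \<infinity>)
      else if x = \<infinity> then (if a > 0 then \<infinity> else 0)
      else ennreal (enn2real x powr a))"

definition dual_sum ::
    "('v, 'i) pre_digraph \<Rightarrow> real \<Rightarrow> ('i \<Rightarrow> real \<Rightarrow> real) \<Rightarrow> 'i \<Rightarrow> real \<Rightarrow> real \<Rightarrow> ennreal" where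
  "dual_sum G p \<rho> i t s =
     (\<integral>\<^sup>+ j. ennreal (\<rho> j (shift_pos t s) powr (- 1 / (p - 1)))
        \<partial>count_space (desc_edges G (cross_count t s) i))"

definition p_admissible :: "('v, 'i) pre_digraph \<Rightarrow> real \<Rightarrow> ('i \<Rightarrow> real \<Rightarrow> real) \<Rightarrow> bool" where
  "p_admissible G p \<rho> \<longleftrightarrow>
     (\<exists>M\<ge>1. \<exists>\<omega>. \<forall>i\<in>arcs G. \<forall>t\<ge>0. \<forall>s\<in>{0..<1}.
        enn_powr (dual_sum G p \<rho> i t s) (p - 1)
          \<le> ennreal (M powr p * exp (p * \<omega> * t) * (1 / \<rho> i s)))"


section \<open>Furstenberg families\<close>

definition Furstenberg_family :: "real set set \<Rightarrow> bool" where
  "Furstenberg_family F \<longleftrightarrow> F \<noteq> {} \<and> F \<subseteq> Pow {0..} \<and>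
     (\<forall>A B. A \<in> F \<longrightarrow> A \<subseteq> B \<longrightarrow> B \<subseteq> {0..} \<longrightarrow> B \<in> F)"

definition proper_family :: "real set set \<Rightarrow> bool" where
  "proper_family F \<longleftrightarrow> F \<noteq> {} \<and> {} \<notin> F"

definition finite_invariant :: "real set set \<Rightarrow> bool" where
  "finite_invariant F \<longleftrightarrow> (\<forall>A\<in>F. \<forall>R>0. A \<inter> {R<..} \<in> F)"

definition return_times :: "(real \<Rightarrow> 'a \<Rightarrow> 'a) \<Rightarrow> 'a set \<Rightarrow> 'a set \<Rightarrow> real set" where
  "return_times T U V = {t. 0 \<le> t \<and> T t ` U \<inter> V \<noteq> {}}"

definition F_transitive :: "real set set \<Rightarrow> 'a topology \<Rightarrow> (real \<Rightarrow> 'a \<Rightarrow> 'a) \<Rightarrow> bool" where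
  "F_transitive F X T \<longleftrightarrow>
     (\<forall>U V. openin X U \<and> U \<noteq> {} \<and> openin X V \<and> V \<noteq> {} \<longrightarrow> return_times T U V \<in> F)"

definition F_recurrent :: "real set set \<Rightarrow> 'a topology \<Rightarrow> (real \<Rightarrow> 'a \<Rightarrow> 'a) \<Rightarrow> bool" where
  "F_recurrent F X T \<longleftrightarrow> (\<forall>U. openin X U \<and> U \<noteq> {} \<longrightarrow> return_times T U U \<in> F)"


section \<open>The weight condition\<close>

definition Phi ::
    "('v, 'i) pre_digraph \<Rightarrow> real \<Rightarrow> ('i \<Rightarrow> real \<Rightarrow> real) \<Rightarrow> 'i \<Rightarrow> real \<Rightarrow> real \<Rightarrow> ennreal" where
  "Phi G p \<rho> i t s = enn_powr (dual_sum G p \<rho> i t s) (1 - p)"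

definition Psi ::
    "('v, 'i) pre_digraph \<Rightarrow> real \<Rightarrow> ('i \<Rightarrow> real \<Rightarrow> real) \<Rightarrow> 'i \<Rightarrow> real \<Rightarrow> real \<Rightarrow> ennreal" where
  "Psi G p \<rho> i t s =
     (let k = anc_edge G (cross_count t s) i
      in enn_powr (ennreal (\<rho> k s powr (- 1 / (p - 1))) + dual_sum G p \<rho> k t s) (1 - p))"

definition N_times ::
    "('v, 'i) pre_digraph \<Rightarrow> real \<Rightarrow> ('i \<Rightarrow> real \<Rightarrow> real) \<Rightarrow> 'i set \<Rightarrow> real \<Rightarrow> real \<Rightarrow> real set" where
  "N_times G p \<rho> K \<epsilon> \<alpha> =
     {t. 0 \<le> t \<and>
        (INF E\<in>{E \<in> sets lebesgue. E \<subseteq> {0..<1} \<and> measure lebesgue E > \<alpha>}.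
           \<integral>\<^sup>+ s\<in>E. (\<Sum>i\<in>K. Phi G p \<rho> i t s + Psi G p \<rho> i t s) \<partial>lebesgue) < ennreal \<epsilon>}"

end

theory Submission
  imports Defs
begin

text \<open>
  Write \<open>n\<close> and \<open>x\<close> for the crossing number and the new position belonging to \<open>(t, s)\<close>; for fixed
  \<open>t\<close> the map \<open>s \<mapsto> x\<close> is a rotation of \<open>[0,1)\<close>, so norms may be computed fiberwise in \<open>s\<close>. For fixed
  \<open>n\<close> the sets \<open>M\<^sub>n(k)\<close> partition the edges, and for large \<open>n\<close> the descendants of a finite set \<open>K\<close>
  avoid \<open>K\<close>.

  If \<open>h\<close> and \<open>T\<^sub>t h\<close> are both close to \<open>1\<^sub>K\<close> with \<open>t\<close> large, apply Hoelder's inequality on the fiber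
  \<open>M\<^sub>n(i)\<close>, on which \<open>h\<close> is small while its sum \<open>(T\<^sub>t h)\<^sub>i\<close> is near \<open>1\<close>: this bounds \<open>\<Phi>\<^sub>i\<close>. On the fiber
  through \<open>i \<in> K\<close> over \<open>k = K\<^sub>n(i) \<notin> K\<close>, the sum of \<open>h\<close> is near a positive integer although
  \<open>(T\<^sub>t h)\<^sub>k\<close> is small: this bounds \<open>\<Psi>\<^sub>i\<close>. Hence recurrence gives the weight condition.

  Conversely, functions of finite support are connected on a set \<open>E\<close> of good positions by adding to
  \<open>f\<close> multiples of the extremal functions of Hoelder's inequality; the costs are exactly governed by
  \<open>\<Phi>\<close> and \<open>\<Psi>\<close>, and uniform integrability takes care of the complement of \<open>E\<close>.
\<close>

section \<open>Descendants and ancestors of edges\<close>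

text \<open>The form of \<open>Psi\<close> comes from a two-term minimisation: for a, b > 0 the
  least value of a^(1-p) |y|^p + b^(1-p) |z|^p subject to y + z = 1 is (a + b)^(1-p), attained at y
  = a/(a+b), z = b/(a+b). Here a is the dual weight of the ancestor edge k, b the dual sum over its
  fiber, y an error left in the translate at k, z an error in h on the fiber. The inequality,
  \<open>powr_convex_combination\<close>, serves the necessity; the minimiser dictates the
  construction for the sufficiency. \<open>Phi\<close> is the case in which the fiber alone pays.
  Indicators of K are suitable test functions because several edges of K may share an ancestor:
  their contributions cannot cancel. The sets E of measure greater than \<alpha> are forced by the
  weight, which may come arbitrarily close to 0 on an edge, so that closeness in norm gives
  closeness at a point only off a small set. In the other direction nothing is known off E, and the
  connecting function is put to 0 there.\<close>

context directed_tree
begin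

lemma countable_arcs: "countable (arcs G)"
proof -
  have "inj_on (arc_to_ends G) (arcs G)"
    by (rule inj_onI) (rule no_multi_arcs)
  moreover have "countable (arc_to_ends G ` arcs G)"
    by (rule countable_subset[of _ "verts G \<times> verts G"])
       (use countable_verts in \<open>auto simp: arc_to_ends_def\<close>)
  ultimately show ?thesis
    using countable_image_inj_on by blast
qed

lemma desc_edges_subset: "i \<in> arcs G \<Longrightarrow> desc_edges G n i \<subseteq> arcs G"
  by (cases n) auto

text \<open>A unique parent makes the tails of two edges ending at \<open>tail G j\<close> agree,
  and absence of multiple arcs then makes the edges agree, so ancestry can be retraced one level at
  a time.\<close>

lemma desc_edges_ancestor_unique:
  "\<lbrakk>i \<in> arcs G; k \<in> arcs G; j \<in> desc_edges G n i; j \<in> desc_edges G n k\<rbrakk> \<Longrightarrow> i = k"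
proof (induction n arbitrary: j)
  case (Suc n)
  then obtain a b where ab: "a \<in> desc_edges G n i" "b \<in> desc_edges G n k"
    "head G a = tail G j" "head G b = tail G j" and j: "j \<in> arcs G"
    by auto
  have "a \<in> arcs G" "b \<in> arcs G"
    using ab Suc.prems desc_edges_subset by blast+
  moreover have "tail G a = tail G b"
    using ab calculation by (intro parent_unique[of _ "tail G j"]) (metis in_arcs_imp_in_arcs_ends)+
  ultimately have "a = b"
    using ab by (auto intro!: no_multi_arcs simp: arc_to_ends_def)
  then show ?case
    using Suc.IH ab Suc.prems by blast
qed simp

lemma desc_edges_ancestor_exists:
  assumes "rootless G" "j \<in> arcs G"
  shows "\<exists>k\<in>arcs G. j \<in> desc_edges G n k"
  using assms(2)
proof (induction n arbitrary: j)
  case (Suc n)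
  then obtain u where "u \<rightarrow> tail G j"
    using assms(1) by (meson rootless_def tail_in_verts)
  then obtain e where "e \<in> arcs G" "head G e = tail G j"
    by auto
  then show ?case
    using Suc by fastforce
qed simp

lemma anc_edge_eqI: "k \<in> arcs G \<Longrightarrow> j \<in> desc_edges G n k \<Longrightarrow> anc_edge G n j = k"
  unfolding anc_edge_def using desc_edges_ancestor_unique by blast

lemma anc_edge:
  assumes "rootless G" "j \<in> arcs G"
  shows "anc_edge G n j \<in> arcs G" "j \<in> desc_edges G n (anc_edge G n j)"
  using desc_edges_ancestor_exists[OF assms] anc_edge_eqI by metis+

lemma desc_edges_nonempty:
  assumes "leafless G" "i \<in> arcs G"
  shows "desc_edges G n i \<noteq> {}"
proof (induction n)
  case (Suc n)
  then obtain k where k: "k \<in> desc_edges G n i" by auto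
  then have "k \<in> arcs G" using assms desc_edges_subset by blast
  then obtain v where "head G k \<rightarrow> v"
    using assms(1) by (meson leafless_def head_in_verts)
  then obtain e where "e \<in> arcs G" "tail G e = head G k" by auto
  with k show ?case by force
qed simp

lemma desc_edges_add: "desc_edges G (m + n) i = (\<Union>k\<in>desc_edges G m i. desc_edges G n k)"
  by (induction n) auto

lemma desc_edges_Suc_reachable:
  "\<lbrakk>i \<in> arcs G; j \<in> desc_edges G (Suc n) i\<rbrakk> \<Longrightarrow> head G i \<rightarrow>\<^sup>* tail G j"
proof (induction n arbitrary: j)
  case (Suc n)
  then obtain k where k: "k \<in> desc_edges G (Suc n) i" "head G k = tail G j" by auto
  then have "k \<in> arcs G" by simp
  then have "tail G k \<rightarrow> tail G j"
    using k(2) in_arcs_imp_in_arcs_ends by metis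
  then show ?case
    using Suc.IH[OF Suc.prems(1) k(1)] reachable_adj_trans by blast
qed (auto simp: reachable_refl)

text \<open>The edge followed by a path from its head back to its tail would be a closed walk and
  hence contain a directed cycle.\<close>

lemma not_in_own_desc_edges:
  assumes i: "i \<in> arcs G" "i \<in> desc_edges G n i"
  shows "n = 0"
proof (rule ccontr)
  assume "n \<noteq> 0"
  then obtain m where "n = Suc m" by (cases n) auto
  then have "head G i \<rightarrow>\<^sup>* tail G i"
    using desc_edges_Suc_reachable i by blast
  then obtain q where "awalk (head G i) q (tail G i)"
    using reachable_awalk by blast
  then have "awalk (tail G i) (i # q) (tail G i)"
    using i by (simp add: awalk_Cons_iff)
  then have "closed_w (i # q)"
    by (auto simp: closed_w_def)
  then show False
    using closed_w_imp_cycle tree by (auto simp: tree_def forest_def)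
qed

text \<open>If j lay at levels m < n below i, level n - m below i would contain the m-th ancestor of
  j, which is i itself, so i would descend from itself.\<close>

lemma desc_edges_level_unique:
  assumes "i \<in> arcs G" "j \<in> desc_edges G m i" "j \<in> desc_edges G n i"
  shows "m = n"
proof -
  have "n \<le> m" if m: "j \<in> desc_edges G m i" and n: "j \<in> desc_edges G n i" for m n
  proof (rule ccontr)
    assume "\<not> n \<le> m"
    then have "n = (n - m) + m" by simp
    then obtain k where k: "k \<in> desc_edges G (n - m) i" "j \<in> desc_edges G m k"
      using n desc_edges_add by (metis UN_E)
    have "k = i"
      using desc_edges_ancestor_unique[OF _ assms(1) k(2) m] desc_edges_subset assms(1) k(1)
      by blast
    then show False
      using not_in_own_desc_edges[OF assms(1), of "n - m"] k(1) \<open>\<not> n \<le> m\<close> by simp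
  qed
  then show ?thesis
    using assms by (meson antisym)
qed

text \<open>An edge sits on at most one level below another, so the finitely many pairs from K rule
  out only finitely many levels.\<close>

lemma desc_edges_eventually_disjoint:
  assumes "finite K" "K \<subseteq> arcs G"
  obtains N where "\<And>n i. n > N \<Longrightarrow> i \<in> K \<Longrightarrow> desc_edges G n i \<inter> K = {}"
proof -
  have "\<exists>N. \<forall>n>N. j \<notin> desc_edges G n i" if "i \<in> K" for i j
    using desc_edges_level_unique assms that by (metis order_less_irrefl subset_eq)
  then obtain N where N: "\<And>i j n. i \<in> K \<Longrightarrow> n > N i j \<Longrightarrow> j \<notin> desc_edges G n i"
    by metis
  let ?N = "Max (insert 0 ((\<lambda>(i, j). N i j) ` (K \<times> K)))"
  have "N i j \<le> ?N" if "i \<in> K" "j \<in> K" for i j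
    using assms that by (intro Max_ge) auto
  then show thesis
    using N by (intro that[of ?N]) force
qed

end

section \<open>Rotations of the unit interval\<close>

lemma shift_pos_eq_frac: "t \<ge> 0 \<Longrightarrow> s \<in> {0..<1} \<Longrightarrow> shift_pos t s = frac (t + s)"
  by (simp add: shift_pos_def cross_count_def frac_def)

lemma shift_pos_in_unit: "t \<ge> 0 \<Longrightarrow> s \<in> {0..<1} \<Longrightarrow> shift_pos t s \<in> {0..<1}"
  by (simp add: shift_pos_eq_frac frac_lt_1)

text \<open>\<open>of_int \<lceil>t\<rceil> - t\<close> is a nonnegative representative of -t modulo
  1, so the two rotations compose to one by an integer. It stands in for -t because
  \<open>nat\<close> in \<open>cross_count\<close> truncates negative floors.\<close>

lemma shift_pos_inverse:
  assumes "t \<ge> 0" "s \<in> {0..<1}"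
  shows "shift_pos (of_int \<lceil>t\<rceil> - t) (shift_pos t s) = s"
proof -
  have "0 \<le> of_int \<lceil>t\<rceil> - t"
    by linarith
  then have "shift_pos (of_int \<lceil>t\<rceil> - t) (shift_pos t s) = frac (of_int \<lceil>t\<rceil> - t + shift_pos t s)"
    using assms shift_pos_in_unit by (intro shift_pos_eq_frac)
  also have "of_int \<lceil>t\<rceil> - t + shift_pos t s = s + of_int (\<lceil>t\<rceil> - \<lfloor>t + s\<rfloor>)"
    using assms by (simp add: shift_pos_eq_frac frac_def)
  also have "frac \<dots> = s"
    using assms by (simp add: frac_unique_iff frac_eq)
  finally show ?thesis .
qed

lemma translation_measurable_lebesgue: "(\<lambda>x::real. c + x) \<in> lebesgue \<rightarrow>\<^sub>M lebesgue"
  using lebesgue_affine_measurable[of "\<lambda>_. 1" c] by simp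

lemma nn_integral_translation_lebesgue:
  fixes c :: real
  assumes "f \<in> borel_measurable lebesgue"
  shows "(\<integral>\<^sup>+x. f (c + x) \<partial>lebesgue) = (\<integral>\<^sup>+x. f x \<partial>lebesgue)"
  using nn_integral_real_affine_lebesgue[OF assms, of 1 c] by simp

lemma cross_count_measurable [measurable]: "cross_count t \<in> unit_meas \<rightarrow>\<^sub>M count_space UNIV"
proof -
  have "(\<lambda>x. x) \<in> borel_measurable unit_meas"
    by (rule measurable_restrict_space1) (rule measurable_completion, simp)
  then have "(\<lambda>s. \<lfloor>t + s\<rfloor>) \<in> unit_meas \<rightarrow>\<^sub>M count_space UNIV"
    by measurable
  then show ?thesis
    unfolding cross_count_def by measurable
qed

lemma shift_pos_measurable [measurable]:
  assumes "t \<ge> 0"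
  shows "shift_pos t \<in> unit_meas \<rightarrow>\<^sub>M unit_meas"
proof (rule measurable_restrict_space2)
  \<comment> \<open>For each fixed crossing number the map is a translation, and there are countably
    many crossing numbers to glue over. \<open>S\<close>, \<open>fsum\<close> and
    \<open>connect\<close> are later handled by the same device.\<close>
  have "(\<lambda>s. (\<lambda>n s. (t - real n) + s) (cross_count t s) s) \<in> unit_meas \<rightarrow>\<^sub>M lebesgue"
    by (rule measurable_compose_countable)
       (auto intro!: measurable_restrict_space1 translation_measurable_lebesgue)
  then show "shift_pos t \<in> unit_meas \<rightarrow>\<^sub>M lebesgue"
    by (simp add: shift_pos_def[abs_def] algebra_simps)
  show "shift_pos t \<in> space unit_meas \<rightarrow> {0..<1}"
    using shift_pos_in_unit[OF assms] by (auto simp: Pi_iff)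
qed

text \<open>The rotation by u = \<open>frac t\<close> carries [0, 1-u) to [u, 1) and [1-u, 1) to [0,
  u), each by a translation; translation invariance applies to the two pieces \<open>A\<close> and
  \<open>B\<close>.\<close>

lemma nn_integral_shift_pos:
  assumes t: "t \<ge> 0" and f: "f \<in> borel_measurable unit_meas"
  shows "(\<integral>\<^sup>+s. f (shift_pos t s) \<partial>unit_meas) = (\<integral>\<^sup>+s. f s \<partial>unit_meas)"
proof -
  define u where "u = frac t"
  have u: "0 \<le> u" "u < 1"
    by (simp_all add: u_def frac_lt_1)
  define F :: "real \<Rightarrow> ennreal" where "F x = f x * indicator {0..<1} x" for x
  have [measurable]: "F \<in> borel_measurable lebesgue"
    using f unfolding F_def by (subst (asm) borel_measurable_restrict_space_iff_ennreal) auto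
  have shift: "shift_pos t s = (if s < 1 - u then u + s else (u - 1) + s)" if "s \<in> {0..<1}" for s
  proof -
    have "frac (t + s) = frac (u + s)"
      using floor_add_int[of "u + s" "\<lfloor>t\<rfloor>"] by (simp add: u_def frac_def algebra_simps)
    also have "\<dots> = (if s < 1 - u then u + s else (u - 1) + s)"
      using u that by (auto simp: frac_unique_iff)
    finally show ?thesis
      using shift_pos_eq_frac[OF t that] by simp
  qed
  define A where "A x = F x * indicator {u..<1} x" for x
  define B where "B x = F x * indicator {0..<u} x" for x
  have [measurable]: "A \<in> borel_measurable lebesgue" "B \<in> borel_measurable lebesgue"
    unfolding A_def B_def by (auto intro!: borel_measurable_times_ennreal borel_measurable_indicator)
  note [measurable] = translation_measurable_lebesgue
  have "(\<integral>\<^sup>+s. f (shift_pos t s) \<partial>unit_meas)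
      = (\<integral>\<^sup>+s. f (shift_pos t s) * indicator {0..<1} s \<partial>lebesgue)"
    by (simp add: nn_integral_restrict_space)
  also have "\<dots> = (\<integral>\<^sup>+s. A (u + s) + B ((u - 1) + s) \<partial>lebesgue)"
    using u by (intro nn_integral_cong)
      (auto simp: A_def B_def F_def shift split: split_indicator)
  also have "\<dots> = (\<integral>\<^sup>+s. A (u + s) \<partial>lebesgue) + (\<integral>\<^sup>+s. B ((u - 1) + s) \<partial>lebesgue)"
    by (rule nn_integral_add) measurable
  also have "\<dots> = (\<integral>\<^sup>+s. A s \<partial>lebesgue) + (\<integral>\<^sup>+s. B s \<partial>lebesgue)"
    by (simp add: nn_integral_translation_lebesgue)
  also have "\<dots> = (\<integral>\<^sup>+s. A s + B s \<partial>lebesgue)"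
    by (rule nn_integral_add[symmetric]) measurable
  also have "\<dots> = (\<integral>\<^sup>+s. f s * indicator {0..<1} s \<partial>lebesgue)"
    using u by (intro nn_integral_cong) (auto simp: A_def B_def F_def split: split_indicator)
  also have "\<dots> = (\<integral>\<^sup>+s. f s \<partial>unit_meas)"
    by (simp add: nn_integral_restrict_space)
  finally show ?thesis .
qed

lemma distr_shift_pos:
  assumes t: "t \<ge> 0"
  shows "distr unit_meas unit_meas (shift_pos t) = unit_meas"
proof (rule measure_eqI)
  fix A assume "A \<in> sets (distr unit_meas unit_meas (shift_pos t))"
  then have A [measurable]: "A \<in> sets unit_meas" by simp
  note [measurable] = shift_pos_measurable[OF t]
  show "emeasure (distr unit_meas unit_meas (shift_pos t)) A = emeasure unit_meas A"
    using nn_integral_shift_pos[OF t, of "indicator A"]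
    by (simp flip: nn_integral_indicator add: nn_integral_distr)
qed simp

lemma AE_shift_pos:
  assumes "t \<ge> 0" "AE s in unit_meas. P s"
  shows "AE s in unit_meas. P (shift_pos t s)"
proof (rule AE_distrD[where f = "shift_pos t" and M' = unit_meas])
  show "shift_pos t \<in> unit_meas \<rightarrow>\<^sub>M unit_meas"
    by (rule shift_pos_measurable) fact
  show "AE s in distr unit_meas unit_meas (shift_pos t). P s"
    using assms by (simp only: distr_shift_pos)
qed

section \<open>Discrete Hoelder inequalities\<close>

text \<open>Hoelder's inequality cleared of roots. The induction adds one term by
  \<open>powr_convex_combination\<close>, the remaining sum acting as a single block of weight
  \<open>?a\<close>; since both blocks need positive weight, the singleton is treated apart.\<close>

lemma Hoelder_sum:
  fixes a x :: "'j \<Rightarrow> real"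
  assumes "finite A" "1 < p" "\<And>j. j \<in> A \<Longrightarrow> a j > 0" "\<And>j. j \<in> A \<Longrightarrow> x j \<ge> 0"
  shows "(\<Sum>j\<in>A. x j) powr p \<le> (\<Sum>j\<in>A. a j) powr (p - 1) * (\<Sum>j\<in>A. a j powr (1 - p) * x j powr p)"
  using assms
proof (induction A)
  case (insert j A)
  show ?case
  proof (cases "A = {}")
    case True
    have "a j powr (p - 1) * a j powr (1 - p) = 1"
      using insert.prems(2)[of j] by (simp flip: powr_add)
    with True show ?thesis
      by (simp add: mult.assoc[symmetric])
  next
    case False
    let ?a = "\<Sum>j\<in>A. a j" and ?x = "\<Sum>j\<in>A. x j" and ?w = "\<Sum>j\<in>A. a j powr (1 - p) * x j powr p"
    have apos: "?a > 0"
      using False insert by (intro sum_pos) auto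
    have "(x j + ?x) powr p
        \<le> (a j + ?a) powr (p - 1) * (a j powr (1 - p) * x j powr p + ?a powr (1 - p) * ?x powr p)"
      using insert apos by (intro powr_convex_combination) (auto intro!: sum_nonneg)
    also have "\<dots> \<le> (a j + ?a) powr (p - 1) * (a j powr (1 - p) * x j powr p + ?w)"
    proof -
      have "?a powr (1 - p) * ?x powr p \<le> ?a powr (1 - p) * (?a powr (p - 1) * ?w)"
        using insert by (intro mult_left_mono) auto
      also have "\<dots> = ?w"
        using apos by (simp flip: powr_add mult.assoc)
      finally show ?thesis
        by (intro mult_left_mono add_left_mono) auto
    qed
    finally show ?thesis
      using insert by simp
  qed
qed auto

lemma sum_le_nn_integral_count_space:
  assumes "finite F" "F \<subseteq> A" "\<And>j. j \<in> A \<Longrightarrow> f j \<ge> 0"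
    and "(\<integral>\<^sup>+j. ennreal (f j) \<partial>count_space A) \<le> ennreal c" "c \<ge> 0"
  shows "(\<Sum>j\<in>F. f j) \<le> c"
proof -
  have "ennreal (\<Sum>j\<in>F. f j) = (\<integral>\<^sup>+j. ennreal (f j) \<partial>count_space F)"
    using assms by (subst nn_integral_count_space_finite) (auto simp: sum_ennreal subset_eq)
  also have "\<dots> \<le> (\<integral>\<^sup>+j. ennreal (f j) \<partial>count_space A)"
    using assms(2) by (auto simp: nn_integral_count_space_indicator intro!: nn_integral_mono split: split_indicator)
  also have "\<dots> \<le> ennreal c" by fact
  finally show ?thesis
    using assms(5) by simp
qed

text \<open>The finite inequality bounds all partial sums of the norms by \<open>C\<close>, the p-th
  root of the right-hand side; this gives absolute summability and then the same bound for the
  infinite sum.\<close>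

lemma Hoelder_infsum:
  fixes z :: "'j \<Rightarrow> 'k::banach"
  assumes p: "1 < p" and a: "\<And>j. j \<in> A \<Longrightarrow> a j > 0" and SW: "S \<ge> 0" "W \<ge> 0"
    and S: "(\<integral>\<^sup>+j. ennreal (a j) \<partial>count_space A) \<le> ennreal S"
    and W: "(\<integral>\<^sup>+j. ennreal (a j powr (1 - p) * norm (z j) powr p) \<partial>count_space A) \<le> ennreal W"
  shows "z summable_on A" "norm (\<Sum>\<^sub>\<infinity>j\<in>A. z j) powr p \<le> S powr (p - 1) * W"
proof -
  define C where "C = (S powr (p - 1) * W) powr (1 / p)"
  have bound: "(\<Sum>j\<in>F. norm (z j)) \<le> C" if F: "finite F" "F \<subseteq> A" for F
  proof -
    have "(\<Sum>j\<in>F. norm (z j)) powr p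
        \<le> (\<Sum>j\<in>F. a j) powr (p - 1) * (\<Sum>j\<in>F. a j powr (1 - p) * norm (z j) powr p)"
      using F p a by (intro Hoelder_sum) auto
    also have "\<dots> \<le> S powr (p - 1) * W"
      using F p a SW
      by (intro mult_mono powr_mono2 sum_le_nn_integral_count_space[OF F _ S]
          sum_le_nn_integral_count_space[OF F _ W] sum_nonneg) (auto intro: less_imp_le)
    finally have "((\<Sum>j\<in>F. norm (z j)) powr p) powr (1 / p) \<le> C"
      unfolding C_def using p by (intro powr_mono2) auto
    then show ?thesis
      using p by (simp add: powr_powr sum_nonneg)
  qed
  have abs: "(\<lambda>j. norm (z j)) summable_on A"
    using bound by (intro nonneg_bdd_above_summable_on) (auto intro!: bdd_aboveI)
  then show "z summable_on A"
    by (rule abs_summable_summable)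
  have "norm (\<Sum>\<^sub>\<infinity>j\<in>A. z j) \<le> (\<Sum>\<^sub>\<infinity>j\<in>A. norm (z j))"
    by (rule norm_infsum_bound[OF abs])
  also have "\<dots> \<le> C"
    using abs bound by (intro infsum_le_finite_sums) auto
  finally have "norm (\<Sum>\<^sub>\<infinity>j\<in>A. z j) powr p \<le> C powr p"
    using p by (intro powr_mono2) auto
  then show "norm (\<Sum>\<^sub>\<infinity>j\<in>A. z j) powr p \<le> S powr (p - 1) * W"
    using p SW by (simp add: C_def powr_powr)
qed

section \<open>The spaces and their topology\<close>

lemma borel_measurable_nn_integral_countable:
  fixes f :: "'i \<Rightarrow> 'a \<Rightarrow> ennreal"
  assumes I: "countable I" and f: "\<And>i. i \<in> I \<Longrightarrow> f i \<in> borel_measurable M"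
  shows "(\<lambda>x. \<integral>\<^sup>+i. f i x \<partial>count_space I) \<in> borel_measurable M"
proof (rule sigma_finite_measure.borel_measurable_nn_integral)
  show "sigma_finite_measure (count_space I)"
    by (rule sigma_finite_measure_count_space_countable) fact
  have "(\<lambda>(i, x). f i x) \<in> borel_measurable (count_space I \<Otimes>\<^sub>M M)"
    using assms by (intro measurable_pair_measure_countable1) auto
  from measurable_compose[OF measurable_pair_swap' this]
  show "(\<lambda>(x, i). f i x) \<in> borel_measurable (M \<Otimes>\<^sub>M count_space I)"
    by (simp add: case_prod_beta')
qed

locale weighted_tree = directed_tree G for G :: "('v, 'i) pre_digraph" (structure) +
  fixes p :: real and \<rho> :: "'i \<Rightarrow> real \<Rightarrow> real"
  assumes rootless: "rootless G" and leafless: "leafless G"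
    and p: "1 < p" and weight: "weight G \<rho>" and admissible: "p_admissible G p \<rho>"
begin

lemma weight_pos: "i \<in> arcs G \<Longrightarrow> s \<in> {0..<1} \<Longrightarrow> \<rho> i s > 0"
  using weight by (auto simp: weight_def)

lemma weight_integrable: "i \<in> arcs G \<Longrightarrow> integrable unit_meas (\<rho> i)"
  using weight by (auto simp: weight_def)

lemma weight_measurable [measurable]: "i \<in> arcs G \<Longrightarrow> \<rho> i \<in> borel_measurable unit_meas"
  using weight_integrable by blast

lemma nn_integral_weight_finite:
  assumes "i \<in> arcs G"
  shows "(\<integral>\<^sup>+ s. ennreal (\<rho> i s) \<partial>unit_meas) < \<infinity>"
proof -
  have "(\<integral>\<^sup>+ s. ennreal (\<rho> i s) \<partial>unit_meas) \<le> (\<integral>\<^sup>+ s. ennreal (norm (\<rho> i s)) \<partial>unit_meas)"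
    by (intro nn_integral_mono ennreal_leI) simp
  also have "\<dots> < \<infinity>"
    using weight_integrable[OF assms] by (auto simp: integrable_iff_bounded)
  finally show ?thesis .
qed

lemma fiber_density_measurable:
  fixes f :: "real \<Rightarrow> 'k::real_normed_field"
  assumes "i \<in> arcs G" and [measurable]: "f \<in> borel_measurable unit_meas"
  shows "(\<lambda>s. ennreal (norm (f s) powr p * \<rho> i s)) \<in> borel_measurable unit_meas"
proof -
  note [measurable] = weight_measurable[OF assms(1)]
  show ?thesis by measurable
qed

text \<open>The contribution of a single position to the modular. The translate at s only involves
  values at \<open>shift_pos t s\<close>, so a function and its translate can be compared position
  by position before integrating.\<close>

definition fiber_mod :: "('i \<Rightarrow> real \<Rightarrow> 'k::real_normed_field) \<Rightarrow> real \<Rightarrow> ennreal" where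
  "fiber_mod f s = (\<integral>\<^sup>+i. ennreal (norm (f i s) powr p * \<rho> i s) \<partial>count_space (arcs G))"

lemma fiber_mod_measurable:
  assumes "\<And>i. i \<in> arcs G \<Longrightarrow> f i \<in> borel_measurable unit_meas"
  shows "fiber_mod f \<in> borel_measurable unit_meas"
  unfolding fiber_mod_def[abs_def]
  using assms by (intro borel_measurable_nn_integral_countable countable_arcs fiber_density_measurable)

lemma Lp_modular_eq_integral_fiber_mod:
  assumes "\<And>i. i \<in> arcs G \<Longrightarrow> f i \<in> borel_measurable unit_meas"
  shows "Lp_modular G p \<rho> f = (\<integral>\<^sup>+s. fiber_mod f s \<partial>unit_meas)"
  unfolding fiber_mod_def Lp_modular_def
  using assms by (intro nn_integral_count_space_nn_integral[symmetric] countable_arcs fiber_density_measurable)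

lemma Lp_modular_cong_AE:
  assumes "\<And>i. i \<in> arcs G \<Longrightarrow> AE s in unit_meas. f i s = g i s"
  shows "Lp_modular G p \<rho> f = Lp_modular G p \<rho> g"
  unfolding Lp_modular_def
proof (rule nn_integral_cong, rule nn_integral_cong_AE)
  fix i assume "i \<in> space (count_space (arcs G))"
  then have "AE s in unit_meas. f i s = g i s" using assms by simp
  then show "AE s in unit_meas. ennreal (norm (f i s) powr p * \<rho> i s) = ennreal (norm (g i s) powr p * \<rho> i s)"
    by eventually_elim simp
qed

lemma Lp_norm_less_if_modular_less:
  assumes "Lp_modular G p \<rho> f < ennreal (a powr p)" "0 < a"
  shows "Lp_norm G p \<rho> f < a"
proof -
  have fin: "Lp_modular G p \<rho> f < \<infinity>"
    unfolding infinity_ennreal_def using assms(1) by (rule less_trans[OF _ ennreal_less_top])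
  have "enn2real (Lp_modular G p \<rho> f) < a powr p"
    using assms fin by (cases "Lp_modular G p \<rho> f") (auto simp: ennreal_less_iff)
  then have "Lp_norm G p \<rho> f < (a powr p) powr (1 / p)"
    unfolding Lp_norm_def using p by (intro powr_less_mono2) auto
  then show ?thesis
    using p assms by (simp add: powr_powr)
qed

section \<open>Classes, balls and the semigroup on the quotient space; density of bounded functions
  of finite support\<close>

abbreviation Lp_class :: "('i \<Rightarrow> real \<Rightarrow> 'k::{real_normed_field, euclidean_space}) \<Rightarrow> ('i \<Rightarrow> real \<Rightarrow> 'k) set" where
  "Lp_class f \<equiv> Lp_rel G p \<rho> `` {f}"

abbreviation Lp_ball ::
    "('i \<Rightarrow> real \<Rightarrow> 'k::{real_normed_field, euclidean_space}) \<Rightarrow> real \<Rightarrow> ('i \<Rightarrow> real \<Rightarrow> 'k) set set" where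
  "Lp_ball f r \<equiv> Metric_space.mball (Lp_space G p \<rho>) (Lp_dist G p \<rho>) (Lp_class f) r"

lemma Lp_class_in_space: "f \<in> Lp_funs G p \<rho> \<Longrightarrow> Lp_class f \<in> Lp_space G p \<rho>"
  unfolding Lp_space_def by (rule quotientI)

text \<open>\<open>Lp_dist\<close> picks representatives by \<open>SOME\<close>; these agree with f
  and g almost everywhere on each edge, and the modular does not see the difference.\<close>

lemma Lp_dist_class:
  fixes f g :: "'i \<Rightarrow> real \<Rightarrow> 'k::{real_normed_field, euclidean_space}"
  assumes "f \<in> Lp_funs G p \<rho>" "g \<in> Lp_funs G p \<rho>"
  shows "Lp_dist G p \<rho> (Lp_class f) (Lp_class g) = Lp_norm G p \<rho> (\<lambda>i s. f i s - g i s)"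
proof -
  let ?F = "SOME h. h \<in> Lp_class f" and ?G = "SOME h. h \<in> Lp_class g"
  have "f \<in> Lp_class f" "g \<in> Lp_class g"
    using assms equiv_class_self[OF Lp_rel_equiv] by blast+
  then have "?F \<in> Lp_class f" "?G \<in> Lp_class g"
    by (metis someI)+
  then have FG: "AE s in unit_meas. f i s = ?F i s" "AE s in unit_meas. g i s = ?G i s" if "i \<in> arcs G" for i
    using that by (auto simp: Lp_rel_def)
  have "AE s in unit_meas. ?F i s - ?G i s = f i s - g i s" if "i \<in> arcs G" for i
    using FG[OF that] by eventually_elim simp
  then have "Lp_modular G p \<rho> (\<lambda>i s. ?F i s - ?G i s) = Lp_modular G p \<rho> (\<lambda>i s. f i s - g i s)"
    by (rule Lp_modular_cong_AE)
  then show ?thesis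
    by (simp only: Lp_dist_def Lp_norm_def)
qed

lemma Lp_class_eqI:
  assumes "(f, g) \<in> Lp_rel G p \<rho>"
  shows "Lp_class f = Lp_class g"
  using assms equiv_class_eq[OF Lp_rel_equiv] by blast

lemma Lp_class_in_ball_iff:
  fixes f g :: "'i \<Rightarrow> real \<Rightarrow> 'k::{real_normed_field, euclidean_space}"
  assumes "f \<in> Lp_funs G p \<rho>" "g \<in> Lp_funs G p \<rho>"
  shows "Lp_class g \<in> Lp_ball f r \<longleftrightarrow> Lp_norm G p \<rho> (\<lambda>i s. g i s - f i s) < r"
proof -
  interpret Metric_space "Lp_space G p \<rho>" "Lp_dist G p \<rho> :: ('i \<Rightarrow> real \<Rightarrow> 'k) set \<Rightarrow> _"
    by (rule Metric_space_Lp[OF weight p])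
  have "Lp_norm G p \<rho> (\<lambda>i s. f i s - g i s) = Lp_norm G p \<rho> (\<lambda>i s. g i s - f i s)"
    by (simp add: Lp_norm_def Lp_modular_def norm_minus_commute)
  then show ?thesis
    using assms by (simp add: in_mball Lp_class_in_space Lp_dist_class)
qed

lemma openin_Lp_ball:
  fixes f :: "'i \<Rightarrow> real \<Rightarrow> 'k::{real_normed_field, euclidean_space}"
  shows "openin (Lp_topology G p \<rho>) (Lp_ball f r)"
proof -
  interpret Metric_space "Lp_space G p \<rho>" "Lp_dist G p \<rho> :: ('i \<Rightarrow> real \<Rightarrow> 'k) set \<Rightarrow> _"
    by (rule Metric_space_Lp[OF weight p])
  show ?thesis
    unfolding Lp_topology_def by simp
qed

lemma openin_Lp_topologyE:
  fixes U :: "('i \<Rightarrow> real \<Rightarrow> 'k::{real_normed_field, euclidean_space}) set set"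
  assumes "openin (Lp_topology G p \<rho>) U" "U \<noteq> {}"
  obtains f r where "f \<in> Lp_funs G p \<rho>" "r > 0" "Lp_ball f r \<subseteq> U"
proof -
  interpret Metric_space "Lp_space G p \<rho>" "Lp_dist G p \<rho> :: ('i \<Rightarrow> real \<Rightarrow> 'k) set \<Rightarrow> _"
    by (rule Metric_space_Lp[OF weight p])
  obtain A where A: "A \<in> U" using assms(2) by blast
  then obtain r where "r > 0" "mball A r \<subseteq> U" "U \<subseteq> Lp_space G p \<rho>"
    using assms(1) unfolding Lp_topology_def openin_mtopology by blast
  moreover obtain f where "f \<in> Lp_funs G p \<rho>" "A = Lp_class f"
    using calculation(3) A Lp_space_some by blast
  ultimately show thesis
    using that by blast
qed

lemma left_trans_cong_AE:
  assumes t: "t \<ge> 0" and i: "i \<in> arcs G"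
    and fg: "\<And>j. j \<in> arcs G \<Longrightarrow> AE s in unit_meas. f j s = g j s"
  shows "AE s in unit_meas. left_trans G t f i s = left_trans G t g i s"
proof -
  have "AE s in unit_meas. \<forall>j\<in>arcs G. f j s = g j s"
    using fg countable_arcs by (simp add: AE_ball_countable)
  then have "AE s in unit_meas. \<forall>j\<in>arcs G. f j (shift_pos t s) = g j (shift_pos t s)"
    by (rule AE_shift_pos[OF t])
  then show ?thesis
  proof eventually_elim
    case (elim s)
    then show ?case
      unfolding left_trans_def using desc_edges_subset[OF i] by (intro infsum_cong) blast
  qed
qed

text \<open>The union in \<open>left_semigroup\<close> runs over all representatives. Each
  contributes the same class or, if its translate is not in \<open>Lp_funs\<close>, the empty set,
  so one good representative determines the union.\<close>

lemma left_semigroup_class: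
  fixes f :: "'i \<Rightarrow> real \<Rightarrow> 'k::{real_normed_field, euclidean_space}"
  assumes t: "t \<ge> 0" and f: "f \<in> Lp_funs G p \<rho>" and Tf: "left_trans G t f \<in> Lp_funs G p \<rho>"
  shows "left_semigroup G p \<rho> t (Lp_class f) = Lp_class (left_trans G t f)"
proof -
  have "Lp_class (left_trans G t g) \<subseteq> Lp_class (left_trans G t f)" if "g \<in> Lp_class f" for g
  proof (cases "left_trans G t g \<in> Lp_funs G p \<rho>")
    case True
    have "(left_trans G t f, left_trans G t g) \<in> Lp_rel G p \<rho>"
      using that True Tf left_trans_cong_AE[OF t, of _ f g] by (auto simp: Lp_rel_def)
    then show ?thesis
      using Lp_class_eqI by blast
  qed (auto simp: Lp_rel_def)
  moreover have "f \<in> Lp_class f"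
    using f equiv_class_self[OF Lp_rel_equiv] by blast
  ultimately show ?thesis
    unfolding left_semigroup_def by blast
qed

lemma return_times_ballsI:
  fixes f g h :: "'i \<Rightarrow> real \<Rightarrow> 'k::{real_normed_field, euclidean_space}"
  assumes "t \<ge> 0" "f \<in> Lp_funs G p \<rho>" "g \<in> Lp_funs G p \<rho>" "h \<in> Lp_funs G p \<rho>"
    and "left_trans G t h \<in> Lp_funs G p \<rho>"
    and "Lp_norm G p \<rho> (\<lambda>i s. h i s - f i s) < r"
    and "Lp_norm G p \<rho> (\<lambda>i s. left_trans G t h i s - g i s) < r'"
  shows "t \<in> return_times (left_semigroup G p \<rho>) (Lp_ball f r) (Lp_ball g r')"
proof -
  have "Lp_class h \<in> Lp_ball f r" "left_semigroup G p \<rho> t (Lp_class h) \<in> Lp_ball g r'"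
    using assms by (simp_all add: Lp_class_in_ball_iff left_semigroup_class)
  then show ?thesis
    using assms(1) by (auto simp: return_times_def)
qed

text \<open>The image of the class \<open>A\<close> lies in \<open>Lp_space\<close> and is therefore
  nonempty, so some representative h of \<open>A\<close> has its translate in
  \<open>Lp_funs\<close>; both distance conditions can be read off on this h.\<close>

lemma return_times_ballsE:
  fixes f g :: "'i \<Rightarrow> real \<Rightarrow> 'k::{real_normed_field, euclidean_space}"
  assumes "t \<in> return_times (left_semigroup G p \<rho>) (Lp_ball f r) (Lp_ball g r')"
    and f: "f \<in> Lp_funs G p \<rho>" and g: "g \<in> Lp_funs G p \<rho>"
  obtains h where "h \<in> Lp_funs G p \<rho>" "left_trans G t h \<in> Lp_funs G p \<rho>"
    "Lp_norm G p \<rho> (\<lambda>i s. h i s - f i s) < r"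
    "Lp_norm G p \<rho> (\<lambda>i s. left_trans G t h i s - g i s) < r'"
proof -
  interpret Metric_space "Lp_space G p \<rho>" "Lp_dist G p \<rho> :: ('i \<Rightarrow> real \<Rightarrow> 'k) set \<Rightarrow> _"
    by (rule Metric_space_Lp[OF weight p])
  obtain A where A: "A \<in> Lp_ball f r" and TA: "left_semigroup G p \<rho> t A \<in> Lp_ball g r'"
    using assms(1) by (auto simp: return_times_def simp del: in_mball)
  have AL: "A \<in> Lp_space G p \<rho>" "left_semigroup G p \<rho> t A \<in> Lp_space G p \<rho>"
    using A TA by (simp_all add: in_mball)
  define u where "u = (SOME u. u \<in> left_semigroup G p \<rho> t A)"
  have u: "u \<in> Lp_funs G p \<rho>" "left_semigroup G p \<rho> t A = Lp_class u"
    using Lp_space_some[OF AL(2)] by (simp_all add: u_def)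
  then have "u \<in> left_semigroup G p \<rho> t A"
    using equiv_class_self[OF Lp_rel_equiv] by metis
  then obtain h where h: "h \<in> A" "(left_trans G t h, u) \<in> Lp_rel G p \<rho>"
    by (auto simp: left_semigroup_def)
  define a where "a = (SOME a. a \<in> A)"
  have "A = Lp_class a"
    using Lp_space_some[OF AL(1)] by (simp add: a_def)
  then have ah: "(a, h) \<in> Lp_rel G p \<rho>" using h(1) by blast
  then have hL: "h \<in> Lp_funs G p \<rho>" and Ah: "A = Lp_class h"
    using \<open>A = Lp_class a\<close> Lp_class_eqI[OF ah] by (simp_all add: Lp_rel_def)
  have Th: "left_trans G t h \<in> Lp_funs G p \<rho>" "left_semigroup G p \<rho> t A = Lp_class (left_trans G t h)"
    using h(2) u(2) Lp_class_eqI[OF h(2)] by (simp_all add: Lp_rel_def)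
  show thesis
    using that[OF hL Th(1)] A TA unfolding Ah[symmetric] Th(2)
    using Lp_class_in_ball_iff f g hL Th(1) Ah by blast
qed

text \<open>Truncation: keep the first m edges of an enumeration and the values of norm at most m.
  Dominated convergence is applied on each edge and then over the edges, the density of f dominating
  both times.\<close>

lemma bounded_finite_support_dense:
  fixes f :: "'i \<Rightarrow> real \<Rightarrow> 'k::{real_normed_field, euclidean_space}"
  assumes f: "f \<in> Lp_funs G p \<rho>" and e: "e > 0"
  obtains g K B where "g \<in> Lp_funs G p \<rho>" "Lp_norm G p \<rho> (\<lambda>i s. g i s - f i s) < e"
    "finite K" "K \<subseteq> arcs G" "B \<ge> 0" "\<forall>i s. i \<notin> K \<longrightarrow> g i s = 0" "\<forall>i s. norm (g i s) \<le> B"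
proof -
  define P where "P m i s \<longleftrightarrow> to_nat_on (arcs G) i < m \<and> norm (f i s) \<le> real m" for m i s
  define g where "g m i s = (if i \<in> arcs G \<and> P m i s then f i s else 0)" for m i s
  let ?w = "\<lambda>i s. ennreal (norm (f i s) powr p * \<rho> i s)"
  let ?u = "\<lambda>m i s. ennreal (norm (g m i s - f i s) powr p * \<rho> i s)"
  have fm [measurable]: "f i \<in> borel_measurable unit_meas" if "i \<in> arcs G" for i
    using f that by (auto simp: Lp_funs_def)
  have fin: "Lp_modular G p \<rho> f < \<infinity>"
    using f by (auto simp: Lp_funs_def)
  have gm [measurable]: "g m i \<in> borel_measurable unit_meas" if "i \<in> arcs G" for m i
    unfolding g_def P_def using fm[OF that] by measurable
  have u_le: "?u m i s \<le> ?w i s" if "i \<in> arcs G" "s \<in> {0..<1}" for m i s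
    using that weight_pos by (auto simp: g_def intro!: mult_right_mono ennreal_leI)
  have inner: "(\<lambda>m. \<integral>\<^sup>+s. ?u m i s \<partial>unit_meas) \<longlonglongrightarrow> 0" if i: "i \<in> arcs G" for i
  proof -
    note [measurable] = fm[OF i] gm[OF i] weight_measurable[OF i]
    have "(\<lambda>m. \<integral>\<^sup>+s. ?u m i s \<partial>unit_meas) \<longlonglongrightarrow> (\<integral>\<^sup>+s. 0 \<partial>unit_meas)"
    proof (rule nn_integral_dominated_convergence[where w = "?w i"])
      show "AE s in unit_meas. ?u m i s \<le> ?w i s" for m
        using u_le[OF i] by (intro AE_I2) simp
      have "(\<integral>\<^sup>+s. ?w i s \<partial>unit_meas) \<le> Lp_modular G p \<rho> f"
        unfolding Lp_modular_def by (rule nn_integral_ge_point) (rule i)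
      then show "(\<integral>\<^sup>+s. ?w i s \<partial>unit_meas) < \<infinity>"
        using fin by simp
      show "AE s in unit_meas. (\<lambda>m. ?u m i s) \<longlonglongrightarrow> 0"
      proof (rule AE_I2)
        fix s
        obtain m0 where m0: "norm (f i s) \<le> real m0"
          using real_arch_simple by blast
        have "?u m i s = 0" if "m \<ge> max (Suc (to_nat_on (arcs G) i)) m0" for m
          using that m0 i by (auto simp: g_def P_def)
        then show "(\<lambda>m. ?u m i s) \<longlonglongrightarrow> 0"
          by (intro tendsto_eventually eventually_sequentiallyI)
      qed
    qed measurable
    then show ?thesis by simp
  qed
  have "(\<lambda>m. Lp_modular G p \<rho> (\<lambda>i s. g m i s - f i s)) \<longlonglongrightarrow> (\<integral>\<^sup>+i. 0 \<partial>count_space (arcs G))"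
    unfolding Lp_modular_def
  proof (rule nn_integral_dominated_convergence[where w = "\<lambda>i. \<integral>\<^sup>+s. ?w i s \<partial>unit_meas"])
    show "AE i in count_space (arcs G). (\<integral>\<^sup>+s. ?u m i s \<partial>unit_meas) \<le> (\<integral>\<^sup>+s. ?w i s \<partial>unit_meas)" for m
      by (intro AE_I2 nn_integral_mono u_le) auto
    show "(\<integral>\<^sup>+i. (\<integral>\<^sup>+s. ?w i s \<partial>unit_meas) \<partial>count_space (arcs G)) < \<infinity>"
      using fin by (simp add: Lp_modular_def)
    show "AE i in count_space (arcs G). (\<lambda>m. \<integral>\<^sup>+s. ?u m i s \<partial>unit_meas) \<longlonglongrightarrow> 0"
      by (intro AE_I2 inner) simp
  qed auto
  then have "\<forall>\<^sub>F m in sequentially. Lp_modular G p \<rho> (\<lambda>i s. g m i s - f i s) < ennreal (e powr p)"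
    using e by (intro order_tendstoD(2)) auto
  then obtain m where m: "Lp_modular G p \<rho> (\<lambda>i s. g m i s - f i s) < ennreal (e powr p)"
    by (auto simp: eventually_sequentially)
  have "Lp_modular G p \<rho> (g m) \<le> Lp_modular G p \<rho> f"
    unfolding Lp_modular_def
    using weight_pos by (intro nn_integral_mono ennreal_leI mult_right_mono) (auto simp: g_def intro: less_imp_le)
  then have gL: "g m \<in> Lp_funs G p \<rho>"
    using fin gm by (auto simp: Lp_funs_def)
  let ?K = "{i \<in> arcs G. to_nat_on (arcs G) i < m}"
  have "finite (to_nat_on (arcs G) ` ?K)"
    by (rule finite_subset[of _ "{..<m}"]) auto
  moreover have "inj_on (to_nat_on (arcs G)) ?K"
    using inj_on_to_nat_on[OF countable_arcs] by (rule inj_on_subset) auto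
  ultimately have "finite ?K"
    using finite_imageD by blast
  then show thesis
    by (rule that[OF gL Lp_norm_less_if_modular_less[OF m e], of ?K "real m"])
       (auto simp: g_def P_def)
qed

end

section \<open>Recurrence implies the weight condition\<close>

lemma enn_powr_ennreal: "x > 0 \<Longrightarrow> enn_powr (ennreal x) a = ennreal (x powr a)"
  by (simp add: enn_powr_def)

context weighted_tree
begin

text \<open>The weight for Hoelder's inequality: its power 1 - p is \<rho> again, so the second
  factor in \<open>Hoelder_sum\<close> becomes the modular.\<close>

definition dual_weight :: "'i \<Rightarrow> real \<Rightarrow> real" where
  "dual_weight j s = \<rho> j s powr (- 1 / (p - 1))"

lemma dual_weight_pos: "j \<in> arcs G \<Longrightarrow> s \<in> {0..<1} \<Longrightarrow> dual_weight j s > 0"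
  using weight_pos[of j s] by (simp add: dual_weight_def)

lemma dual_sum_eq: "dual_sum G p \<rho> k t s =
    (\<integral>\<^sup>+j. ennreal (dual_weight j (shift_pos t s)) \<partial>count_space (desc_edges G (cross_count t s) k))"
  by (simp add: dual_sum_def dual_weight_def)

lemma dual_weight_powr:
  assumes "j \<in> arcs G" "s \<in> {0..<1}"
  shows "dual_weight j s powr (1 - p) = \<rho> j s"
proof -
  have "- 1 / (p - 1) * (1 - p) = 1"
    using p by (simp add: field_simps)
  then show ?thesis
    using weight_pos[OF assms] by (simp add: dual_weight_def powr_powr)
qed

lemma Psi_eq: "Psi G p \<rho> i t s =
    enn_powr (ennreal (dual_weight (anc_edge G (cross_count t s) i) s)
      + dual_sum G p \<rho> (anc_edge G (cross_count t s) i) t s) (1 - p)"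
  unfolding Psi_def dual_weight_def Let_def ..

text \<open>Admissibility bounds the sum from above, and it is positive because fibers in a leafless
  tree are nonempty. At nonnegative times the conventions of \<open>enn_powr\<close> at 0 and
  infinity thus never enter for it.\<close>

lemma dual_sum_real:
  assumes k: "k \<in> arcs G" and t: "t \<ge> 0" and s: "s \<in> {0..<1}"
  obtains S where "S > 0" "dual_sum G p \<rho> k t s = ennreal S"
proof -
  let ?D = "dual_sum G p \<rho> k t s"
  obtain M \<omega> where "enn_powr ?D (p - 1) \<le> ennreal (M powr p * exp (p * \<omega> * t) * (1 / \<rho> k s))"
    using admissible k t s unfolding p_admissible_def by blast
  then have "enn_powr ?D (p - 1) \<noteq> \<infinity>"
    by (auto simp: top_unique)
  then have "?D \<noteq> \<infinity>"
    using p by (auto simp: enn_powr_def)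
  moreover have "?D \<noteq> 0"
  proof -
    obtain j where j: "j \<in> desc_edges G (cross_count t s) k"
      using desc_edges_nonempty[OF leafless k] by blast
    have "ennreal (dual_weight j (shift_pos t s)) \<le> ?D"
      unfolding dual_sum_eq using j by (rule nn_integral_ge_point)
    moreover have "dual_weight j (shift_pos t s) > 0"
      using j desc_edges_subset[OF k] shift_pos_in_unit[OF t s] by (intro dual_weight_pos) auto
    ultimately show ?thesis
      by (auto simp: ennreal_eq_0_iff)
  qed
  ultimately show thesis
    using that[of "enn2real ?D"] by (cases ?D) (auto simp: enn2real_positive_iff)
qed

text \<open>Hoelder on the fiber below k, its second factor enlarged to all edges so that a
  \<open>fiber_mod\<close> can be inserted.\<close>

lemma fiber_Hoelder:
  fixes z :: "'i \<Rightarrow> 'k::banach"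
  assumes k: "k \<in> arcs G" and t: "t \<ge> 0" and s: "s \<in> {0..<1}"
    and S: "S > 0" "dual_sum G p \<rho> k t s = ennreal S"
    and W: "W \<ge> 0" "(\<integral>\<^sup>+j. ennreal (norm (z j) powr p * \<rho> j (shift_pos t s)) \<partial>count_space (arcs G)) \<le> ennreal W"
  shows "z summable_on desc_edges G (cross_count t s) k"
    and "norm (\<Sum>\<^sub>\<infinity>j\<in>desc_edges G (cross_count t s) k. z j) powr p \<le> S powr (p - 1) * W"
proof -
  let ?A = "desc_edges G (cross_count t s) k" and ?x = "shift_pos t s"
  have A: "?A \<subseteq> arcs G" using desc_edges_subset[OF k] .
  have x: "?x \<in> {0..<1}" using shift_pos_in_unit[OF t s] .
  have "(\<integral>\<^sup>+j. ennreal (dual_weight j ?x powr (1 - p) * norm (z j) powr p) \<partial>count_space ?A)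
      = (\<integral>\<^sup>+j. ennreal (norm (z j) powr p * \<rho> j ?x) \<partial>count_space ?A)"
    using A x by (intro nn_integral_cong) (auto simp: dual_weight_powr mult.commute)
  also have "\<dots> \<le> (\<integral>\<^sup>+j. ennreal (norm (z j) powr p * \<rho> j ?x) \<partial>count_space (arcs G))"
    using A by (auto simp: nn_integral_count_space_indicator intro!: nn_integral_mono split: split_indicator)
  finally have W': "(\<integral>\<^sup>+j. ennreal (dual_weight j ?x powr (1 - p) * norm (z j) powr p) \<partial>count_space ?A) \<le> ennreal W"
    using W(2) by simp
  have S': "(\<integral>\<^sup>+j. ennreal (dual_weight j ?x) \<partial>count_space ?A) \<le> ennreal S"
    using S(2) by (simp add: dual_sum_eq)
  have "\<And>j. j \<in> ?A \<Longrightarrow> dual_weight j ?x > 0"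
    using A x dual_weight_pos by blast
  note H = Hoelder_infsum[OF p this less_imp_le[OF S(1)] W(1) S' W']
  show "z summable_on ?A" "norm (\<Sum>\<^sub>\<infinity>j\<in>?A. z j) powr p \<le> S powr (p - 1) * W"
    using H by blast+
qed

definition one_on :: "'i set \<Rightarrow> 'i \<Rightarrow> real \<Rightarrow> 'k::real_normed_field" where
  "one_on K i s = (if i \<in> K then 1 else 0)"

lemma one_on_in_Lp:
  assumes "finite K" "K \<subseteq> arcs G"
  shows "one_on K \<in> Lp_funs G p \<rho>"
proof -
  have "Lp_modular G p \<rho> (one_on K) = (\<Sum>i\<in>K. \<integral>\<^sup>+ s. ennreal (\<rho> i s) \<partial>unit_meas)"
    unfolding Lp_modular_def
    using assms by (subst nn_integral_count_space'[of K]) (auto simp: one_on_def)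
  also have "\<dots> < \<infinity>"
    using assms nn_integral_weight_finite by (simp add: less_top subset_eq)
  finally show ?thesis
    by (simp add: Lp_funs_def) (simp add: one_on_def[abs_def])
qed

text \<open>The factor 2^p is the price of the threshold 1/2: the translate at i is only known to
  have norm at least 1/2.\<close>

lemma Phi_le_fiber_mod:
  fixes h :: "'i \<Rightarrow> real \<Rightarrow> 'k::{real_normed_field, euclidean_space}"
  assumes i: "i \<in> arcs G" and t: "t \<ge> 0" and s: "s \<in> {0..<1}"
    and disj: "desc_edges G (cross_count t s) i \<inter> K = {}"
    and near: "norm (left_trans G t h i s - 1) \<le> 1 / 2"
  shows "Phi G p \<rho> i t s \<le> ennreal (2 powr p) * fiber_mod (\<lambda>i s. h i s - one_on K i s) (shift_pos t s)"
proof (cases "fiber_mod (\<lambda>i s. h i s - one_on K i s) (shift_pos t s)")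
  case (real W)
  let ?A = "desc_edges G (cross_count t s) i" and ?x = "shift_pos t s"
  obtain S where S: "S > 0" "dual_sum G p \<rho> i t s = ennreal S"
    using dual_sum_real[OF i t s] .
  have W: "(\<integral>\<^sup>+j. ennreal (norm (h j ?x - one_on K j ?x) powr p * \<rho> j ?x) \<partial>count_space (arcs G)) \<le> ennreal W"
    using real(2) by (simp add: fiber_mod_def)
  \<comment> \<open>The fiber avoids K, where \<open>one_on K\<close> lives, so on it h coincides
    with its own small error.\<close>
  have "left_trans G t h i s = (\<Sum>\<^sub>\<infinity>j\<in>?A. h j ?x - one_on K j ?x)"
    unfolding left_trans_def using disj by (intro infsum_cong) (auto simp: one_on_def)
  then have le: "norm (left_trans G t h i s) powr p \<le> S powr (p - 1) * W"
    using fiber_Hoelder(2)[OF i t s S real(1) W] by simp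
  have "1 - norm (left_trans G t h i s) \<le> 1 / 2"
    using near norm_triangle_ineq2[of 1 "left_trans G t h i s"] by (simp add: norm_minus_commute)
  then have "(1 / 2) powr p \<le> norm (left_trans G t h i s) powr p"
    using p by (intro powr_mono2) auto
  then have "1 / 2 powr p \<le> S powr (p - 1) * W"
    using le by (simp add: powr_divide)
  then have "S powr (1 - p) * 1 \<le> S powr (1 - p) * (2 powr p * (S powr (p - 1) * W))"
    by (intro mult_left_mono) (auto simp: field_simps)
  also have "\<dots> = S powr (1 - p) * S powr (p - 1) * (2 powr p * W)"
    by (simp only: mult_ac)
  also have "S powr (1 - p) * S powr (p - 1) = 1"
    using S(1) by (simp flip: powr_add)
  finally have "S powr (1 - p) \<le> 2 powr p * W" by simp
  then show ?thesis
    using S real by (simp add: Phi_def enn_powr_ennreal flip: ennreal_mult)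
qed (simp add: ennreal_mult_top)

text \<open>The translate at k and the error of h on the fiber over k differ by the integer
  \<open>card (?A \<inter> K)\<close>, of norm at least 1. Splitting this cost between two blocks of
  weights \<open>dual_weight k s\<close> and S leaves at least the power 1 - p of their sum.\<close>

lemma Psi_le_fiber_mod:
  fixes h :: "'i \<Rightarrow> real \<Rightarrow> 'k::{real_normed_field, euclidean_space}"
  assumes i: "i \<in> K" and K: "finite K" "K \<subseteq> arcs G" and t: "t \<ge> 0" and s: "s \<in> {0..<1}"
    and disj: "\<And>k. k \<in> K \<Longrightarrow> desc_edges G (cross_count t s) k \<inter> K = {}"
  shows "Psi G p \<rho> i t s \<le> fiber_mod (\<lambda>i s. left_trans G t h i s - one_on K i s) s
           + fiber_mod (\<lambda>i s. h i s - one_on K i s) (shift_pos t s)"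
    (is "_ \<le> ?Y + ?X")
proof (cases "?X = \<infinity> \<or> ?Y = \<infinity>")
  case False
  then obtain V W where V: "V \<ge> 0" "?Y = ennreal V" and W: "W \<ge> 0" "?X = ennreal W"
    by (cases ?X; cases ?Y) auto
  let ?n = "cross_count t s" and ?x = "shift_pos t s"
  define k where "k = anc_edge G ?n i"
  let ?A = "desc_edges G ?n k"
  have k: "k \<in> arcs G" "i \<in> ?A"
    using anc_edge[OF rootless, of i ?n] i K by (auto simp: k_def)
  \<comment> \<open>Otherwise the fiber over k would meet K in i, against \<open>disj\<close>. Hence
    the target of the translate at k is 0.\<close>
  have kK: "k \<notin> K"
    using disj k i by blast
  obtain S where S: "S > 0" "dual_sum G p \<rho> k t s = ennreal S"
    using dual_sum_real[OF k(1) t s] .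
  let ?z = "\<lambda>j. h j ?x - one_on K j ?x"
  have W': "(\<integral>\<^sup>+j. ennreal (norm (?z j) powr p * \<rho> j ?x) \<partial>count_space (arcs G)) \<le> ennreal W"
    using W(2) by (simp add: fiber_mod_def)
  note H = fiber_Hoelder[OF k(1) t s S W(1) W']
  have one: "(\<lambda>j. one_on K j ?x :: 'k) summable_on ?A" "(\<Sum>\<^sub>\<infinity>j\<in>?A. one_on K j ?x :: 'k) = of_nat (card (?A \<inter> K))"
  proof -
    have fin: "finite (?A \<inter> K)" using K by simp
    then show "(\<lambda>j. one_on K j ?x :: 'k) summable_on ?A"
      by (intro finite_nonzero_values_imp_summable_on) (auto simp: one_on_def elim: rev_finite_subset)
    have "(\<Sum>\<^sub>\<infinity>j\<in>?A. one_on K j ?x :: 'k) = (\<Sum>\<^sub>\<infinity>j\<in>?A \<inter> K. 1)"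
      by (rule infsum_cong_neutral) (auto simp: one_on_def)
    then show "(\<Sum>\<^sub>\<infinity>j\<in>?A. one_on K j ?x :: 'k) = of_nat (card (?A \<inter> K))"
      using fin by simp
  qed
  have "left_trans G t h k s = (\<Sum>\<^sub>\<infinity>j\<in>?A. ?z j + one_on K j ?x)"
    unfolding left_trans_def by (intro infsum_cong) auto
  also have "\<dots> = (\<Sum>\<^sub>\<infinity>j\<in>?A. ?z j) + of_nat (card (?A \<inter> K))"
    using infsum_add[OF H(1) one(1)] one(2) by simp
  finally have eq: "of_nat (card (?A \<inter> K)) = left_trans G t h k s - (\<Sum>\<^sub>\<infinity>j\<in>?A. ?z j)"
    by simp
  have "card (?A \<inter> K) \<noteq> 0"
    using k i K by auto
  then have "1 \<le> norm (of_nat (card (?A \<inter> K)) :: 'k)"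
    by (simp add: norm_of_nat)
  also have "\<dots> \<le> norm (left_trans G t h k s) + norm (\<Sum>\<^sub>\<infinity>j\<in>?A. ?z j)"
    unfolding eq by (rule norm_triangle_ineq4)
  finally have ge1: "1 \<le> norm (left_trans G t h k s) + norm (\<Sum>\<^sub>\<infinity>j\<in>?A. ?z j)" (is "1 \<le> ?a + ?b") .
  have r: "\<rho> k s > 0" "dual_weight k s > 0"
    using weight_pos[OF k(1) s] dual_weight_pos[OF k(1) s] by simp_all
  have "1 powr p \<le> (?a + ?b) powr p"
    using ge1 p by (intro powr_mono2) auto
  also have "\<dots> \<le> (dual_weight k s + S) powr (p - 1)
      * (dual_weight k s powr (1 - p) * ?a powr p + S powr (1 - p) * ?b powr p)"
    using r S p by (intro powr_convex_combination) auto
  also have "\<dots> \<le> (dual_weight k s + S) powr (p - 1) * (V + W)"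
  proof (intro mult_left_mono add_mono)
    have "ennreal (norm (left_trans G t h k s - one_on K k s) powr p * \<rho> k s) \<le> ?Y"
      unfolding fiber_mod_def using k(1) by (rule nn_integral_ge_point)
    then show "dual_weight k s powr (1 - p) * ?a powr p \<le> V"
      using kK V dual_weight_powr[OF k(1) s] by (simp add: one_on_def mult.commute)
    have "S powr (1 - p) * ?b powr p \<le> S powr (1 - p) * (S powr (p - 1) * W)"
      using H(2) by (intro mult_left_mono) auto
    also have "\<dots> = W"
      using S(1) by (simp flip: powr_add mult.assoc)
    finally show "S powr (1 - p) * ?b powr p \<le> W" .
  qed auto
  finally have "(dual_weight k s + S) powr (1 - p) * 1
      \<le> (dual_weight k s + S) powr (1 - p) * ((dual_weight k s + S) powr (p - 1) * (V + W))"
    by (intro mult_left_mono) auto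
  also have "\<dots> = V + W"
    using S(1) r by (simp flip: powr_add mult.assoc)
  finally have "(dual_weight k s + S) powr (1 - p) \<le> V + W"
    by simp
  moreover have "Psi G p \<rho> i t s = ennreal ((dual_weight k s + S) powr (1 - p))"
    using S r by (simp add: Psi_eq k_def[symmetric] enn_powr_ennreal flip: ennreal_plus)
  ultimately show ?thesis
    using V W by (simp flip: ennreal_plus)
qed auto

end

section \<open>Exceptional sets, and the passage from return times to the weight condition\<close>

context weighted_tree
begin

lemma emeasure_unit_meas_unit: "emeasure unit_meas {0..<1} = 1"
  by (simp add: emeasure_restrict_space)

text \<open>For finite K and positive weights the sets \<open>B n\<close> decrease to the empty set,
  so their measures tend to 0. Where the weight is at least c, a small weighted error is a small
  error.\<close>

lemma weight_bounded_below_off_small_set: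
  assumes "finite K" "K \<subseteq> arcs G" "e > 0"
  obtains c where "c > 0" "emeasure unit_meas {s \<in> {0..<1}. \<exists>i\<in>K. \<rho> i s < c} < ennreal e"
proof -
  define B where "B n = {s \<in> space unit_meas. \<exists>i\<in>K. \<rho> i s < 1 / real (Suc n)}" for n
  have B_sets: "B n \<in> sets unit_meas" for n
  proof -
    have "B n = (\<Union>i\<in>K. {s \<in> space unit_meas. \<rho> i s < 1 / real (Suc n)})"
      by (auto simp: B_def)
    also have "\<dots> \<in> sets unit_meas"
    proof (intro sets.finite_UN assms(1))
      fix i assume "i \<in> K"
      then have [measurable]: "\<rho> i \<in> borel_measurable unit_meas"
        using weight_measurable assms(2) by blast
      show "{s \<in> space unit_meas. \<rho> i s < 1 / real (Suc n)} \<in> sets unit_meas"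
        by measurable
    qed
    finally show ?thesis .
  qed
  have "(\<lambda>n. emeasure unit_meas (B n)) \<longlonglongrightarrow> emeasure unit_meas (\<Inter>n. B n)"
  proof (rule Lim_emeasure_decseq)
    show "range B \<subseteq> sets unit_meas" using B_sets by blast
    show "decseq B"
    proof (rule decseq_SucI, rule subsetI)
      fix n s
      assume "s \<in> B (Suc n)"
      moreover have "1 / real (Suc (Suc n)) \<le> 1 / real (Suc n)"
        by (simp add: frac_le)
      ultimately show "s \<in> B n"
        unfolding B_def by (blast intro: less_le_trans)
    qed
    show "emeasure unit_meas (B n) \<noteq> \<infinity>" for n
    proof -
      have "emeasure unit_meas (B n) \<le> emeasure unit_meas (space unit_meas)"
        by (rule emeasure_space)
      also have "\<dots> = 1"
        using emeasure_unit_meas_unit by simp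
      finally show ?thesis by (auto simp: top_unique)
    qed
  qed
  also have "(\<Inter>n. B n) = {}"
  proof -
    have False if s: "\<And>n. s \<in> B n" for s
    proof -
      have su: "s \<in> {0..<1}" using s[of 0] by (simp add: B_def)
      define m where "m = Min (insert 1 ((\<lambda>i. \<rho> i s) ` K))"
      have "m > 0"
        unfolding m_def using assms weight_pos su by (subst Min_gr_iff) auto
      then obtain n where n: "1 / real (Suc n) < m"
        using nat_approx_posE by blast
      obtain i where "i \<in> K" "\<rho> i s < 1 / real (Suc n)"
        using s[of n] by (auto simp: B_def)
      moreover have "m \<le> \<rho> i s"
        unfolding m_def using assms \<open>i \<in> K\<close> by (intro Min_le) auto
      ultimately show False using n by simp
    qed
    then show ?thesis by auto
  qed
  finally have "(\<lambda>n. emeasure unit_meas (B n)) \<longlonglongrightarrow> 0" by simp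
  then have "\<forall>\<^sub>F n in sequentially. emeasure unit_meas (B n) < ennreal e"
    using assms(3) by (intro order_tendstoD(2)) auto
  then obtain n where "emeasure unit_meas (B n) < ennreal e"
    by (auto simp: eventually_sequentially)
  then show thesis
    using that[of "1 / real (Suc n)"] by (simp add: B_def)
qed

text \<open>Beyond time N + 1 the crossing number exceeds N at every position, so fibers over K
  avoid K. The bound on \<open>Psi\<close> then holds everywhere, that on \<open>Phi\<close> off two
  exceptional sets.\<close>

lemma N_times_superset_return_times:
  assumes K: "finite K" "K \<noteq> {}" "K \<subseteq> arcs G" and \<epsilon>: "0 < \<epsilon>" and \<alpha>: "\<alpha> < 1"
  obtains d R where "d > 0" "R > 0"
    "return_times (left_semigroup G p \<rho>)
        (Lp_ball (one_on K :: 'i \<Rightarrow> real \<Rightarrow> 'k::{real_normed_field, euclidean_space}) d)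
        (Lp_ball (one_on K) d) \<inter> {R<..}
      \<subseteq> N_times G p \<rho> K \<epsilon> \<alpha>"
proof -
  obtain N where N: "\<And>n i. n > N \<Longrightarrow> i \<in> K \<Longrightarrow> desc_edges G n i \<inter> K = {}"
    using desc_edges_eventually_disjoint[OF K(1,3)] by blast
  \<comment> \<open>Two exceptional sets \<open>B1\<close> and \<open>B2\<close> of measure below
    \<beta> each leave a set of measure above \<alpha>.\<close>
  define \<beta> where "\<beta> = (1 - \<alpha>) / 2"
  have \<beta>: "\<beta> > 0" using \<alpha> by (simp add: \<beta>_def)
  obtain c where c: "c > 0" "emeasure unit_meas {s \<in> {0..<1}. \<exists>i\<in>K. \<rho> i s < c} < ennreal \<beta>"
    using weight_bounded_below_off_small_set[OF K(1,3) \<beta>] .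
  \<comment> \<open>The first bound makes the final integral at most \<epsilon>/2: for each edge of
    K there are 2^p + 1 copies of the integral of \<open>X\<close> and one of that of
    \<open>Y\<close>. The second makes the Markov bound for \<open>B2\<close> at most
    \<beta>/2.\<close>
  define \<eta> where "\<eta> = min (\<epsilon> / (2 * real (card K) * (2 powr p + 2))) (c * \<beta> / (2 * 2 powr p))"
  have "card K > 0" using K by auto
  then have \<eta>: "\<eta> > 0" using \<epsilon> c \<beta> by (simp add: \<eta>_def add_pos_pos)
  define d where "d = \<eta> powr (1 / p)"
  have d: "d > 0" "d powr p = \<eta>"
    using \<eta> p by (simp_all add: d_def powr_powr)
  have "t \<in> N_times G p \<rho> K \<epsilon> \<alpha>"
    if ret: "t \<in> return_times (left_semigroup G p \<rho>)
        (Lp_ball (one_on K :: 'i \<Rightarrow> real \<Rightarrow> 'k) d) (Lp_ball (one_on K) d)"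
      and tR: "t > real N + 1" for t
  proof -
    have t: "t \<ge> 0" using tR by simp
    have one: "(one_on K :: 'i \<Rightarrow> real \<Rightarrow> 'k) \<in> Lp_funs G p \<rho>"
      by (rule one_on_in_Lp[OF K(1,3)])
    obtain h :: "'i \<Rightarrow> real \<Rightarrow> 'k" where h: "h \<in> Lp_funs G p \<rho>" "left_trans G t h \<in> Lp_funs G p \<rho>"
      and h1: "Lp_norm G p \<rho> (\<lambda>i s. h i s - one_on K i s) < d"
      and h2: "Lp_norm G p \<rho> (\<lambda>i s. left_trans G t h i s - one_on K i s) < d"
      using return_times_ballsE[OF ret one one] by blast
    define X where "X = fiber_mod (\<lambda>i s. h i s - one_on K i s)"
    define Y where "Y = fiber_mod (\<lambda>i s. left_trans G t h i s - one_on K i s)"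
    have meas: "h i \<in> borel_measurable unit_meas" "left_trans G t h i \<in> borel_measurable unit_meas"
      "(one_on K i :: real \<Rightarrow> 'k) \<in> borel_measurable unit_meas" if "i \<in> arcs G" for i
      using that h one by (auto simp: Lp_funs_def)
    have XY [measurable]: "X \<in> borel_measurable unit_meas" "Y \<in> borel_measurable unit_meas"
      unfolding X_def Y_def by (intro fiber_mod_measurable borel_measurable_diff meas; assumption)+
    have intX: "(\<integral>\<^sup>+s. X s \<partial>unit_meas) \<le> ennreal \<eta>" and intY: "(\<integral>\<^sup>+s. Y s \<partial>unit_meas) \<le> ennreal \<eta>"
      using Lp_modular_le_if_norm_less[OF p Lp_norm_diff(1)[OF weight p h(1) one] h1]
        Lp_modular_le_if_norm_less[OF p Lp_norm_diff(1)[OF weight p h(2) one] h2]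
      unfolding X_def Y_def d(2)
      by (simp_all add: Lp_modular_eq_integral_fiber_mod borel_measurable_diff meas)
    have disj: "desc_edges G (cross_count t s) k \<inter> K = {}" if "k \<in> K" "s \<in> {0..<1}" for k s
    proof (rule N[OF _ that(1)])
      have "int N + 1 \<le> \<lfloor>t + s\<rfloor>" using tR that by (simp add: le_floor_iff)
      then show "N < cross_count t s" by (simp add: cross_count_def)
    qed
    define B1 where "B1 = {s \<in> {0..<1}. \<exists>i\<in>K. \<rho> i s < c}"
    \<comment> \<open>Off \<open>B1\<close> an error of norm at least 1/2 on an edge of K
      contributes at least c / 2^p to \<open>Y s\<close>, so such positions are caught by
      \<open>B2\<close>.\<close>
    define B2 where "B2 = {s \<in> {0..<1}. 1 \<le> ennreal (2 powr p / c) * Y s}"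
    have B1 [measurable]: "B1 \<in> sets unit_meas"
    proof -
      have "B1 = (\<Union>i\<in>K. {s \<in> space unit_meas. \<rho> i s < c})"
        by (auto simp: B1_def)
      also have "\<dots> \<in> sets unit_meas"
      proof (intro sets.finite_UN K(1))
        fix i assume "i \<in> K"
        then have [measurable]: "\<rho> i \<in> borel_measurable unit_meas"
          using weight_measurable K by blast
        show "{s \<in> space unit_meas. \<rho> i s < c} \<in> sets unit_meas"
          by measurable
      qed
      finally show ?thesis .
    qed
    have B2 [measurable]: "B2 \<in> sets unit_meas"
    proof -
      have "{s \<in> space unit_meas. 1 \<le> ennreal (2 powr p / c) * Y s} \<in> sets unit_meas"
        by measurable
      then show ?thesis by (simp add: B2_def)
    qed
    have "emeasure unit_meas B2 \<le> ennreal (2 powr p / c) * (\<integral>\<^sup>+s. Y s * indicator {0..<1} s \<partial>unit_meas)"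
      unfolding B2_def by (intro nn_integral_Markov_inequality borel_measurable_times_ennreal XY borel_measurable_indicator) auto
    also have "(\<integral>\<^sup>+s. Y s * indicator {0..<1} s \<partial>unit_meas) = (\<integral>\<^sup>+s. Y s \<partial>unit_meas)"
      by (intro nn_integral_cong) simp
    also have "ennreal (2 powr p / c) * \<dots> \<le> ennreal (2 powr p / c) * ennreal \<eta>"
      by (intro mult_left_mono intY) simp
    also have "\<dots> = ennreal (2 powr p / c * \<eta>)"
      using c \<eta> by (intro ennreal_mult[symmetric]) auto
    also have "\<dots> < ennreal \<beta>"
    proof (rule ennreal_lessI[OF \<beta>])
      have "2 powr p / c * \<eta> \<le> 2 powr p / c * (c * \<beta> / (2 * 2 powr p))"
        using c by (intro mult_left_mono) (auto simp: \<eta>_def)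
      also have "\<dots> = \<beta> / 2" using c by simp
      finally show "2 powr p / c * \<eta> < \<beta>"
        by (rule le_less_trans) (use \<beta> in simp)
    qed
    finally have mB2: "emeasure unit_meas B2 < ennreal \<beta>" .
    define E where "E = {0..<1} - (B1 \<union> B2)"
    have E [measurable]: "E \<in> sets unit_meas"
    proof -
      have "space unit_meas - (B1 \<union> B2) \<in> sets unit_meas" by measurable
      then show ?thesis by (simp add: E_def)
    qed
    have E_leb: "E \<in> sets lebesgue" "E \<subseteq> {0..<1}"
      using E by (auto simp: E_def sets_restrict_space_iff)
    have "measure lebesgue E > \<alpha>"
    proof -
      interpret U: finite_measure unit_meas
        by (rule finite_measureI) (simp add: emeasure_unit_meas_unit)
      have "measure unit_meas (B1 \<union> B2) \<le> measure unit_meas B1 + measure unit_meas B2"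
        by (intro measure_Un_le) measurable
      also have "\<dots> < \<beta> + \<beta>"
        using c(2) mB2 \<beta> unfolding B1_def[symmetric] U.emeasure_eq_measure by (simp add: ennreal_less_iff)
      finally have "measure unit_meas (B1 \<union> B2) < 1 - \<alpha>" by (simp add: \<beta>_def)
      moreover have "measure unit_meas E = 1 - measure unit_meas (B1 \<union> B2)"
      proof -
        have "measure unit_meas (space unit_meas - (B1 \<union> B2))
            = measure unit_meas (space unit_meas) - measure unit_meas (B1 \<union> B2)"
          by (rule U.finite_measure_compl) measurable
        then show ?thesis
          using emeasure_unit_meas_unit by (simp add: E_def measure_def)
      qed
      moreover have "measure unit_meas E = measure lebesgue E"
        using E_leb by (intro measure_restrict_space) auto
      ultimately show ?thesis by simp
    qed
    have near: "norm (left_trans G t h i s - 1) \<le> 1 / 2" if "i \<in> K" "s \<in> E" for i s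
    proof (rule ccontr)
      assume "\<not> ?thesis"
      then have gt: "norm (left_trans G t h i s - 1) \<ge> 1 / 2" by simp
      have s: "s \<in> {0..<1}" "\<rho> i s \<ge> c" "\<not> 1 \<le> ennreal (2 powr p / c) * Y s"
        using that by (auto simp: E_def B1_def B2_def not_less)
      have "1 = 2 powr p / c * ((1 / 2) powr p * c)"
        using c by (simp add: powr_divide)
      also have "\<dots> \<le> 2 powr p / c * (norm (left_trans G t h i s - 1) powr p * \<rho> i s)"
        using gt s c p by (intro mult_left_mono mult_mono powr_mono2) auto
      finally have "ennreal 1 \<le> ennreal (2 powr p / c * (norm (left_trans G t h i s - 1) powr p * \<rho> i s))"
        by (rule ennreal_leI)
      also have "\<dots> = ennreal (2 powr p / c) * ennreal (norm (left_trans G t h i s - one_on K i s) powr p * \<rho> i s)"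
        using that c s weight_pos[of i s] K by (subst ennreal_mult[symmetric]) (auto simp: one_on_def)
      also have "\<dots> \<le> ennreal (2 powr p / c) * Y s"
        unfolding Y_def fiber_mod_def using that K(3)
        by (intro mult_left_mono nn_integral_ge_point) auto
      finally show False using s(3) by simp
    qed
    let ?Q = "\<lambda>s. \<Sum>i\<in>K. Phi G p \<rho> i t s + Psi G p \<rho> i t s"
    have Q_le: "?Q s \<le> of_nat (card K) * (ennreal (2 powr p + 1) * X (shift_pos t s) + Y s)" if "s \<in> E" for s
    proof -
      have s: "s \<in> {0..<1}" using that E_leb by blast
      have "Phi G p \<rho> i t s + Psi G p \<rho> i t s \<le> ennreal (2 powr p + 1) * X (shift_pos t s) + Y s" if i: "i \<in> K" for i
      proof -
        have "Phi G p \<rho> i t s \<le> ennreal (2 powr p) * X (shift_pos t s)"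
          unfolding X_def using i K \<open>s \<in> E\<close> s
          by (intro Phi_le_fiber_mod t disj near) auto
        moreover have "Psi G p \<rho> i t s \<le> Y s + X (shift_pos t s)"
          unfolding X_def Y_def using disj[OF _ s] by (intro Psi_le_fiber_mod i K(1,3) t s)
        ultimately have "Phi G p \<rho> i t s + Psi G p \<rho> i t s
            \<le> ennreal (2 powr p) * X (shift_pos t s) + (Y s + X (shift_pos t s))"
          by (rule add_mono)
        also have "\<dots> = ennreal (2 powr p + 1) * X (shift_pos t s) + Y s"
          by (simp add: distrib_right add_ac)
        finally show ?thesis .
      qed
      then show ?thesis by (rule sum_bounded_above)
    qed
    have Xs [measurable]: "(\<lambda>s. X (shift_pos t s)) \<in> borel_measurable unit_meas"
      by (rule measurable_compose[OF shift_pos_measurable[OF t] XY(1)])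
    have "(\<integral>\<^sup>+s\<in>E. ?Q s \<partial>lebesgue) \<le> (\<integral>\<^sup>+s. (of_nat (card K) * (ennreal (2 powr p + 1) * X (shift_pos t s) + Y s)) * indicator {0..<1} s \<partial>lebesgue)"
      using Q_le E_leb by (intro nn_integral_mono) (auto split: split_indicator)
    also have "\<dots> = (\<integral>\<^sup>+s. of_nat (card K) * (ennreal (2 powr p + 1) * X (shift_pos t s) + Y s) \<partial>unit_meas)"
      by (simp add: nn_integral_restrict_space)
    also have "\<dots> = of_nat (card K) * (ennreal (2 powr p + 1) * (\<integral>\<^sup>+s. X (shift_pos t s) \<partial>unit_meas) + (\<integral>\<^sup>+s. Y s \<partial>unit_meas))"
      by (simp add: nn_integral_cmult nn_integral_add)
    also have "\<dots> \<le> of_nat (card K) * (ennreal (2 powr p + 1) * ennreal \<eta> + ennreal \<eta>)"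
      using intX intY nn_integral_shift_pos[OF t XY(1)] by (intro mult_left_mono add_mono) auto
    also have "\<dots> = ennreal (real (card K) * ((2 powr p + 2) * \<eta>))"
      using \<eta> by (simp add: ennreal_of_nat_eq_real_of_nat algebra_simps flip: ennreal_mult ennreal_plus)
    also have "\<dots> < ennreal \<epsilon>"
    proof (rule ennreal_lessI[OF \<epsilon>])
      have "real (card K) * ((2 powr p + 2) * \<eta>)
          \<le> real (card K) * ((2 powr p + 2) * (\<epsilon> / (2 * real (card K) * (2 powr p + 2))))"
        by (intro mult_left_mono) (auto simp: \<eta>_def)
      also have "\<dots> = \<epsilon> / 2"
      proof -
        have *: "x * (y * (\<epsilon> / (2 * x * y))) = \<epsilon> / 2" if "x > 0" "y > 0" for x y :: real
          using that by simp
        show ?thesis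
          by (rule *) (use \<open>card K > 0\<close> in \<open>auto intro: add_pos_pos\<close>)
      qed
      finally show "real (card K) * ((2 powr p + 2) * \<eta>) < \<epsilon>" using \<epsilon> by simp
    qed
    finally have lt: "(\<integral>\<^sup>+s\<in>E. ?Q s \<partial>lebesgue) < ennreal \<epsilon>" .
    show ?thesis
      unfolding N_times_def INF_less_iff
      using t lt E_leb \<open>measure lebesgue E > \<alpha>\<close> by blast
  qed
  note main = this
  show thesis
  proof (rule that[OF d(1)])
    show "real N + 1 > 0" by simp
    show "return_times (left_semigroup G p \<rho>) (Lp_ball (one_on K :: 'i \<Rightarrow> real \<Rightarrow> 'k) d) (Lp_ball (one_on K) d)
        \<inter> {real N + 1<..} \<subseteq> N_times G p \<rho> K \<epsilon> \<alpha>"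
    proof (rule subsetI, erule IntE)
      fix t assume "t \<in> return_times (left_semigroup G p \<rho>)
        (Lp_ball (one_on K :: 'i \<Rightarrow> real \<Rightarrow> 'k) d) (Lp_ball (one_on K) d)" "t \<in> {real N + 1<..}"
      then show "t \<in> N_times G p \<rho> K \<epsilon> \<alpha>"
        by (intro main) (assumption, simp only: greaterThan_iff)
    qed
  qed
qed

end

section \<open>The weight condition implies transitivity\<close>

text \<open>Links the dual sums, written as integrals over counting measure, to the
  \<open>infsum\<close> in \<open>left_trans\<close>.\<close>

lemma has_sum_of_nn_integral_count_space:
  fixes f :: "'j \<Rightarrow> real"
  assumes "\<And>j. j \<in> A \<Longrightarrow> f j \<ge> 0" "(\<integral>\<^sup>+j. ennreal (f j) \<partial>count_space A) = ennreal S" "S \<ge> 0"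
  shows "(f has_sum S) A"
proof -
  have nn: "AE j in count_space A. 0 \<le> f j"
    using assms(1) by (simp add: AE_count_space)
  have int: "integrable (count_space A) f"
    using assms(2) nn by (intro integrableI_nonneg) auto
  have "integral\<^sup>L (count_space A) f = S"
    using assms nn by (subst integral_eq_nn_integral) auto
  moreover have abs: "Infinite_Set_Sum.abs_summable_on f A"
    using int by (simp add: Infinite_Set_Sum.abs_summable_on_def)
  ultimately have "infsum f A = S"
    using infsetsum_infsum[OF abs] by (simp add: infsetsum_def)
  moreover have "f summable_on A"
    using abs abs_summable_equivalent abs_summable_summable by blast
  ultimately show ?thesis
    using has_sum_infsum by blast
qed

text \<open>The n-th ancestor exists in a rootless tree and is unique, so every edge lies in exactly
  one fiber; Tonelli for counting measures does the rest.\<close>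

lemma (in weighted_tree) nn_integral_arcs_by_ancestor:
  "(\<integral>\<^sup>+k. (\<integral>\<^sup>+j. F j \<partial>count_space (desc_edges G n k)) \<partial>count_space (arcs G))
     = (\<integral>\<^sup>+j. F j \<partial>count_space (arcs G))"
proof -
  have "(\<integral>\<^sup>+k. (\<integral>\<^sup>+j. F j \<partial>count_space (desc_edges G n k)) \<partial>count_space (arcs G))
      = (\<integral>\<^sup>+k. (\<integral>\<^sup>+j. F j * of_bool (j \<in> desc_edges G n k) \<partial>count_space (arcs G)) \<partial>count_space (arcs G))"
  proof (rule nn_integral_cong)
    fix k assume "k \<in> space (count_space (arcs G))"
    then have "desc_edges G n k \<subseteq> arcs G" using desc_edges_subset by simp
    then have "(\<integral>\<^sup>+j. F j * of_bool (j \<in> desc_edges G n k) \<partial>count_space (desc_edges G n k))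
      = (\<integral>\<^sup>+j. F j * of_bool (j \<in> desc_edges G n k) \<partial>count_space (arcs G))"
      by (intro nn_integral_count_space_eq) auto
    moreover have "(\<integral>\<^sup>+j. F j * of_bool (j \<in> desc_edges G n k) \<partial>count_space (desc_edges G n k))
      = (\<integral>\<^sup>+j. F j \<partial>count_space (desc_edges G n k))"
      by (intro nn_integral_cong) simp
    ultimately show "(\<integral>\<^sup>+j. F j \<partial>count_space (desc_edges G n k))
      = (\<integral>\<^sup>+j. F j * of_bool (j \<in> desc_edges G n k) \<partial>count_space (arcs G))"
      by simp
  qed
  also have "\<dots> = (\<integral>\<^sup>+j. (\<integral>\<^sup>+k. F j * of_bool (j \<in> desc_edges G n k) \<partial>count_space (arcs G)) \<partial>count_space (arcs G))"
    by (rule nn_integral_count_space_nn_integral) (simp_all add: countable_arcs)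
  also have "\<dots> = (\<integral>\<^sup>+j. F j \<partial>count_space (arcs G))"
  proof (rule nn_integral_cong)
    fix j assume "j \<in> space (count_space (arcs G))"
    then have j: "j \<in> arcs G" by simp
    have "(\<integral>\<^sup>+k. F j * of_bool (j \<in> desc_edges G n k) \<partial>count_space (arcs G))
        = (\<Sum>k\<in>{anc_edge G n j}. F j * of_bool (j \<in> desc_edges G n k))"
      using anc_edge[OF rootless j] anc_edge_eqI by (intro nn_integral_count_space') auto
    also have "\<dots> = F j" using anc_edge[OF rootless j] by simp
    finally show "(\<integral>\<^sup>+k. F j * of_bool (j \<in> desc_edges G n k) \<partial>count_space (arcs G)) = F j" .
  qed
  finally show ?thesis .
qed

text \<open>The data for connecting f with g at one time t: E holds the good positions, K carries
  both functions, M bounds them. The factor \<open>1 + real (card K)\<close> makes the sum of f over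
  a fiber, with at most \<open>card K\<close> nonzero terms, bounded by M as well.\<close>

locale transition_data = weighted_tree G p \<rho>
  for G :: "('v, 'i) pre_digraph" (structure) and p \<rho> +
  fixes t :: real and E :: "real set" and K :: "'i set" and M :: real
    and f g :: "'i \<Rightarrow> real \<Rightarrow> 'k::{real_normed_field, euclidean_space}"
  assumes t: "t \<ge> 0" and E: "E \<in> sets unit_meas"
    and K: "finite K" "K \<subseteq> arcs G" and M: "M \<ge> 0"
    and f: "f \<in> Lp_funs G p \<rho>" and g: "g \<in> Lp_funs G p \<rho>"
    and f_support: "\<And>i s. i \<notin> K \<Longrightarrow> f i s = 0" and g_support: "\<And>i s. i \<notin> K \<Longrightarrow> g i s = 0"
    and f_bound: "\<And>i s. (1 + real (card K)) * norm (f i s) \<le> M"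
    and g_bound: "\<And>i s. norm (g i s) \<le> M"
begin

text \<open>What f alone produces at edge k after time t; as f vanishes off K, a finite sum
  suffices.\<close>

definition fsum :: "'i \<Rightarrow> real \<Rightarrow> 'k" where
  "fsum k s = (\<Sum>j\<in>K. of_bool (j \<in> desc_edges G (cross_count t s) k) * f j (shift_pos t s))"

definition S :: "'i \<Rightarrow> real \<Rightarrow> real" where
  "S k s = enn2real (dual_sum G p \<rho> k t s)"

text \<open>The base of the power in \<open>Psi\<close> for every edge whose ancestor is k.\<close>

definition D :: "'i \<Rightarrow> real \<Rightarrow> real" where
  "D k s = dual_weight k s + S k s"

definition coef :: "'i \<Rightarrow> real \<Rightarrow> 'k" where
  "coef k s = g k s / of_real (S k s) - fsum k s / of_real (D k s)"

text \<open>
  The connecting function is \<open>f\<close> plus, on each fiber \<open>M\<^sub>n(k)\<close>, a multiple of the profile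
  \<open>dual_weight j\<close> that is extremal in the Hoelder inequality: the term with \<open>g\<close> creates \<open>g\<close> after
  time \<open>t\<close>, and the term with \<open>fsum\<close> distributes the unavoidable error \<open>fsum\<close> between the initial and
  the final function so that the sum of the two costs is minimal. \<open>pre\<close> is this function in the
  coordinate \<open>s\<close> before the translation, \<open>connect\<close> the same function in its own coordinate.
\<close>

definition pre :: "'i \<Rightarrow> real \<Rightarrow> 'k" where
  "pre j s = of_bool (s \<in> E) * (f j (shift_pos t s)
     + coef (anc_edge G (cross_count t s) j) s * of_real (dual_weight j (shift_pos t s)))"

definition connect :: "'i \<Rightarrow> real \<Rightarrow> 'k" where
  "connect j x = pre j (shift_pos (of_int \<lceil>t\<rceil> - t) x)"

lemma connect_shift_pos: "s \<in> {0..<1} \<Longrightarrow> connect j (shift_pos t s) = pre j s"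
  unfolding connect_def using shift_pos_inverse[OF t] by simp

lemma
  assumes "k \<in> arcs G" "s \<in> {0..<1}"
  shows S_pos: "S k s > 0" and dual_sum_eq_S: "dual_sum G p \<rho> k t s = ennreal (S k s)"
proof -
  obtain x where "x > 0" "dual_sum G p \<rho> k t s = ennreal x"
    using dual_sum_real[OF assms(1) t assms(2)] .
  then show "S k s > 0" "dual_sum G p \<rho> k t s = ennreal (S k s)"
    by (simp_all add: S_def)
qed

lemma D_pos: "k \<in> arcs G \<Longrightarrow> s \<in> {0..<1} \<Longrightarrow> D k s > 0"
  unfolding D_def using S_pos dual_weight_pos by (simp add: add_pos_pos)

lemma S_le_D: "k \<in> arcs G \<Longrightarrow> s \<in> {0..<1} \<Longrightarrow> S k s \<le> D k s"
  unfolding D_def using dual_weight_pos[of k s] by simp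

lemma Phi_eq_S: "k \<in> arcs G \<Longrightarrow> s \<in> {0..<1} \<Longrightarrow> Phi G p \<rho> k t s = ennreal (S k s powr (1 - p))"
  unfolding Phi_def using S_pos by (simp add: dual_sum_eq_S enn_powr_ennreal)

lemma Psi_eq_D:
  assumes "i \<in> arcs G" "s \<in> {0..<1}"
  shows "Psi G p \<rho> i t s = ennreal (D (anc_edge G (cross_count t s) i) s powr (1 - p))"
proof -
  let ?k = "anc_edge G (cross_count t s) i"
  have k: "?k \<in> arcs G" using anc_edge[OF rootless assms(1)] by simp
  show ?thesis
    using D_pos[OF k assms(2)] S_pos[OF k assms(2)] dual_weight_pos[OF k assms(2)]
    by (simp add: Psi_eq dual_sum_eq_S[OF k assms(2)] D_def enn_powr_ennreal flip: ennreal_plus)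
qed

lemma norm_fsum_le: "norm (fsum k s) \<le> M"
proof -
  have "norm (fsum k s) \<le> (\<Sum>j\<in>K. norm (of_bool (j \<in> desc_edges G (cross_count t s) k) * f j (shift_pos t s)))"
    unfolding fsum_def by (rule norm_sum)
  also have "\<dots> \<le> (\<Sum>j\<in>K. M / (1 + real (card K)))"
    using f_bound M by (intro sum_mono) (auto simp: field_simps)
  also have "\<dots> \<le> M"
    using M by (simp add: field_simps)
  finally show ?thesis .
qed

lemma fsum_eq_0: "K \<inter> desc_edges G (cross_count t s) k = {} \<Longrightarrow> fsum k s = 0"
  unfolding fsum_def by (intro sum.neutral) auto

text \<open>The profile sums to \<open>S k s\<close> over the fiber, so the correction contributes g
  - fsum S/D to the sum fsum of f; since S/D = 1 - dual_weight/D, exactly the share dual_weight/D of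
  the error fsum survives.\<close>

lemma left_trans_connect:
  assumes k: "k \<in> arcs G" and s: "s \<in> {0..<1}"
  shows "left_trans G t connect k s
    = of_bool (s \<in> E) * (g k s + fsum k s * of_real (dual_weight k s / D k s))"
proof -
  let ?A = "desc_edges G (cross_count t s) k" and ?x = "shift_pos t s"
  have A: "?A \<subseteq> arcs G" using desc_edges_subset[OF k] .
  have x: "?x \<in> {0..<1}" using shift_pos_in_unit[OF t s] .
  have "((\<lambda>j. f j ?x) has_sum fsum k s) ?A"
  proof -
    have "((\<lambda>j. f j ?x) has_sum (\<Sum>j\<in>K \<inter> ?A. f j ?x)) ?A"
      using K f_support by (intro has_sum_finite_neutralI) auto
    moreover have "(\<Sum>j\<in>K \<inter> ?A. f j ?x) = fsum k s"
      unfolding fsum_def using K by (intro sum.mono_neutral_cong_left) auto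
    ultimately show ?thesis by simp
  qed
  moreover have "((\<lambda>j. dual_weight j ?x) has_sum S k s) ?A"
    using dual_sum_eq_S[OF k s] S_pos[OF k s] A x
    by (intro has_sum_of_nn_integral_count_space) (auto simp: dual_sum_eq intro!: less_imp_le dual_weight_pos)
  then have "((\<lambda>j. of_real (dual_weight j ?x) :: 'k) has_sum of_real (S k s)) ?A"
    by (rule has_sum_of_real)
  then have "((\<lambda>j. coef k s * of_real (dual_weight j ?x)) has_sum coef k s * of_real (S k s)) ?A"
    by (rule has_sum_cmult_right)
  ultimately have "((\<lambda>j. f j ?x + coef k s * of_real (dual_weight j ?x)) has_sum
      (fsum k s + coef k s * of_real (S k s))) ?A"
    by (rule has_sum_add)
  then have hs: "((\<lambda>j. of_bool (s \<in> E) * (f j ?x + coef k s * of_real (dual_weight j ?x))) has_sum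
      of_bool (s \<in> E) * (fsum k s + coef k s * of_real (S k s))) ?A"
    by (rule has_sum_cmult_right)
  have "left_trans G t connect k s
      = (\<Sum>\<^sub>\<infinity>j\<in>?A. of_bool (s \<in> E) * (f j ?x + coef k s * of_real (dual_weight j ?x)))"
    unfolding left_trans_def
  proof (rule infsum_cong)
    fix j assume "j \<in> ?A"
    then have "anc_edge G (cross_count t s) j = k"
      using anc_edge_eqI[OF k] by blast
    then show "connect j ?x = of_bool (s \<in> E) * (f j ?x + coef k s * of_real (dual_weight j ?x))"
      by (simp add: connect_shift_pos[OF s] pre_def)
  qed
  also have "\<dots> = of_bool (s \<in> E) * (fsum k s + coef k s * of_real (S k s))"
    using hs by (rule infsumI)
  also have "fsum k s + coef k s * of_real (S k s) = g k s + fsum k s * of_real (dual_weight k s / D k s)"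
  proof -
    have "coef k s * of_real (S k s) = g k s - fsum k s * of_real (S k s / D k s)"
      using S_pos[OF k s] by (simp add: coef_def left_diff_distrib)
    moreover have "S k s / D k s = 1 - dual_weight k s / D k s"
      using D_pos[OF k s] by (simp add: D_def field_simps)
    then have "of_real (S k s / D k s) = (1 - of_real (dual_weight k s / D k s) :: 'k)"
      by (simp only: of_real_diff of_real_1)
    ultimately show ?thesis by (simp only: right_diff_distrib mult_1_right) simp
  qed
  finally show ?thesis .
qed

text \<open>\<open>fsum k s\<close> can be nonzero only if k is the ancestor of some i in K, and
  then \<open>D k s powr (1 - p)\<close> is \<open>Psi\<close> at i. Edges of K with a common
  ancestor are counted repeatedly, which an upper bound allows.\<close>

lemma nn_integral_fsum_le:
  assumes s: "s \<in> {0..<1}"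
  shows "(\<integral>\<^sup>+k. ennreal (norm (fsum k s) powr p * D k s powr (1 - p)) \<partial>count_space (arcs G))
    \<le> ennreal (M powr p) * (\<Sum>i\<in>K. Psi G p \<rho> i t s)"
proof -
  let ?anc = "anc_edge G (cross_count t s)"
  have "(\<integral>\<^sup>+k. ennreal (norm (fsum k s) powr p * D k s powr (1 - p)) \<partial>count_space (arcs G))
      \<le> (\<integral>\<^sup>+k. ennreal (M powr p) * (\<Sum>i\<in>K. of_bool (?anc i = k) * Psi G p \<rho> i t s) \<partial>count_space (arcs G))"
  proof (rule nn_integral_mono)
    fix k assume "k \<in> space (count_space (arcs G))"
    then have k: "k \<in> arcs G" by simp
    show "ennreal (norm (fsum k s) powr p * D k s powr (1 - p))
        \<le> ennreal (M powr p) * (\<Sum>i\<in>K. of_bool (?anc i = k) * Psi G p \<rho> i t s)"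
    proof (cases "K \<inter> desc_edges G (cross_count t s) k = {}")
      case True
      then show ?thesis using fsum_eq_0 p by simp
    next
      case False
      then obtain i where i: "i \<in> K" "i \<in> desc_edges G (cross_count t s) k" by blast
      then have ik: "?anc i = k" using anc_edge_eqI[OF k] by blast
      have "ennreal (norm (fsum k s) powr p * D k s powr (1 - p)) \<le> ennreal (M powr p * D k s powr (1 - p))"
        using norm_fsum_le p by (intro ennreal_leI mult_right_mono powr_mono2) auto
      also have "\<dots> = ennreal (M powr p) * (of_bool (?anc i = k) * Psi G p \<rho> i t s)"
        using i(1) K ik by (simp add: Psi_eq_D[OF _ s] ennreal_mult subset_eq)
      also have "\<dots> \<le> ennreal (M powr p) * (\<Sum>i\<in>K. of_bool (?anc i = k) * Psi G p \<rho> i t s)"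
        using i(1) K by (intro mult_left_mono member_le_sum) auto
      finally show ?thesis .
    qed
  qed
  also have "\<dots> = ennreal (M powr p) * (\<Sum>i\<in>K. \<integral>\<^sup>+k. of_bool (?anc i = k) * Psi G p \<rho> i t s \<partial>count_space (arcs G))"
    by (simp add: nn_integral_cmult nn_integral_sum)
  also have "(\<Sum>i\<in>K. \<integral>\<^sup>+k. of_bool (?anc i = k) * Psi G p \<rho> i t s \<partial>count_space (arcs G))
      = (\<Sum>i\<in>K. Psi G p \<rho> i t s)"
  proof (rule sum.cong)
    fix i assume "i \<in> K"
    then have "?anc i \<in> arcs G" using anc_edge[OF rootless] K by blast
    then have "(\<integral>\<^sup>+k. of_bool (?anc i = k) * Psi G p \<rho> i t s \<partial>count_space (arcs G))
        = (\<Sum>k\<in>{?anc i}. of_bool (?anc i = k) * Psi G p \<rho> i t s)"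
      by (intro nn_integral_count_space') auto
    then show "(\<integral>\<^sup>+k. of_bool (?anc i = k) * Psi G p \<rho> i t s \<partial>count_space (arcs G)) = Psi G p \<rho> i t s"
      by simp
  qed simp
  finally show ?thesis .
qed

lemma nn_integral_g_le:
  assumes s: "s \<in> {0..<1}"
  shows "(\<integral>\<^sup>+k. ennreal (norm (g k s) powr p * S k s powr (1 - p)) \<partial>count_space (arcs G))
    \<le> ennreal (M powr p) * (\<Sum>i\<in>K. Phi G p \<rho> i t s)"
proof -
  have "(\<integral>\<^sup>+k. ennreal (norm (g k s) powr p * S k s powr (1 - p)) \<partial>count_space (arcs G))
      = (\<Sum>k\<in>K. ennreal (norm (g k s) powr p * S k s powr (1 - p)))"
    using K g_support p by (intro nn_integral_count_space') auto
  also have "\<dots> \<le> (\<Sum>k\<in>K. ennreal (M powr p) * Phi G p \<rho> k t s)"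
  proof (rule sum_mono)
    fix k assume "k \<in> K"
    then have k: "k \<in> arcs G" using K by blast
    have "ennreal (norm (g k s) powr p * S k s powr (1 - p)) \<le> ennreal (M powr p * S k s powr (1 - p))"
      using g_bound p by (intro ennreal_leI mult_right_mono powr_mono2) auto
    then show "ennreal (norm (g k s) powr p * S k s powr (1 - p)) \<le> ennreal (M powr p) * Phi G p \<rho> k t s"
      by (simp add: Phi_eq_S[OF k s] ennreal_mult)
  qed
  finally show ?thesis
    by (simp add: sum_distrib_left)
qed

abbreviation Q :: "real \<Rightarrow> ennreal" where
  "Q s \<equiv> \<Sum>i\<in>K. Phi G p \<rho> i t s + Psi G p \<rho> i t s"

text \<open>Since \<rho> is the power 1 - p of the dual weight, the added function has modular
  |coef|^p S on the fiber over k. Its part with g costs |g|^p S^(1-p), that with fsum costs |fsum|^p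
  S / D^p, which is at most |fsum|^p D^(1-p).\<close>

lemma fiber_mod_connect_le:
  assumes s: "s \<in> E" "s \<in> {0..<1}"
  shows "fiber_mod (\<lambda>i s. connect i s - f i s) (shift_pos t s) \<le> ennreal (2 powr p * M powr p) * Q s"
proof -
  let ?n = "cross_count t s" and ?x = "shift_pos t s"
  have x: "?x \<in> {0..<1}" using shift_pos_in_unit[OF t s(2)] .
  have inner: "(\<integral>\<^sup>+j. ennreal (norm (connect j ?x - f j ?x) powr p * \<rho> j ?x) \<partial>count_space (desc_edges G ?n k))
      \<le> ennreal (2 powr p) * (ennreal (norm (g k s) powr p * S k s powr (1 - p))
           + ennreal (norm (fsum k s) powr p * D k s powr (1 - p)))" if k: "k \<in> arcs G" for k
  proof -
    note pos = S_pos[OF k s(2)] D_pos[OF k s(2)]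
    have "(\<integral>\<^sup>+j. ennreal (norm (connect j ?x - f j ?x) powr p * \<rho> j ?x) \<partial>count_space (desc_edges G ?n k))
        = (\<integral>\<^sup>+j. ennreal (norm (coef k s) powr p) * ennreal (dual_weight j ?x) \<partial>count_space (desc_edges G ?n k))"
    proof (rule nn_integral_cong)
      fix j assume "j \<in> space (count_space (desc_edges G ?n k))"
      then have j: "j \<in> desc_edges G ?n k" by simp
      then have ja: "j \<in> arcs G" using desc_edges_subset[OF k] by blast
      have dw: "dual_weight j ?x > 0" using dual_weight_pos[OF ja x] .
      have "connect j ?x - f j ?x = coef k s * of_real (dual_weight j ?x)"
        using s anc_edge_eqI[OF k j] by (simp add: connect_shift_pos pre_def)
      then have "norm (connect j ?x - f j ?x) powr p * \<rho> j ?x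
          = norm (coef k s) powr p * (dual_weight j ?x powr p * dual_weight j ?x powr (1 - p))"
        using dw by (simp add: norm_mult powr_mult dual_weight_powr[OF ja x])
      also have "dual_weight j ?x powr p * dual_weight j ?x powr (1 - p) = dual_weight j ?x"
        using dw by (simp flip: powr_add)
      finally show "ennreal (norm (connect j ?x - f j ?x) powr p * \<rho> j ?x)
          = ennreal (norm (coef k s) powr p) * ennreal (dual_weight j ?x)"
        using dw by (simp add: ennreal_mult)
    qed
    also have "\<dots> = ennreal (norm (coef k s) powr p) * dual_sum G p \<rho> k t s"
      by (simp add: nn_integral_cmult dual_sum_eq)
    also have "\<dots> = ennreal (norm (coef k s) powr p * S k s)"
      using pos by (simp add: dual_sum_eq_S[OF k s(2)] ennreal_mult)
    also have "\<dots> \<le> ennreal (2 powr p * (norm (g k s) powr p * S k s powr (1 - p)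
        + norm (fsum k s) powr p * D k s powr (1 - p)))"
    proof (rule ennreal_leI)
      let ?a = "norm (g k s) / S k s" and ?b = "norm (fsum k s) / D k s"
      have "norm (coef k s) \<le> ?a + ?b"
        unfolding coef_def using pos norm_triangle_ineq4[of "g k s / of_real (S k s)" "fsum k s / of_real (D k s)"]
        by (simp add: norm_divide)
      then have "norm (coef k s) powr p \<le> (?a + ?b) powr p"
        using p by (intro powr_mono2) auto
      \<comment> \<open>Equal block weights are enough here; they cost a factor 2^(p-1), which 2^p
        absorbs.\<close>
      also have "\<dots> \<le> (1 + 1) powr (p - 1) * (1 powr (1 - p) * ?a powr p + 1 powr (1 - p) * ?b powr p)"
        using pos p by (intro powr_convex_combination) auto
      also have "\<dots> = 2 powr (p - 1) * (?a powr p + ?b powr p)"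
        by simp
      also have "\<dots> \<le> 2 powr p * (?a powr p + ?b powr p)"
        by (intro mult_right_mono powr_mono add_nonneg_nonneg) auto
      finally have "norm (coef k s) powr p * S k s \<le> 2 powr p * (?a powr p + ?b powr p) * S k s"
        using pos by (intro mult_right_mono) auto
      also have "\<dots> = 2 powr p * (?a powr p * S k s + ?b powr p * S k s)"
        by (simp add: algebra_simps)
      also have "\<dots> \<le> 2 powr p * (?a powr p * S k s + ?b powr p * D k s)"
        using S_le_D[OF k s(2)] by (intro mult_left_mono add_left_mono) auto
      also have "\<dots> = 2 powr p * (norm (g k s) powr p * S k s powr (1 - p)
        + norm (fsum k s) powr p * D k s powr (1 - p))"
        using pos by (simp add: powr_divide powr_diff)
      finally show "norm (coef k s) powr p * S k s \<le> \<dots>" .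
    qed
    also have "\<dots> = ennreal (2 powr p) * (ennreal (norm (g k s) powr p * S k s powr (1 - p))
           + ennreal (norm (fsum k s) powr p * D k s powr (1 - p)))"
      by (simp add: ennreal_mult ennreal_plus)
    finally show ?thesis .
  qed
  have "fiber_mod (\<lambda>i s. connect i s - f i s) ?x
      = (\<integral>\<^sup>+k. (\<integral>\<^sup>+j. ennreal (norm (connect j ?x - f j ?x) powr p * \<rho> j ?x)
          \<partial>count_space (desc_edges G ?n k)) \<partial>count_space (arcs G))"
    unfolding fiber_mod_def nn_integral_arcs_by_ancestor ..
  also have "\<dots> \<le> (\<integral>\<^sup>+k. ennreal (2 powr p) * (ennreal (norm (g k s) powr p * S k s powr (1 - p))
           + ennreal (norm (fsum k s) powr p * D k s powr (1 - p))) \<partial>count_space (arcs G))"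
    by (intro nn_integral_mono inner) simp
  also have "\<dots> = ennreal (2 powr p) *
      ((\<integral>\<^sup>+k. ennreal (norm (g k s) powr p * S k s powr (1 - p)) \<partial>count_space (arcs G))
      + (\<integral>\<^sup>+k. ennreal (norm (fsum k s) powr p * D k s powr (1 - p)) \<partial>count_space (arcs G)))"
    by (simp add: nn_integral_cmult nn_integral_add)
  also have "\<dots> \<le> ennreal (2 powr p) * (ennreal (M powr p) * (\<Sum>i\<in>K. Phi G p \<rho> i t s)
      + ennreal (M powr p) * (\<Sum>i\<in>K. Psi G p \<rho> i t s))"
    by (intro mult_left_mono add_mono nn_integral_g_le nn_integral_fsum_le s) simp
  also have "\<dots> = ennreal (2 powr p * M powr p) * Q s"
    by (simp add: sum.distrib distrib_left ennreal_mult mult.assoc)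
  finally show ?thesis .
qed

text \<open>The error remaining at k is fsum dual_weight / D. Measured with \<rho> =
  dual_weight^(1-p) it costs |fsum|^p dual_weight / D^p, and the dual weight is at most D.\<close>

lemma fiber_mod_left_trans_connect_le:
  assumes s: "s \<in> E" "s \<in> {0..<1}"
  shows "fiber_mod (\<lambda>i s. left_trans G t connect i s - g i s) s \<le> ennreal (2 powr p * M powr p) * Q s"
proof -
  have "fiber_mod (\<lambda>i s. left_trans G t connect i s - g i s) s
      \<le> (\<integral>\<^sup>+k. ennreal (norm (fsum k s) powr p * D k s powr (1 - p)) \<partial>count_space (arcs G))"
    unfolding fiber_mod_def
  proof (intro nn_integral_mono ennreal_leI)
    fix k assume "k \<in> space (count_space (arcs G))"
    then have k: "k \<in> arcs G" by simp
    note pos = dual_weight_pos[OF k s(2)] D_pos[OF k s(2)]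
    have "norm (left_trans G t connect k s - g k s) = norm (fsum k s) * (dual_weight k s / D k s)"
      using left_trans_connect[OF k s(2)] s pos by (simp add: norm_mult norm_divide)
    then have "norm (left_trans G t connect k s - g k s) powr p * \<rho> k s
        = norm (fsum k s) powr p * (dual_weight k s powr p * dual_weight k s powr (1 - p)) / D k s powr p"
      using pos by (simp add: powr_mult powr_divide dual_weight_powr[OF k s(2)])
    also have "dual_weight k s powr p * dual_weight k s powr (1 - p) = dual_weight k s"
      using pos by (simp flip: powr_add)
    also have "norm (fsum k s) powr p * dual_weight k s / D k s powr p
        \<le> norm (fsum k s) powr p * D k s / D k s powr p"
      using S_pos[OF k s(2)] by (intro divide_right_mono mult_left_mono) (auto simp: D_def)
    also have "\<dots> = norm (fsum k s) powr p * D k s powr (1 - p)"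
      using pos by (simp add: powr_diff)
    finally show "norm (left_trans G t connect k s - g k s) powr p * \<rho> k s
        \<le> norm (fsum k s) powr p * D k s powr (1 - p)" .
  qed
  also have "\<dots> \<le> ennreal (M powr p) * (\<Sum>i\<in>K. Psi G p \<rho> i t s)"
    by (rule nn_integral_fsum_le[OF s(2)])
  \<comment> \<open>The factor 2^p and the \<open>Phi\<close> terms are added to match the estimate
    for \<open>connect\<close>.\<close>
  also have "\<dots> \<le> ennreal (2 powr p * M powr p) * Q s"
  proof (intro mult_mono sum_mono ennreal_leI)
    have "1 * M powr p \<le> 2 powr p * M powr p"
      using p by (intro mult_right_mono ge_one_powr_ge_zero) auto
    then show "M powr p \<le> 2 powr p * M powr p" by simp
  qed auto
  finally show ?thesis .
qed

end

section \<open>Measurability of the connecting function and integrated estimates\<close>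

context transition_data
begin

lemma f_measurable: "j \<in> arcs G \<Longrightarrow> f j \<in> borel_measurable unit_meas"
  and g_measurable: "j \<in> arcs G \<Longrightarrow> g j \<in> borel_measurable unit_meas"
  using f g by (auto simp: Lp_funs_def)

lemma dual_weight_measurable: "j \<in> arcs G \<Longrightarrow> dual_weight j \<in> borel_measurable unit_meas"
  unfolding dual_weight_def[abs_def] using weight_measurable by measurable

lemma S_measurable:
  assumes k: "k \<in> arcs G"
  shows "S k \<in> borel_measurable unit_meas"
proof -
  have "(\<lambda>s. (\<lambda>n s. \<integral>\<^sup>+j. ennreal (dual_weight j (shift_pos t s)) \<partial>count_space (desc_edges G n k)) (cross_count t s) s)
      \<in> borel_measurable unit_meas"
  proof (rule measurable_compose_countable)
    fix n
    show "(\<lambda>s. \<integral>\<^sup>+j. ennreal (dual_weight j (shift_pos t s)) \<partial>count_space (desc_edges G n k)) \<in> borel_measurable unit_meas"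
    proof (rule borel_measurable_nn_integral_countable)
      show "countable (desc_edges G n k)"
        using countable_arcs desc_edges_subset[OF k] countable_subset by blast
      fix j assume "j \<in> desc_edges G n k"
      then have "dual_weight j \<in> borel_measurable unit_meas"
        using dual_weight_measurable desc_edges_subset[OF k] by blast
      from measurable_compose[OF shift_pos_measurable[OF t] this]
      show "(\<lambda>s. ennreal (dual_weight j (shift_pos t s))) \<in> borel_measurable unit_meas"
        by measurable
    qed
  qed measurable
  then show ?thesis
    unfolding S_def[abs_def] dual_sum_eq by measurable
qed

lemma fsum_measurable:
  assumes k: "k \<in> arcs G"
  shows "fsum k \<in> borel_measurable unit_meas"
proof -
  have "(\<lambda>s. (\<lambda>n s. \<Sum>j\<in>K. of_bool (j \<in> desc_edges G n k) * f j (shift_pos t s)) (cross_count t s) s)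
      \<in> borel_measurable unit_meas"
  proof (rule measurable_compose_countable)
    fix n
    have "(\<lambda>s. f j (shift_pos t s)) \<in> borel_measurable unit_meas" if "j \<in> K" for j
      using measurable_compose[OF shift_pos_measurable[OF t] f_measurable] that K by blast
    then show "(\<lambda>s. \<Sum>j\<in>K. of_bool (j \<in> desc_edges G n k) * f j (shift_pos t s)) \<in> borel_measurable unit_meas"
      by (intro borel_measurable_sum borel_measurable_times) auto
  qed measurable
  then show ?thesis
    by (simp add: fsum_def[abs_def])
qed

lemma coef_measurable:
  assumes k: "k \<in> arcs G"
  shows "coef k \<in> borel_measurable unit_meas"
proof -
  note [measurable] = g_measurable[OF k] S_measurable[OF k] fsum_measurable[OF k] dual_weight_measurable[OF k]
  show ?thesis
    unfolding coef_def[abs_def] D_def by measurable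
qed

lemma E_measurable: "(\<lambda>s. of_bool (s \<in> E) :: 'k) \<in> borel_measurable unit_meas"
proof -
  have "(\<lambda>s. indicator E s :: 'k) \<in> borel_measurable unit_meas"
    using E by measurable
  then show ?thesis by (simp add: indicator_def[abs_def])
qed

lemma connect_measurable:
  assumes j: "j \<in> arcs G"
  shows "connect j \<in> borel_measurable unit_meas"
proof -
  define c where "c s = coef (anc_edge G (cross_count t s) j) s" for s
  define u where "u s = f j (shift_pos t s)" for s
  define v where "v s = dual_weight j (shift_pos t s)" for s
  have "(\<lambda>s. (\<lambda>n s. coef (anc_edge G n j) s) (cross_count t s) s) \<in> borel_measurable unit_meas"
  proof (rule measurable_compose_countable)
    fix n
    show "(\<lambda>s. coef (anc_edge G n j) s) \<in> borel_measurable unit_meas"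
      using coef_measurable[OF anc_edge(1)[OF rootless j]] .
  qed (rule cross_count_measurable)
  then have [measurable]: "c \<in> borel_measurable unit_meas"
    by (simp only: c_def[abs_def])
  have [measurable]: "u \<in> borel_measurable unit_meas"
    unfolding u_def[abs_def] by (rule measurable_compose[OF shift_pos_measurable[OF t] f_measurable[OF j]])
  have [measurable]: "v \<in> borel_measurable unit_meas"
    unfolding v_def[abs_def] by (rule measurable_compose[OF shift_pos_measurable[OF t] dual_weight_measurable[OF j]])
  have "(\<lambda>s. indicator E s * (u s + c s * of_real (v s))) \<in> borel_measurable unit_meas"
    using E by measurable
  then have pre: "pre j \<in> borel_measurable unit_meas"
    by (simp add: pre_def[abs_def] c_def u_def v_def indicator_def)
  have "of_int \<lceil>t\<rceil> - t \<ge> 0" by linarith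
  from measurable_compose[OF shift_pos_measurable[OF this] pre]
  show ?thesis by (simp add: connect_def[abs_def])
qed

text \<open>Read off from the closed formula of \<open>left_trans_connect\<close> rather than from
  the infinite sum.\<close>

lemma left_trans_connect_measurable:
  assumes k: "k \<in> arcs G"
  shows "left_trans G t connect k \<in> borel_measurable unit_meas"
proof -
  note [measurable] = g_measurable[OF k] S_measurable[OF k] fsum_measurable[OF k]
    dual_weight_measurable[OF k] E_measurable
  have "(\<lambda>s. of_bool (s \<in> E) * (g k s + fsum k s * of_real (dual_weight k s / D k s)) :: 'k)
      \<in> borel_measurable unit_meas"
    unfolding D_def by measurable
  then show ?thesis
    by (rule measurable_cong[THEN iffD2, rotated]) (simp add: left_trans_connect[OF k])
qed

lemma fiber_mod_bounded_le:
  assumes "\<And>i s. i \<notin> K \<Longrightarrow> u i s = 0" "\<And>i s. norm (u i s) \<le> M" "x \<in> {0..<1}"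
  shows "fiber_mod u x \<le> ennreal (M powr p) * (\<Sum>i\<in>K. ennreal (\<rho> i x))"
proof -
  have "fiber_mod u x = (\<Sum>i\<in>K. ennreal (norm (u i x) powr p * \<rho> i x))"
    unfolding fiber_mod_def using K assms(1) p by (intro nn_integral_count_space') auto
  also have "\<dots> \<le> (\<Sum>i\<in>K. ennreal (M powr p) * ennreal (\<rho> i x))"
  proof (rule sum_mono)
    fix i assume "i \<in> K"
    then have "\<rho> i x > 0" using weight_pos K assms(3) by blast
    then have "norm (u i x) powr p * \<rho> i x \<le> M powr p * \<rho> i x"
      using assms(2) p by (intro mult_right_mono powr_mono2) auto
    then show "ennreal (norm (u i x) powr p * \<rho> i x) \<le> ennreal (M powr p) * ennreal (\<rho> i x)"
      using \<open>\<rho> i x > 0\<close> by (simp flip: ennreal_mult)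
  qed
  finally show ?thesis by (simp add: sum_distrib_left)
qed

lemma f_bound': "norm (f i s) \<le> M"
proof -
  have "1 * norm (f i s) \<le> (1 + real (card K)) * norm (f i s)"
    by (intro mult_right_mono) auto
  then show ?thesis using f_bound[of i s] by simp
qed

text \<open>Measurability of \<open>Q\<close> is never established. Hence the constant is moved to
  the measurable side \<open>L\<close>, and \<open>Q\<close> enters only through monotonicity of the
  integral.\<close>

lemma integral_split_le:
  assumes L: "L \<in> borel_measurable unit_meas" and "M > 0"
    and on_E: "\<And>s. s \<in> E \<Longrightarrow> s \<in> {0..<1} \<Longrightarrow> L s \<le> ennreal (2 powr p * M powr p) * Q s"
    and off_E: "\<And>s. s \<notin> E \<Longrightarrow> s \<in> {0..<1} \<Longrightarrow> L s \<le> ennreal (M powr p) * W s"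
    and W: "W \<in> borel_measurable unit_meas"
  shows "(\<integral>\<^sup>+s. L s \<partial>unit_meas) \<le> ennreal (2 powr p * M powr p) * (\<integral>\<^sup>+s\<in>E. Q s \<partial>lebesgue)
           + ennreal (M powr p) * (\<integral>\<^sup>+s. W s * indicator ({0..<1} - E) s \<partial>unit_meas)"
proof -
  note [measurable] = L W E
  define C where "C = 2 powr p * M powr p"
  have C: "C > 0" using \<open>M > 0\<close> by (simp add: C_def)
  have inv: "ennreal C * (ennreal (1 / C) * z) = z" for z
    using C by (simp add: mult.assoc[symmetric] flip: ennreal_mult)
  have E1: "E \<in> sets lebesgue" "E \<subseteq> {0..<1}"
    using E by (auto simp: sets_restrict_space)
  have E2: "{0..<1} - E \<in> sets unit_meas"
    using sets.compl_sets[OF E] by simp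
  have "(\<integral>\<^sup>+s. L s \<partial>unit_meas) = (\<integral>\<^sup>+s. L s * indicator E s + L s * indicator ({0..<1} - E) s \<partial>unit_meas)"
    by (intro nn_integral_cong) (auto split: split_indicator)
  also have "\<dots> = (\<integral>\<^sup>+s. L s * indicator E s \<partial>unit_meas) + (\<integral>\<^sup>+s. L s * indicator ({0..<1} - E) s \<partial>unit_meas)"
    by (intro nn_integral_add borel_measurable_times_ennreal borel_measurable_indicator L E E2)
  also have "(\<integral>\<^sup>+s. L s * indicator E s \<partial>unit_meas)
      = (\<integral>\<^sup>+s. ennreal C * (ennreal (1 / C) * (L s * indicator E s)) \<partial>unit_meas)"
    by (simp only: inv)
  also have "\<dots> = ennreal C * (\<integral>\<^sup>+s. ennreal (1 / C) * (L s * indicator E s) \<partial>unit_meas)"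
    by (intro nn_integral_cmult) measurable
  also have "(\<integral>\<^sup>+s. ennreal (1 / C) * (L s * indicator E s) \<partial>unit_meas)
      = (\<integral>\<^sup>+s. ennreal (1 / C) * (L s * indicator E s) * indicator {0..<1} s \<partial>lebesgue)"
    by (simp add: nn_integral_restrict_space)
  also have "\<dots> \<le> (\<integral>\<^sup>+s\<in>E. Q s \<partial>lebesgue)"
  proof (rule nn_integral_mono)
    fix s
    show "ennreal (1 / C) * (L s * indicator E s) * indicator {0..<1} s \<le> Q s * indicator E s"
    proof (cases "s \<in> E")
      case True
      then have "ennreal (1 / C) * L s \<le> ennreal (1 / C) * (ennreal C * Q s)"
        using on_E E1 by (intro mult_left_mono) (auto simp: C_def)
      also have "\<dots> = Q s"
        using inv by (simp add: mult.left_commute)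
      finally show ?thesis using True E1 by auto
    qed simp
  qed
  also have "(\<integral>\<^sup>+s. L s * indicator ({0..<1} - E) s \<partial>unit_meas)
      \<le> (\<integral>\<^sup>+s. ennreal (M powr p) * (W s * indicator ({0..<1} - E) s) \<partial>unit_meas)"
    using off_E by (intro nn_integral_mono) (auto split: split_indicator)
  also have "\<dots> = ennreal (M powr p) * (\<integral>\<^sup>+s. W s * indicator ({0..<1} - E) s \<partial>unit_meas)"
    by (intro nn_integral_cmult borel_measurable_times_ennreal borel_measurable_indicator W E2)
  finally show ?thesis
    by (simp add: C_def add_mono mult_left_mono)
qed

lemma weight_sum_measurable: "(\<lambda>s. \<Sum>i\<in>K. ennreal (\<rho> i s)) \<in> borel_measurable unit_meas"
  using K weight_measurable
  by (intro borel_measurable_sum measurable_compose[OF _ measurable_ennreal]) blast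

text \<open>E and \<open>Q\<close> refer to the position before the translation, so the first error
  is rotated to that coordinate, and its weights appear at \<open>shift_pos t s\<close>. Off E both
  the connecting function and its translate vanish, leaving -f and -g.\<close>

lemma connect_estimates:
  assumes "M > 0"
  shows "Lp_modular G p \<rho> (\<lambda>i s. connect i s - f i s)
      \<le> ennreal (2 powr p * M powr p) * (\<integral>\<^sup>+s\<in>E. Q s \<partial>lebesgue) + ennreal (M powr p) *
          (\<integral>\<^sup>+s. (\<Sum>i\<in>K. ennreal (\<rho> i (shift_pos t s))) * indicator ({0..<1} - E) s \<partial>unit_meas)"
      (is ?first)
    and "Lp_modular G p \<rho> (\<lambda>i s. left_trans G t connect i s - g i s)
      \<le> ennreal (2 powr p * M powr p) * (\<integral>\<^sup>+s\<in>E. Q s \<partial>lebesgue) + ennreal (M powr p) *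
          (\<integral>\<^sup>+s. (\<Sum>i\<in>K. ennreal (\<rho> i s)) * indicator ({0..<1} - E) s \<partial>unit_meas)"
      (is ?second)
proof -
  have m1: "(\<lambda>s. connect i s - f i s) \<in> borel_measurable unit_meas" if "i \<in> arcs G" for i
    using that by (intro borel_measurable_diff connect_measurable f_measurable)
  have m2: "(\<lambda>s. left_trans G t connect i s - g i s) \<in> borel_measurable unit_meas" if "i \<in> arcs G" for i
    using that by (intro borel_measurable_diff left_trans_connect_measurable g_measurable)
  define L where "L = fiber_mod (\<lambda>i s. connect i s - f i s)"
  have L: "L \<in> borel_measurable unit_meas"
    unfolding L_def by (rule fiber_mod_measurable[OF m1])
  have "Lp_modular G p \<rho> (\<lambda>i s. connect i s - f i s) = (\<integral>\<^sup>+s. L s \<partial>unit_meas)"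
    unfolding L_def by (rule Lp_modular_eq_integral_fiber_mod[OF m1])
  also have "\<dots> = (\<integral>\<^sup>+s. L (shift_pos t s) \<partial>unit_meas)"
    by (rule nn_integral_shift_pos[OF t L, symmetric])
  also have "\<dots> \<le> ennreal (2 powr p * M powr p) * (\<integral>\<^sup>+s\<in>E. Q s \<partial>lebesgue) + ennreal (M powr p) *
          (\<integral>\<^sup>+s. (\<Sum>i\<in>K. ennreal (\<rho> i (shift_pos t s))) * indicator ({0..<1} - E) s \<partial>unit_meas)"
  proof (rule integral_split_le[OF _ assms])
    show "(\<lambda>s. L (shift_pos t s)) \<in> borel_measurable unit_meas"
      by (rule measurable_compose[OF shift_pos_measurable[OF t] L])
    show "(\<lambda>s. \<Sum>i\<in>K. ennreal (\<rho> i (shift_pos t s))) \<in> borel_measurable unit_meas"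
      by (rule measurable_compose[OF shift_pos_measurable[OF t] weight_sum_measurable])
    show "L (shift_pos t s) \<le> ennreal (2 powr p * M powr p) * Q s" if "s \<in> E" "s \<in> {0..<1}" for s
      unfolding L_def using that by (rule fiber_mod_connect_le)
    show "L (shift_pos t s) \<le> ennreal (M powr p) * (\<Sum>i\<in>K. ennreal (\<rho> i (shift_pos t s)))"
      if "s \<notin> E" "s \<in> {0..<1}" for s
    proof -
      have "L (shift_pos t s) = fiber_mod f (shift_pos t s)"
        unfolding L_def fiber_mod_def using that by (simp add: connect_shift_pos pre_def)
      also have "\<dots> \<le> ennreal (M powr p) * (\<Sum>i\<in>K. ennreal (\<rho> i (shift_pos t s)))"
        using f_support f_bound' shift_pos_in_unit[OF t that(2)] by (rule fiber_mod_bounded_le)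
      finally show ?thesis .
    qed
  qed
  finally show ?first .
  define L' where "L' = fiber_mod (\<lambda>i s. left_trans G t connect i s - g i s)"
  have "Lp_modular G p \<rho> (\<lambda>i s. left_trans G t connect i s - g i s) = (\<integral>\<^sup>+s. L' s \<partial>unit_meas)"
    unfolding L'_def by (rule Lp_modular_eq_integral_fiber_mod[OF m2])
  also have "\<dots> \<le> ennreal (2 powr p * M powr p) * (\<integral>\<^sup>+s\<in>E. Q s \<partial>lebesgue) + ennreal (M powr p) *
          (\<integral>\<^sup>+s. (\<Sum>i\<in>K. ennreal (\<rho> i s)) * indicator ({0..<1} - E) s \<partial>unit_meas)"
  proof (rule integral_split_le[OF _ assms _ _ weight_sum_measurable])
    show "L' \<in> borel_measurable unit_meas"
      unfolding L'_def by (rule fiber_mod_measurable[OF m2])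
    show "L' s \<le> ennreal (2 powr p * M powr p) * Q s" if "s \<in> E" "s \<in> {0..<1}" for s
      unfolding L'_def using that by (rule fiber_mod_left_trans_connect_le)
    show "L' s \<le> ennreal (M powr p) * (\<Sum>i\<in>K. ennreal (\<rho> i s))" if "s \<notin> E" "s \<in> {0..<1}" for s
    proof -
      have "L' s = fiber_mod g s"
        unfolding L'_def fiber_mod_def using that
        by (intro nn_integral_cong) (simp add: left_trans_connect)
      also have "\<dots> \<le> ennreal (M powr p) * (\<Sum>i\<in>K. ennreal (\<rho> i s))"
        using g_support g_bound that(2) by (rule fiber_mod_bounded_le)
      finally show ?thesis .
    qed
  qed
  finally show ?second .
qed

end

lemma Furstenberg_family_superset:
  "\<lbrakk>Furstenberg_family F; A \<in> F; A \<subseteq> B; B \<subseteq> {0..}\<rbrakk> \<Longrightarrow> B \<in> F"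
  unfolding Furstenberg_family_def by blast

lemma return_times_mono: "U \<subseteq> U' \<Longrightarrow> V \<subseteq> V' \<Longrightarrow> return_times T U V \<subseteq> return_times T U' V'"
  unfolding return_times_def by blast

lemma return_times_nonneg: "return_times T U V \<subseteq> {0..}"
  unfolding return_times_def by auto

text \<open>As u = v - (v - u), the error estimate alone places the connecting function and its
  translate in the space.\<close>

lemma (in weighted_tree) Lp_funs_if_diff:
  fixes u v :: "'i \<Rightarrow> real \<Rightarrow> 'k::{real_normed_field, euclidean_space}"
  assumes u: "\<And>i. i \<in> arcs G \<Longrightarrow> u i \<in> borel_measurable unit_meas" and v: "v \<in> Lp_funs G p \<rho>"
    and fin: "Lp_modular G p \<rho> (\<lambda>i s. u i s - v i s) < \<infinity>"
  shows "u \<in> Lp_funs G p \<rho>"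
proof -
  have vm: "v i \<in> borel_measurable unit_meas" if "i \<in> arcs G" for i
    using v that by (auto simp: Lp_funs_def)
  have "Lp_modular G p \<rho> (\<lambda>i s. v i s - u i s) < \<infinity>"
    using fin by (simp add: Lp_modular_def norm_minus_commute)
  then have d: "(\<lambda>i s. v i s - u i s) \<in> Lp_funs G p \<rho>"
    using vm u by (simp add: Lp_funs_def borel_measurable_diff)
  have "(\<lambda>i s. v i s - (v i s - u i s)) \<in> Lp_funs G p \<rho>"
    by (rule Lp_norm_diff(1)[OF weight p v d])
  then show ?thesis by simp
qed

lemma (in transition_data) return_time_if_estimates_small:
  assumes M: "M > 0" and r: "r > 0"
    and est1: "ennreal (2 powr p * M powr p) * (\<integral>\<^sup>+s\<in>E. Q s \<partial>lebesgue) + ennreal (M powr p) *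
        (\<integral>\<^sup>+s. (\<Sum>i\<in>K. ennreal (\<rho> i (shift_pos t s))) * indicator ({0..<1} - E) s \<partial>unit_meas)
      < ennreal (r powr p)"
    and est2: "ennreal (2 powr p * M powr p) * (\<integral>\<^sup>+s\<in>E. Q s \<partial>lebesgue) + ennreal (M powr p) *
        (\<integral>\<^sup>+s. (\<Sum>i\<in>K. ennreal (\<rho> i s)) * indicator ({0..<1} - E) s \<partial>unit_meas)
      < ennreal (r powr p)"
  shows "t \<in> return_times (left_semigroup G p \<rho>) (Lp_ball f r) (Lp_ball g r)"
proof -
  note mod1 = le_less_trans[OF connect_estimates(1)[OF M] est1]
  note mod2 = le_less_trans[OF connect_estimates(2)[OF M] est2]
  have fin: "x < ennreal (r powr p) \<Longrightarrow> x < \<infinity>" for x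
    unfolding infinity_ennreal_def by (rule less_trans[OF _ ennreal_less_top])
  show ?thesis
    by (rule return_times_ballsI[OF t f g
          Lp_funs_if_diff[OF connect_measurable f fin[OF mod1]]
          Lp_funs_if_diff[OF left_trans_connect_measurable g fin[OF mod2]]
          Lp_norm_less_if_modular_less[OF mod1 r] Lp_norm_less_if_modular_less[OF mod2 r]])
qed

section \<open>Uniform integrability, and the passage from the weight condition to
  transitivity\<close>

context weighted_tree
begin

text \<open>Cut the sum of the weights at height n: the tail \<open>v n\<close> has a small
  integral, unchanged by rotation, and the rest is at most n. This makes \<beta> independent of
  t.\<close>

lemma weight_uniformly_integrable:
  assumes K: "finite K" "K \<subseteq> arcs G" and e: "e > 0"
  obtains \<beta> where "\<beta> > 0"
    "\<forall>A\<in>sets unit_meas. \<forall>t\<ge>0. emeasure unit_meas A \<le> ennreal \<beta> \<longrightarrow>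
       (\<integral>\<^sup>+s. (\<Sum>i\<in>K. ennreal (\<rho> i (shift_pos t s))) * indicator A s \<partial>unit_meas) \<le> ennreal e"
proof -
  define w where "w s = (\<Sum>i\<in>K. ennreal (\<rho> i s))" for s
  define v where "v n s = w s * indicator {s. w s > of_nat n} s" for n :: nat and s
  have w [measurable]: "w \<in> borel_measurable unit_meas"
    unfolding w_def[abs_def] using K weight_measurable
    by (intro borel_measurable_sum measurable_compose[OF _ measurable_ennreal]) blast
  have v [measurable]: "v n \<in> borel_measurable unit_meas" for n
    unfolding v_def[abs_def] by measurable
  have "(\<integral>\<^sup>+s. w s \<partial>unit_meas) = (\<Sum>i\<in>K. \<integral>\<^sup>+s. ennreal (\<rho> i s) \<partial>unit_meas)"
    unfolding w_def using K weight_measurable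
    by (intro nn_integral_sum measurable_compose[OF _ measurable_ennreal]) blast
  also have "\<dots> < \<infinity>"
    using K nn_integral_weight_finite by (simp add: less_top subset_eq)
  finally have fin: "(\<integral>\<^sup>+s. w s \<partial>unit_meas) < \<infinity>" .
  have "(\<lambda>n. \<integral>\<^sup>+s. v n s \<partial>unit_meas) \<longlonglongrightarrow> (\<integral>\<^sup>+s. 0 \<partial>unit_meas)"
  proof (rule nn_integral_dominated_convergence[OF v _ w _ fin])
    show "AE s in unit_meas. v n s \<le> w s" for n
      by (intro AE_I2) (simp add: v_def split: split_indicator)
    show "AE s in unit_meas. (\<lambda>n. v n s) \<longlonglongrightarrow> 0"
    proof (rule AE_I2)
      fix s
      have "w s < \<infinity>" unfolding w_def using K by (simp add: less_top)
      then obtain r where r: "r \<ge> 0" "w s = ennreal r" by (cases "w s") auto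
      obtain n0 where n0: "r \<le> real n0" using real_arch_simple by blast
      have "v n s = 0" if "n \<ge> n0" for n
      proof -
        have "r \<le> real n" using that n0 by simp
        then have "\<not> w s > of_nat n"
          unfolding r(2) by (simp add: ennreal_of_nat_eq_real_of_nat not_less ennreal_leI)
        then show ?thesis by (simp add: v_def)
      qed
      then show "(\<lambda>n. v n s) \<longlonglongrightarrow> 0"
        by (intro tendsto_eventually eventually_sequentiallyI)
    qed
  qed simp
  then have "(\<lambda>n. \<integral>\<^sup>+s. v n s \<partial>unit_meas) \<longlonglongrightarrow> 0" by simp
  then have "\<forall>\<^sub>F n in sequentially. (\<integral>\<^sup>+s. v n s \<partial>unit_meas) < ennreal (e / 2)"
    using e by (intro order_tendstoD(2)) auto
  then obtain n where n: "(\<integral>\<^sup>+s. v n s \<partial>unit_meas) < ennreal (e / 2)"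
    by (auto simp: eventually_sequentially)
  \<comment> \<open>The bounded part then contributes at most e/2; the + 1 covers n = 0.\<close>
  define \<beta> where "\<beta> = e / (2 * (real n + 1))"
  have \<beta>: "\<beta> > 0" using e by (simp add: \<beta>_def)
  show thesis
  proof (rule that[OF \<beta>], intro ballI allI impI)
    fix A t assume A: "A \<in> sets unit_meas" "emeasure unit_meas A \<le> ennreal \<beta>" and t: "(t::real) \<ge> 0"
    have vs: "(\<lambda>s. v n (shift_pos t s)) \<in> borel_measurable unit_meas"
      by (rule measurable_compose[OF shift_pos_measurable[OF t] v])
    have "(\<integral>\<^sup>+s. (\<Sum>i\<in>K. ennreal (\<rho> i (shift_pos t s))) * indicator A s \<partial>unit_meas)
        \<le> (\<integral>\<^sup>+s. v n (shift_pos t s) + of_nat n * indicator A s \<partial>unit_meas)"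
    proof (rule nn_integral_mono)
      fix s
      show "(\<Sum>i\<in>K. ennreal (\<rho> i (shift_pos t s))) * indicator A s \<le> v n (shift_pos t s) + of_nat n * indicator A s"
        unfolding w_def[symmetric] v_def by (auto split: split_indicator simp: not_less)
    qed
    also have "\<dots> = (\<integral>\<^sup>+s. v n (shift_pos t s) \<partial>unit_meas) + of_nat n * emeasure unit_meas A"
      using A vs by (subst nn_integral_add) (auto simp: nn_integral_cmult_indicator)
    also have "\<dots> \<le> ennreal (e / 2) + of_nat n * ennreal \<beta>"
      using n A(2) nn_integral_shift_pos[OF t v] by (intro add_mono mult_left_mono) auto
    also have "\<dots> = ennreal (e / 2 + real n * \<beta>)"
      using e \<beta> by (simp add: ennreal_of_nat_eq_real_of_nat ennreal_mult ennreal_plus)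
    also have "\<dots> \<le> ennreal e"
    proof (rule ennreal_leI)
      have "real n * \<beta> \<le> (real n + 1) * \<beta>" using \<beta> by (intro mult_right_mono) auto
      also have "\<dots> = e / 2" by (simp add: \<beta>_def field_simps)
      finally show "e / 2 + real n * \<beta> \<le> e" by simp
    qed
    finally show "(\<integral>\<^sup>+s. (\<Sum>i\<in>K. ennreal (\<rho> i (shift_pos t s))) * indicator A s \<partial>unit_meas) \<le> ennreal e" .
  qed
qed

lemma return_times_superset_N_times:
  fixes f g :: "'i \<Rightarrow> real \<Rightarrow> 'k::{real_normed_field, euclidean_space}"
  assumes Kf: "finite K" "K \<subseteq> arcs G" and f: "f \<in> Lp_funs G p \<rho>" and g: "g \<in> Lp_funs G p \<rho>"
    and f_support: "\<And>i s. i \<notin> K \<Longrightarrow> f i s = 0" and g_support: "\<And>i s. i \<notin> K \<Longrightarrow> g i s = 0"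
    and f_bound: "\<And>i s. norm (f i s) \<le> B" and g_bound: "\<And>i s. norm (g i s) \<le> B"
    and r: "r > 0"
  obtains \<epsilon> \<alpha> where "0 < \<epsilon>" "0 < \<alpha>" "\<alpha> < 1"
    "N_times G p \<rho> K \<epsilon> \<alpha> \<subseteq> return_times (left_semigroup G p \<rho>) (Lp_ball f r) (Lp_ball g r)"
proof -
  \<comment> \<open>The factor \<open>1 + real (card K)\<close> provides \<open>f_bound\<close>; the
    + 1 keeps M positive.\<close>
  define M where "M = (1 + real (card K)) * (\<bar>B\<bar> + 1)"
  have Mpos: "M > 0" by (auto simp: M_def intro!: mult_pos_pos add_nonneg_pos add_pos_nonneg)
  define \<eta> where "\<eta> = r powr p"
  have \<eta>: "\<eta> > 0" using r by (simp add: \<eta>_def)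
  define c where "c = 2 powr p * M powr p"
  have c: "c > 0" using Mpos by (simp add: c_def)
  \<comment> \<open>The integral over E may use \<eta>/2 and the complement \<eta>/4, so the total
    stays strictly below \<eta>.\<close>
  define \<epsilon> where "\<epsilon> = \<eta> / (2 * c)"
  define e where "e = \<eta> / (4 * M powr p)"
  have pos: "\<epsilon> > 0" "e > 0" using c \<eta> Mpos by (simp_all add: \<epsilon>_def e_def)
  obtain \<beta> where \<beta>: "\<beta> > 0" and small: "\<forall>A\<in>sets unit_meas. \<forall>t\<ge>0. emeasure unit_meas A \<le> ennreal \<beta> \<longrightarrow>
       (\<integral>\<^sup>+s. (\<Sum>i\<in>K. ennreal (\<rho> i (shift_pos t s))) * indicator A s \<partial>unit_meas) \<le> ennreal e"
    using weight_uniformly_integrable[OF Kf pos(2)] .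
  \<comment> \<open>A set of measure above \<alpha> has a complement of measure below \<beta>; the
    maximum with 1/2 keeps \<alpha> positive.\<close>
  define \<alpha> where "\<alpha> = max (1 / 2) (1 - \<beta>)"
  have \<alpha>: "0 < \<alpha>" "\<alpha> < 1" "1 - \<alpha> \<le> \<beta>" using \<beta> by (auto simp: \<alpha>_def)
  have main: "t \<in> return_times (left_semigroup G p \<rho>) (Lp_ball f r) (Lp_ball g r)"
    if tN: "t \<in> N_times G p \<rho> K \<epsilon> \<alpha>" for t
  proof -
    have t0: "t \<ge> 0" using that by (simp add: N_times_def)
    obtain E where El: "E \<in> sets lebesgue" "E \<subseteq> {0..<1}" "measure lebesgue E > \<alpha>"
      and Q: "(\<integral>\<^sup>+ s\<in>E. (\<Sum>i\<in>K. Phi G p \<rho> i t s + Psi G p \<rho> i t s) \<partial>lebesgue) < ennreal \<epsilon>"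
      using tN unfolding N_times_def mem_Collect_eq INF_less_iff by blast
    have EU: "E \<in> sets unit_meas"
      using El by (auto simp: sets_restrict_space_iff)
    have data: "transition_data G p \<rho> t E K M f g"
    proof
      show "(1 + real (card K)) * norm (f i s) \<le> M" for i s
        unfolding M_def using f_bound[of i s] by (intro mult_left_mono) auto
      have "1 * (\<bar>B\<bar> + 1) \<le> M"
        unfolding M_def by (intro mult_right_mono) auto
      then show "norm (g i s) \<le> M" for i s
        using g_bound[of i s] by simp
      show "0 \<le> M" using Mpos by simp
    qed (fact t0 EU Kf f g f_support g_support)+
    have comp: "{0..<1} - E \<in> sets unit_meas"
      using sets.compl_sets[OF EU] by simp
    have compl: "emeasure unit_meas ({0..<1} - E) \<le> ennreal \<beta>"
    proof -
      interpret U: finite_measure unit_meas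
        by (rule finite_measureI) (simp add: emeasure_unit_meas_unit)
      have "measure unit_meas (space unit_meas - E) = measure unit_meas (space unit_meas) - measure unit_meas E"
        by (rule U.finite_measure_compl[OF EU])
      moreover have "measure unit_meas (space unit_meas) = 1"
        using emeasure_unit_meas_unit by (simp add: measure_def)
      moreover have "measure unit_meas E = measure lebesgue E"
        using El by (intro measure_restrict_space) auto
      ultimately have "measure unit_meas ({0..<1} - E) \<le> \<beta>"
        using El(3) \<alpha>(3) by simp
      then show ?thesis
        by (simp add: U.emeasure_eq_measure ennreal_leI)
    qed
    have lt: "ennreal (2 powr p * M powr p) * (\<integral>\<^sup>+ s\<in>E. (\<Sum>i\<in>K. Phi G p \<rho> i t s + Psi G p \<rho> i t s) \<partial>lebesgue)
        + ennreal (M powr p) * z < ennreal \<eta>" if "z \<le> ennreal e" for z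
    proof -
      have "ennreal (2 powr p * M powr p) * (\<integral>\<^sup>+ s\<in>E. (\<Sum>i\<in>K. Phi G p \<rho> i t s + Psi G p \<rho> i t s) \<partial>lebesgue)
          + ennreal (M powr p) * z \<le> ennreal c * ennreal \<epsilon> + ennreal (M powr p) * ennreal e"
        unfolding c_def by (intro add_mono mult_left_mono less_imp_le[OF Q] that) auto
      also have "\<dots> = ennreal (c * \<epsilon> + M powr p * e)"
        using c pos by (simp add: ennreal_mult ennreal_plus)
      also have "c * \<epsilon> + M powr p * e = \<eta> / 2 + \<eta> / 4"
        using c Mpos by (simp add: \<epsilon>_def e_def)
      also have "ennreal (\<eta> / 2 + \<eta> / 4) < ennreal \<eta>"
        using \<eta> by (intro ennreal_lessI) auto
      finally show ?thesis .
    qed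
    \<comment> \<open>The estimate for the translate has unrotated weights; it is the case of time 0
      in \<open>small\<close>.\<close>
    have "(\<integral>\<^sup>+s. (\<Sum>i\<in>K. ennreal (\<rho> i s)) * indicator ({0..<1} - E) s \<partial>unit_meas)
        = (\<integral>\<^sup>+s. (\<Sum>i\<in>K. ennreal (\<rho> i (shift_pos 0 s))) * indicator ({0..<1} - E) s \<partial>unit_meas)"
    proof (rule nn_integral_cong)
      fix s assume "s \<in> space unit_meas"
      then have "shift_pos 0 s = s"
        using shift_pos_eq_frac[of 0 s] frac_eq[of s] by simp
      then show "(\<Sum>i\<in>K. ennreal (\<rho> i s)) * indicator ({0..<1} - E) s
          = (\<Sum>i\<in>K. ennreal (\<rho> i (shift_pos 0 s))) * indicator ({0..<1} - E) s"
        by (simp only:)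
    qed
    also have "\<dots> \<le> ennreal e"
      by (rule small[rule_format, OF comp _ compl]) simp
    finally have small0: "(\<integral>\<^sup>+s. (\<Sum>i\<in>K. ennreal (\<rho> i s)) * indicator ({0..<1} - E) s \<partial>unit_meas) \<le> ennreal e" .
    show ?thesis
      by (rule transition_data.return_time_if_estimates_small[OF data Mpos r
            lt[OF small[rule_format, OF comp t0 compl], unfolded \<eta>_def] lt[OF small0, unfolded \<eta>_def]])
  qed
  show thesis
  proof (rule that[OF pos(1) \<alpha>(1,2)])
    show "N_times G p \<rho> K \<epsilon> \<alpha> \<subseteq> return_times (left_semigroup G p \<rho>) (Lp_ball f r) (Lp_ball g r)"
      by (rule subsetI) (rule main)
  qed
qed

lemma Lp_ball_subset:
  fixes f f' :: "'i \<Rightarrow> real \<Rightarrow> 'k::{real_normed_field, euclidean_space}"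
  assumes "f \<in> Lp_funs G p \<rho>" "f' \<in> Lp_funs G p \<rho>" "Lp_norm G p \<rho> (\<lambda>i s. f' i s - f i s) < a"
  shows "Lp_ball f' b \<subseteq> Lp_ball f (a + b)"
proof -
  interpret Metric_space "Lp_space G p \<rho>" "Lp_dist G p \<rho> :: ('i \<Rightarrow> real \<Rightarrow> 'k) set \<Rightarrow> _"
    by (rule Metric_space_Lp[OF weight p])
  have "Lp_class f' \<in> Lp_ball f a"
    using Lp_class_in_ball_iff[OF assms(1,2)] assms(3) by blast
  then have d: "Lp_dist G p \<rho> (Lp_class f) (Lp_class f') < a"
    and sp: "Lp_class f \<in> Lp_space G p \<rho>" "Lp_class f' \<in> Lp_space G p \<rho>"
    by (simp_all only: in_mball)
  show ?thesis
  proof (rule subsetI)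
    fix A assume "A \<in> Lp_ball f' b"
    then have A: "A \<in> Lp_space G p \<rho>" "Lp_dist G p \<rho> (Lp_class f') A < b"
      by (simp_all only: in_mball)
    have "Lp_dist G p \<rho> (Lp_class f) A \<le> Lp_dist G p \<rho> (Lp_class f) (Lp_class f') + Lp_dist G p \<rho> (Lp_class f') A"
      by (rule triangle[OF sp A(1)])
    then have "Lp_dist G p \<rho> (Lp_class f) A < a + b"
      using d A(2) by linarith
    then show "A \<in> Lp_ball f (a + b)"
      using sp A by (simp only: in_mball)
  qed
qed

lemma arcs_nonempty: "arcs G \<noteq> {}"
proof -
  obtain v where "v \<in> verts G"
    using tree unfolding tree_def Digraph_Component.connected_def strongly_connected_def
    by auto
  then obtain u where "u \<rightarrow> v"
    using rootless by (meson rootless_def)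
  then show ?thesis by auto
qed

text \<open>Open sets contain balls around arbitrary elements; moving the centres by less than half
  the smaller radius makes them bounded and finitely supported, the case already treated.\<close>

lemma F_transitive_if_N_times:
  assumes F: "Furstenberg_family F"
    and N: "\<And>K \<epsilon> \<alpha>. \<lbrakk>finite K; K \<noteq> {}; K \<subseteq> arcs G; 0 < \<epsilon>; 0 < \<alpha>; \<alpha> < 1\<rbrakk> \<Longrightarrow> N_times G p \<rho> K \<epsilon> \<alpha> \<in> F"
  shows "F_transitive F (Lp_topology G p \<rho> :: ('i \<Rightarrow> real \<Rightarrow> 'k::{real_normed_field, euclidean_space}) set topology)
    (left_semigroup G p \<rho>)"
  unfolding F_transitive_def
proof (intro allI impI, elim conjE)
  fix U V :: "('i \<Rightarrow> real \<Rightarrow> 'k) set set"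
  assume U: "openin (Lp_topology G p \<rho>) U" "U \<noteq> {}" and V: "openin (Lp_topology G p \<rho>) V" "V \<noteq> {}"
  obtain f0 r1 where f0: "f0 \<in> Lp_funs G p \<rho>" "r1 > 0" "Lp_ball f0 r1 \<subseteq> U"
    using openin_Lp_topologyE[OF U] .
  obtain g0 r2 where g0: "g0 \<in> Lp_funs G p \<rho>" "r2 > 0" "Lp_ball g0 r2 \<subseteq> V"
    using openin_Lp_topologyE[OF V] .
  define r where "r = min r1 r2 / 2"
  have r: "r > 0" "r + r \<le> r1" "r + r \<le> r2" using f0 g0 by (simp_all add: r_def)
  obtain f :: "'i \<Rightarrow> real \<Rightarrow> 'k" and K1 B1 where f: "f \<in> Lp_funs G p \<rho>" "Lp_norm G p \<rho> (\<lambda>i s. f i s - f0 i s) < r"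
    "finite K1" "K1 \<subseteq> arcs G" "B1 \<ge> 0" "\<forall>i s. i \<notin> K1 \<longrightarrow> f i s = 0" "\<forall>i s. norm (f i s) \<le> B1"
    using bounded_finite_support_dense[OF f0(1) r(1)] .
  obtain g :: "'i \<Rightarrow> real \<Rightarrow> 'k" and K2 B2 where g: "g \<in> Lp_funs G p \<rho>" "Lp_norm G p \<rho> (\<lambda>i s. g i s - g0 i s) < r"
    "finite K2" "K2 \<subseteq> arcs G" "B2 \<ge> 0" "\<forall>i s. i \<notin> K2 \<longrightarrow> g i s = 0" "\<forall>i s. norm (g i s) \<le> B2"
    using bounded_finite_support_dense[OF g0(1) r(1)] .
  obtain i0 where i0: "i0 \<in> arcs G" using arcs_nonempty by blast
  \<comment> \<open>The extra edge keeps K nonempty even if both supports are empty.\<close>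
  define K where "K = insert i0 (K1 \<union> K2)"
  have K: "finite K" "K \<noteq> {}" "K \<subseteq> arcs G" using f g i0 by (auto simp: K_def)
  have fB: "norm (f i s) \<le> B1 + B2" and gB: "norm (g i s) \<le> B1 + B2" for i s
    using f(7)[rule_format, of i s] g(7)[rule_format, of i s] f(5) g(5) by simp_all
  have fK: "i \<notin> K \<Longrightarrow> f i s = 0" and gK: "i \<notin> K \<Longrightarrow> g i s = 0" for i s
    using f(6)[rule_format, of i s] g(6)[rule_format, of i s] by (simp_all add: K_def)
  obtain \<epsilon> \<alpha> where \<epsilon>\<alpha>: "0 < \<epsilon>" "0 < \<alpha>" "\<alpha> < 1"
    "N_times G p \<rho> K \<epsilon> \<alpha> \<subseteq> return_times (left_semigroup G p \<rho>) (Lp_ball f r) (Lp_ball g r)"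
    using return_times_superset_N_times[OF K(1,3) f(1) g(1) fK gK fB gB r(1)] .
  have "Lp_ball f r \<subseteq> Lp_ball f0 (r + r)" "Lp_ball g r \<subseteq> Lp_ball g0 (r + r)"
    by (rule Lp_ball_subset[OF f0(1) f(1,2)], rule Lp_ball_subset[OF g0(1) g(1,2)])
  moreover have "Lp_ball f0 (r + r) \<subseteq> Lp_ball f0 r1" "Lp_ball g0 (r + r) \<subseteq> Lp_ball g0 r2"
  proof -
    interpret Metric_space "Lp_space G p \<rho>" "Lp_dist G p \<rho> :: ('i \<Rightarrow> real \<Rightarrow> 'k) set \<Rightarrow> _"
      by (rule Metric_space_Lp[OF weight p])
    show "Lp_ball f0 (r + r) \<subseteq> Lp_ball f0 r1" "Lp_ball g0 (r + r) \<subseteq> Lp_ball g0 r2"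
      using r by (simp_all add: mball_subset_concentric)
  qed
  ultimately have "Lp_ball f r \<subseteq> U" "Lp_ball g r \<subseteq> V"
    using f0(3) g0(3) by blast+
  then have "N_times G p \<rho> K \<epsilon> \<alpha> \<subseteq> return_times (left_semigroup G p \<rho>) U V"
    by (rule subset_trans[OF \<epsilon>\<alpha>(4) return_times_mono])
  then show "return_times (left_semigroup G p \<rho>) U V \<in> F"
    by (rule Furstenberg_family_superset[OF F N[OF K \<epsilon>\<alpha>(1-3)] _ return_times_nonneg])
qed

text \<open>Recurrence is tested on a ball around \<open>one_on K\<close>; finite invariance removes
  the times up to R, when fibers over K may still meet K.\<close>

lemma N_times_if_F_recurrent:
  assumes F: "Furstenberg_family F" "finite_invariant F"
    and rec: "F_recurrent F (Lp_topology G p \<rho> :: ('i \<Rightarrow> real \<Rightarrow> 'k::{real_normed_field, euclidean_space}) set topology)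
      (left_semigroup G p \<rho>)"
    and K: "finite K" "K \<noteq> {}" "K \<subseteq> arcs G" and "0 < \<epsilon>" "\<alpha> < 1"
  shows "N_times G p \<rho> K \<epsilon> \<alpha> \<in> F"
proof -
  let ?f = "one_on K :: 'i \<Rightarrow> real \<Rightarrow> 'k"
  obtain d R where d: "d > 0" "R > 0" and sub:
    "return_times (left_semigroup G p \<rho>) (Lp_ball ?f d) (Lp_ball ?f d) \<inter> {R<..} \<subseteq> N_times G p \<rho> K \<epsilon> \<alpha>"
    using N_times_superset_return_times[OF K assms(7,8)] .
  have one: "?f \<in> Lp_funs G p \<rho>" by (rule one_on_in_Lp[OF K(1,3)])
  have "Lp_norm G p \<rho> (\<lambda>i s. ?f i s - ?f i s) = 0"
    using p by (simp add: Lp_norm_def Lp_modular_def)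
  then have "Lp_class ?f \<in> Lp_ball ?f d"
    using Lp_class_in_ball_iff[OF one one] d(1) by simp
  then have "Lp_ball ?f d \<noteq> {}"
    by (metis empty_iff)
  then have "return_times (left_semigroup G p \<rho>) (Lp_ball ?f d) (Lp_ball ?f d) \<in> F"
    using rec[unfolded F_recurrent_def, rule_format, OF conjI, OF openin_Lp_ball] by simp
  then have "return_times (left_semigroup G p \<rho>) (Lp_ball ?f d) (Lp_ball ?f d) \<inter> {R<..} \<in> F"
    by (rule F(2)[unfolded finite_invariant_def, rule_format, OF _ d(2)])
  moreover have "N_times G p \<rho> K \<epsilon> \<alpha> \<subseteq> {0..}"
    by (auto simp: N_times_def)
  ultimately show ?thesis
    by (rule Furstenberg_family_superset[OF F(1) _ sub])
qed

end

lemma F_recurrent_if_F_transitive: "F_transitive F X T \<Longrightarrow> F_recurrent F X T"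
  unfolding F_transitive_def F_recurrent_def by blast

theorem theorem3p5:
  fixes G :: "('v, 'i) pre_digraph"
    and p :: real
    and \<rho> :: "'i \<Rightarrow> real \<Rightarrow> real"
    and F :: "real set set"
  assumes "directed_tree G" "rootless G" "leafless G"
    and "1 < p" "weight G \<rho>" "p_admissible G p \<rho>"
    and "Furstenberg_family F" "proper_family F" "finite_invariant F"
  shows "(F_transitive F
            (Lp_topology G p \<rho> :: ('i \<Rightarrow> real \<Rightarrow> 'k::{real_normed_field, euclidean_space}) set topology)
            (left_semigroup G p \<rho>)
          \<longleftrightarrow> (\<forall>K \<epsilon> \<alpha>. finite K \<and> K \<noteq> {} \<and> K \<subseteq> arcs G \<and> 0 < \<epsilon> \<and> 0 < \<alpha> \<and> \<alpha> < 1
                 \<longrightarrow> N_times G p \<rho> K \<epsilon> \<alpha> \<in> F))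
       \<and> ((\<forall>K \<epsilon> \<alpha>. finite K \<and> K \<noteq> {} \<and> K \<subseteq> arcs G \<and> 0 < \<epsilon> \<and> 0 < \<alpha> \<and> \<alpha> < 1
                 \<longrightarrow> N_times G p \<rho> K \<epsilon> \<alpha> \<in> F)
          \<longleftrightarrow> F_recurrent F
            (Lp_topology G p \<rho> :: ('i \<Rightarrow> real \<Rightarrow> 'k) set topology)
            (left_semigroup G p \<rho>))"
proof -
  interpret directed_tree G by fact
  interpret weighted_tree G p \<rho>
    by unfold_locales fact+
  let ?X = "Lp_topology G p \<rho> :: ('i \<Rightarrow> real \<Rightarrow> 'k) set topology"
  let ?N = "\<forall>K \<epsilon> \<alpha>. finite K \<and> K \<noteq> {} \<and> K \<subseteq> arcs G \<and> 0 < \<epsilon> \<and> 0 < \<alpha> \<and> \<alpha> < 1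
    \<longrightarrow> N_times G p \<rho> K \<epsilon> \<alpha> \<in> F"
  have 1: "F_transitive F ?X (left_semigroup G p \<rho>)" if N: ?N
    using assms(7) by (rule F_transitive_if_N_times) (use N in simp)
  have 2: "F_recurrent F ?X (left_semigroup G p \<rho>)" if "F_transitive F ?X (left_semigroup G p \<rho>)"
    using that by (rule F_recurrent_if_F_transitive)
  have 3: ?N if "F_recurrent F ?X (left_semigroup G p \<rho>)"
    using N_times_if_F_recurrent[OF assms(7,9) that] by simp
  show ?thesis
    using 1 2 3 by argo
qed

end
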